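(* (i) For every integer $s \ge 1$, the group $\mathcal{GT}_1(\mathrm{PSL}(2, 2^s))$ is trivial. (ii) When $q$ is odd (a power of an odd prime), the group $\mathcal{GT}_1(\mathrm{PSL}(2, q))$ is isomorphic to a product $$C_2^{n_1} \times D_8^{n_2}$$ for some integers $n_1, n_2$.
   Context: $C_2$ is the cyclic group of order $2$ and $D_8$ is the dihedral group of order $8$. Definition of $\mathcal{GT}_1(G)$. The following definition is suitable only when the finite group $G$ is non-abelian and simple, such as $G=\mathrm{PSL}(2,q)$; for other finite groups $\mathcal{GT}_1(G)$ has a more general definition, given in P. Guillot, "The Grothendieck-Teichmüller group of a finite group and $G$-dessins d'enfants". Let $\mathscr{T}$ be the set of triples $(x,y,z) \in G^3$ such that $xyz = 1$ and $\langle x,y,z\rangle = G$. Let $\mathscr{T}/G$ be the set of orbits of $\mathscr{T}$ under simultaneous conjugation by elements of $G$, and write $[x,y,z]$ for the class of $(x,y,z)$. The group $Out(G)$ of outer automorphisms acts (freely) on $\mathscr{T}/G$ by applying an automorphism to all three coordinates. The symmetric group $S_3$ acts on $\mathscr{T}/G$ by letting the transposition $(12)$ act as $\theta \cdot [x,y,z] = [y,x,z^x]$ and the transposition $(13)$ act as $\delta\cdot[x,y,z] = [z,y,x^y]$, where $g^h = h^{-1}gh$. These two actions commute, so $H := Out(G) \times S_3$ acts on $\mathscr{T}/G$. Write $[x,y,z] \equiv [x',y',z']$ when $x$ is a conjugate of $x'$, $y$ is a conjugate of $y'$, and $z$ is a conjugate of $z'$ in $G$; this is an equivalence relation on $\mathscr{T}/G$.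 Then $\mathcal{GT}_1(G)$ is the group of all permutations $\varphi$ of the set $\mathscr{T}/G$ such that - $\varphi$ commutes with the action of $H$: $\varphi(h \cdot t) = h\cdot \varphi(t)$ for all $h \in H$ and $t \in \mathscr{T}/G$; - $\varphi$ is compatible with $\equiv$: for $t,t'\in\mathscr{T}/G$, $t \equiv t'$ implies $\varphi(t) \equiv \varphi(t')$.
   Formalization: Compatibility with ≡ is taken as φ(t) ≡ t for all t; with "t ≡ t' implies φ(t) ≡ φ(t')" part (i) fails for PSL(2,4), where the outer automorphism gives a nontrivial element. The definition for simple groups is used also for q = 2, 3. *)

theory Defs
  imports "HOL-Analysis.Analysis" "HOL-Algebra.Algebra"
begin

section \<open>The group \<open>PSL\<close> over a field\<close>

definition SL :: "('k::field ^ 'n::finite ^ 'n) monoid" where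
  "SL = \<lparr>carrier = {A. det A = 1}, mult = (**), one = mat 1\<rparr>"

definition SL_scalars :: "('k::field ^ 'n::finite ^ 'n) set" where
  "SL_scalars = {A \<in> carrier SL. \<exists>c. A = mat c}"

definition PSL :: "('k::field ^ 'n::finite ^ 'n) set monoid" where
  "PSL = SL Mod SL_scalars"

section \<open>Generating triples up to conjugation\<close>

definition conj_by :: "('a, 'b) monoid_scheme \<Rightarrow> 'a \<Rightarrow> 'a \<Rightarrow> 'a" where
  "conj_by G g h = inv\<^bsub>G\<^esub> h \<otimes>\<^bsub>G\<^esub> g \<otimes>\<^bsub>G\<^esub> h"

definition map_triple :: "('a \<Rightarrow> 'c) \<Rightarrow> 'a \<times> 'a \<times> 'a \<Rightarrow> 'c \<times> 'c \<times> 'c" where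
  "map_triple f = (\<lambda>(x, y, z). (f x, f y, f z))"

definition triples :: "('a, 'b) monoid_scheme \<Rightarrow> ('a \<times> 'a \<times> 'a) set" where
  "triples G = {(x, y, z). x \<in> carrier G \<and> y \<in> carrier G \<and> z \<in> carrier G \<and>
     x \<otimes>\<^bsub>G\<^esub> y \<otimes>\<^bsub>G\<^esub> z = \<one>\<^bsub>G\<^esub> \<and> generate G {x, y, z} = carrier G}"

definition triple_class :: "('a, 'b) monoid_scheme \<Rightarrow> 'a \<times> 'a \<times> 'a \<Rightarrow> ('a \<times> 'a \<times> 'a) set" where
  "triple_class G t = (\<lambda>h. map_triple (\<lambda>g. conj_by G g h) t) ` carrier G"

definition triple_classes :: "('a, 'b) monoid_scheme \<Rightarrow> ('a \<times> 'a \<times> 'a) set set" where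
  "triple_classes G = triple_class G ` triples G"

section \<open>The action of \<open>Out(G) \<times> S\<^sub>3\<close>\<close>

definition Inn :: "('a, 'b) monoid_scheme \<Rightarrow> ('a \<Rightarrow> 'a) set" where
  "Inn G = (\<lambda>h. \<lambda>g\<in>carrier G. conj_by G g h) ` carrier G"

definition Out :: "('a, 'b) monoid_scheme \<Rightarrow> ('a \<Rightarrow> 'a) set monoid" where
  "Out G = AutoGroup G Mod Inn G"

text \<open>An outer automorphism is a coset \<open>A\<close> of automorphisms.  All the members of \<open>A\<close> send
  the class \<open>c\<close> onto one and the same class (lemma \<open>Out_act_eq\<close>), which is therefore the
  union below.\<close>

definition Out_act :: "('a \<Rightarrow> 'a) set \<Rightarrow> ('a \<times> 'a \<times> 'a) set \<Rightarrow> ('a \<times> 'a \<times> 'a) set" where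
  "Out_act A c = (\<Union>\<alpha>\<in>A. map_triple \<alpha> ` c)"

definition theta :: "('a, 'b) monoid_scheme \<Rightarrow> 'a \<times> 'a \<times> 'a \<Rightarrow> 'a \<times> 'a \<times> 'a" where
  "theta G = (\<lambda>(x, y, z). (y, x, conj_by G z x))"

definition delta :: "('a, 'b) monoid_scheme \<Rightarrow> 'a \<times> 'a \<times> 'a \<Rightarrow> 'a \<times> 'a \<times> 'a" where
  "delta G = (\<lambda>(x, y, z). (z, y, conj_by G x y))"

text \<open>\<open>theta\<close> and \<open>delta\<close> are maps on triples; the induced maps on classes are the images.
  The action of \<open>S\<^sub>3\<close> is given on the transpositions \<open>(1 2)\<close> and \<open>(1 3)\<close>; the remaining
  elements are words in these two, the last case being \<open>(2 3) = (1 2)(1 3)(1 2)\<close>.  That this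
  is an action is part of \<open>H_action\<close> below.\<close>

definition S3_act :: "('a, 'b) monoid_scheme \<Rightarrow> (nat \<Rightarrow> nat) \<Rightarrow>
    ('a \<times> 'a \<times> 'a) set \<Rightarrow> ('a \<times> 'a \<times> 'a) set" where
  "S3_act G p c =
    (if p = id then c
     else if p = Transposition.transpose 1 2 then theta G ` c
     else if p = Transposition.transpose 1 3 then delta G ` c
     else if p = Transposition.transpose 1 2 \<circ> Transposition.transpose 1 3 then theta G ` delta G ` c
     else if p = Transposition.transpose 1 3 \<circ> Transposition.transpose 1 2 then delta G ` theta G ` c
     else theta G ` delta G ` theta G ` c)"

definition H_group :: "('a, 'b) monoid_scheme \<Rightarrow> (('a \<Rightarrow> 'a) set \<times> (nat \<Rightarrow> nat)) monoid" where
  "H_group G = Out G \<times>\<times> sym_group 3"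

definition H_act :: "('a, 'b) monoid_scheme \<Rightarrow> ('a \<Rightarrow> 'a) set \<times> (nat \<Rightarrow> nat) \<Rightarrow>
    ('a \<times> 'a \<times> 'a) set \<Rightarrow> ('a \<times> 'a \<times> 'a) set" where
  "H_act G h = (\<lambda>c\<in>triple_classes G. Out_act (fst h) (S3_act G (snd h) c))"

section \<open>The group \<open>GT\<^sub>1\<close>\<close>

definition conjugate :: "('a, 'b) monoid_scheme \<Rightarrow> 'a \<Rightarrow> 'a \<Rightarrow> bool" where
  "conjugate G x x' \<longleftrightarrow> (\<exists>h\<in>carrier G. x = conj_by G x' h)"

definition class_equiv :: "('a, 'b) monoid_scheme \<Rightarrow>
    ('a \<times> 'a \<times> 'a) set \<Rightarrow> ('a \<times> 'a \<times> 'a) set \<Rightarrow> bool" where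
  "class_equiv G c c' \<longleftrightarrow> (\<exists>(x, y, z)\<in>c. \<exists>(x', y', z')\<in>c'.
     conjugate G x x' \<and> conjugate G y y' \<and> conjugate G z z')"

text \<open>Compatibility of \<open>\<phi>\<close> with \<open>\<equiv>\<close> means that \<open>\<phi>\<close> maps every class \<open>c\<close> to a class
  equivalent to \<open>c\<close>, i.e. that \<open>\<phi>\<close> preserves each of the three conjugacy classes.  Asking only
  that \<open>\<phi>\<close> respect the relation (\<open>c \<equiv> c'\<close> implies \<open>\<phi> c \<equiv> \<phi> c'\<close>) would be too weak: the
  action of any central element of \<open>Out(G)\<close> commutes with \<open>Out(G) \<times> S\<^sub>3\<close> and respects \<open>\<equiv>\<close>, so
  for \<open>G = PSL(2, 2\<^sup>s)\<close> with \<open>s \<ge> 2\<close> the resulting group would contain the cyclic group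
  \<open>Out(G)\<close> of order \<open>s\<close> and would not be trivial.\<close>

definition GT1 :: "('a, 'b) monoid_scheme \<Rightarrow> (('a \<times> 'a \<times> 'a) set \<Rightarrow> ('a \<times> 'a \<times> 'a) set) monoid" where
  "GT1 G = BijGroup (triple_classes G)
     \<lparr>carrier := {\<phi> \<in> Bij (triple_classes G).
        (\<forall>h\<in>carrier (H_group G). \<forall>c\<in>triple_classes G. \<phi> (H_act G h c) = H_act G h (\<phi> c)) \<and>
        (\<forall>c\<in>triple_classes G. class_equiv G (\<phi> c) c)}\<rparr>"

section \<open>Dihedral groups and powers of groups\<close>

text \<open>\<open>(k, b)\<close> is the symmetry \<open>r\<^sup>k s\<^sup>b\<close> of the regular \<open>n\<close>-gon, where \<open>r\<close> is a rotation of
  order \<open>n\<close> and \<open>s\<close> a reflection, so that \<open>s r s = r\<^sup>-\<^sup>1\<close>.  The argument \<open>n\<close> is half of the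
  order of the group.\<close>

definition dihedral :: "nat \<Rightarrow> (int \<times> bool) monoid" where
  "dihedral n =
    \<lparr>carrier = {0..<int n} \<times> UNIV,
     mult = (\<lambda>(k, b) (l, c). ((k + (if b then - l else l)) mod int n, b \<noteq> c)),
     one = (0, False)\<rparr>"

abbreviation "C2 \<equiv> integer_mod_group 2"

abbreviation "D8 \<equiv> dihedral 4"

abbreviation group_power :: "('a, 'b) monoid_scheme \<Rightarrow> nat \<Rightarrow> (nat \<Rightarrow> 'a) monoid" where
  "group_power G n \<equiv> product_group {..<n} (\<lambda>_. G)"

section \<open>The objects above are well defined\<close>


lemma group_SL: "group (SL :: ('k::field ^ 'n::finite ^ 'n) monoid)"
proof (rule groupI)
  fix A :: "'k ^ 'n ^ 'n" assume A: "A \<in> carrier SL"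
  then have d: "det A = 1" by (simp add: SL_def)
  then obtain B where B: "A ** B = mat 1" "B ** A = mat 1"
    using invertible_det_nz[of A] unfolding invertible_def by auto
  have "det B = 1" using d B(2) det_mul[of B A] by (simp add: det_I)
  then show "\<exists>B\<in>carrier SL. B \<otimes>\<^bsub>SL\<^esub> A = \<one>\<^bsub>SL\<^esub>"
    using B by (auto simp: SL_def)
qed (auto simp: SL_def det_mul det_I matrix_mul_assoc)

lemma mat_mul_left: "mat c ** (A :: 'k::field ^ 'n::finite ^ 'n) = (\<chi> i j. c * A $ i $ j)"
  by (simp add: matrix_matrix_mult_def mat_def vec_eq_iff if_distrib if_distribR
      sum.delta cong: if_cong)

lemma mat_mul_right: "(A :: 'k::field ^ 'n::finite ^ 'n) ** mat c = (\<chi> i j. c * A $ i $ j)"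
  by (simp add: matrix_matrix_mult_def mat_def vec_eq_iff if_distrib if_distribR
      sum.delta' mult.commute cong: if_cong)

lemma normal_SL_scalars: "(SL_scalars :: ('k::field ^ 'n::finite ^ 'n) set) \<lhd> SL"
proof -
  interpret group "SL :: ('k ^ 'n ^ 'n) monoid" by (rule group_SL)
  have central: "x \<otimes>\<^bsub>SL\<^esub> h = h \<otimes>\<^bsub>SL\<^esub> x" if "h \<in> SL_scalars" for x h :: "'k ^ 'n ^ 'n"
    using that by (auto simp: SL_scalars_def SL_def mat_mul_left mat_mul_right)
  have mm: "mat c ** mat d = (mat (c * d) :: 'k ^ 'n ^ 'n)" for c d
    by (simp add: mat_mul_left) (simp add: mat_def vec_eq_iff)
  show ?thesis
  proof (rule normal_invI)
    show "subgroup (SL_scalars :: ('k ^ 'n ^ 'n) set) SL"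
    proof (rule subgroupI)
      have "(mat 1 :: 'k ^ 'n ^ 'n) \<in> SL_scalars"
        unfolding SL_scalars_def SL_def by (auto simp: det_I)
      then show "(SL_scalars :: ('k ^ 'n ^ 'n) set) \<noteq> {}" by blast
    next
      fix a :: "'k ^ 'n ^ 'n" assume "a \<in> SL_scalars"
      then obtain c where a: "a \<in> carrier SL" "a = mat c" by (auto simp: SL_scalars_def)
      then have "c \<noteq> 0" by (metis (mono_tags) SL_def det_0 mem_Collect_eq partial_object.select_convs(1) zero_neq_one)
      then have "mat (inverse c) ** a = mat 1" by (simp add: a mm)
      moreover have "det (mat (inverse c) ** a) = det (mat (inverse c) :: 'k ^ 'n ^ 'n)"
        using a by (simp add: det_mul SL_def)
      ultimately have "inv\<^bsub>SL\<^esub> a = mat (inverse c)"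
        using a by (intro inv_equality) (auto simp: SL_def det_I)
      then show "inv\<^bsub>SL\<^esub> a \<in> SL_scalars"
        using inv_closed[OF a(1)] unfolding SL_scalars_def by auto
    next
      fix a b :: "'k ^ 'n ^ 'n" assume "a \<in> SL_scalars" "b \<in> SL_scalars"
      then show "a \<otimes>\<^bsub>SL\<^esub> b \<in> SL_scalars"
        by (auto simp: SL_scalars_def) (auto simp: SL_def mm)
    qed (auto simp: SL_scalars_def)
  next
    fix x h :: "'k ^ 'n ^ 'n" assume "x \<in> carrier SL" "h \<in> SL_scalars"
    then have "h \<in> carrier SL" by (auto simp: SL_scalars_def)
    then have "x \<otimes>\<^bsub>SL\<^esub> h \<otimes>\<^bsub>SL\<^esub> inv\<^bsub>SL\<^esub> x = h"
      using \<open>x \<in> carrier SL\<close> by (simp add: central[OF \<open>h \<in> SL_scalars\<close>] m_assoc)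
    then show "x \<otimes>\<^bsub>SL\<^esub> h \<otimes>\<^bsub>SL\<^esub> inv\<^bsub>SL\<^esub> x \<in> SL_scalars" using \<open>h \<in> SL_scalars\<close> by simp
  qed
qed

lemma group_PSL: "group (PSL :: ('k::field ^ 'n::finite ^ 'n) set monoid)"
  unfolding PSL_def by (rule normal.factorgroup_is_group[OF normal_SL_scalars])

context group begin

lemma cancel_inv [simp]:
  "x \<in> carrier G \<Longrightarrow> y \<in> carrier G \<Longrightarrow> x \<otimes> (inv x \<otimes> y) = y"
  "x \<in> carrier G \<Longrightarrow> y \<in> carrier G \<Longrightarrow> inv x \<otimes> (x \<otimes> y) = y"
  by (simp_all flip: m_assoc)

lemma conj_by_closed [simp, intro]: "g \<in> carrier G \<Longrightarrow> h \<in> carrier G \<Longrightarrow> conj_by G g h \<in> carrier G"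
  by (simp add: conj_by_def)

lemma conj_by_conj_by:
  "g \<in> carrier G \<Longrightarrow> h \<in> carrier G \<Longrightarrow> k \<in> carrier G \<Longrightarrow>
    conj_by G (conj_by G g h) k = conj_by G g (h \<otimes> k)"
  by (simp add: conj_by_def inv_mult_group m_assoc)

lemma conj_by_one [simp]: "g \<in> carrier G \<Longrightarrow> conj_by G g \<one> = g"
  by (simp add: conj_by_def)

lemma conj_by_mult: "x \<in> carrier G \<Longrightarrow> y \<in> carrier G \<Longrightarrow> h \<in> carrier G \<Longrightarrow>
    conj_by G (x \<otimes> y) h = conj_by G x h \<otimes> conj_by G y h"
  by (simp add: conj_by_def m_assoc)

lemma autoD:
  assumes "\<alpha> \<in> auto G"
  shows "\<alpha> \<in> hom G G" "\<alpha> ` carrier G = carrier G" "\<And>x. x \<in> carrier G \<Longrightarrow> \<alpha> x \<in> carrier G"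
    "inj_on \<alpha> (carrier G)"
  using assms by (auto simp: auto_def Bij_def bij_betw_def)

lemma auto_conj_by:
  assumes "\<alpha> \<in> auto G" "g \<in> carrier G" "h \<in> carrier G"
  shows "\<alpha> (conj_by G g h) = conj_by G (\<alpha> g) (\<alpha> h)"
proof -
  interpret a: group_hom G G \<alpha>
    using autoD(1)[OF assms(1)] by (simp add: group_hom_def group_hom_axioms_def is_group)
  show ?thesis using assms by (simp add: conj_by_def)
qed

lemma inner_auto: "h \<in> carrier G \<Longrightarrow> (\<lambda>g\<in>carrier G. conj_by G g h) \<in> auto G"
proof -
  assume h: "h \<in> carrier G"
  have "bij_betw (\<lambda>g\<in>carrier G. conj_by G g h) (carrier G) (carrier G)"
    using h by (intro bij_betw_byWitness[where f' = "\<lambda>g. conj_by G g (inv h)"])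
      (auto simp: conj_by_conj_by)
  then show ?thesis
    using h by (auto simp: auto_def Bij_def conj_by_mult intro!: homI)
qed

lemma AutoGroup_simps:
  "carrier (AutoGroup G) = auto G"
  "\<alpha> \<in> auto G \<Longrightarrow> \<beta> \<in> auto G \<Longrightarrow> \<alpha> \<otimes>\<^bsub>AutoGroup G\<^esub> \<beta> = compose (carrier G) \<alpha> \<beta>"
  "\<one>\<^bsub>AutoGroup G\<^esub> = (\<lambda>x\<in>carrier G. x)"
  by (auto simp: AutoGroup_def BijGroup_def auto_def)

lemma Inn_normal: "Inn G \<lhd> AutoGroup G"
proof -
  interpret A: group "AutoGroup G" by (rule AutoGroup)
  let ?i = "\<lambda>h. \<lambda>g\<in>carrier G. conj_by G g h"
  have mult: "?i h \<otimes>\<^bsub>AutoGroup G\<^esub> ?i k = ?i (k \<otimes> h)" if "h \<in> carrier G" "k \<in> carrier G" for h k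
    using that by (auto simp: AutoGroup_simps inner_auto compose_def conj_by_conj_by intro!: restrict_ext)
  have one: "?i \<one> = \<one>\<^bsub>AutoGroup G\<^esub>"
    by (auto simp: AutoGroup_simps intro!: restrict_ext)
  have inv: "inv\<^bsub>AutoGroup G\<^esub> (?i h) = ?i (inv h)" if "h \<in> carrier G" for h
    using that by (intro A.inv_equality) (simp_all add: mult one inner_auto AutoGroup_simps(1))
  show ?thesis
  proof (rule A.normal_invI)
    show "subgroup (Inn G) (AutoGroup G)"
    proof (rule A.subgroupI)
      show "Inn G \<subseteq> carrier (AutoGroup G)" by (auto simp: Inn_def inner_auto AutoGroup_simps)
      show "Inn G \<noteq> {}" by (auto simp: Inn_def)
      show "inv\<^bsub>AutoGroup G\<^esub> a \<in> Inn G" if "a \<in> Inn G" for a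
        using that by (auto simp: Inn_def inv)
      show "a \<otimes>\<^bsub>AutoGroup G\<^esub> b \<in> Inn G" if "a \<in> Inn G" "b \<in> Inn G" for a b
        using that by (auto simp: Inn_def mult)
    qed
  next
    fix x a assume x: "x \<in> carrier (AutoGroup G)" and a: "a \<in> Inn G"
    then obtain h where h: "h \<in> carrier G" "a = ?i h" by (auto simp: Inn_def)
    have xa: "x \<in> auto G" using x by (simp add: AutoGroup_simps)
    have "x \<otimes>\<^bsub>AutoGroup G\<^esub> a = ?i (x h) \<otimes>\<^bsub>AutoGroup G\<^esub> x"
      using h xa by (auto simp: AutoGroup_simps inner_auto autoD compose_def auto_conj_by intro!: restrict_ext)
    then have "x \<otimes>\<^bsub>AutoGroup G\<^esub> a \<otimes>\<^bsub>AutoGroup G\<^esub> inv\<^bsub>AutoGroup G\<^esub> x = ?i (x h)"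
    proof -
      assume e: "x \<otimes>\<^bsub>AutoGroup G\<^esub> a = ?i (x h) \<otimes>\<^bsub>AutoGroup G\<^esub> x"
      have "?i (x h) \<in> carrier (AutoGroup G)"
        using h xa by (simp add: AutoGroup_simps inner_auto autoD)
      then show ?thesis unfolding e using x by (simp add: A.m_assoc)
    qed
    then show "x \<otimes>\<^bsub>AutoGroup G\<^esub> a \<otimes>\<^bsub>AutoGroup G\<^esub> inv\<^bsub>AutoGroup G\<^esub> x \<in> Inn G"
      using h xa by (auto simp: Inn_def autoD)
  qed
qed

lemma rotate:
  assumes "x \<otimes> y \<otimes> z = \<one>" "x \<in> carrier G" "y \<in> carrier G" "z \<in> carrier G"
  shows "y \<otimes> z \<otimes> x = \<one>" "z \<otimes> x \<otimes> y = \<one>"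
  using inv_comm[of x "y \<otimes> z"] inv_comm[of "x \<otimes> y" z] assms by (simp_all add: m_assoc)

lemma triple_inv:
  assumes "x \<otimes> y \<otimes> z = \<one>" "x \<in> carrier G" "y \<in> carrier G" "z \<in> carrier G"
  shows "z = inv (x \<otimes> y)" "x = inv (y \<otimes> z)" "y = inv (z \<otimes> x)"
proof -
  show "z = inv (x \<otimes> y)" using inv_equality[of z "x \<otimes> y"] rotate(2)[OF assms] assms by (simp add: m_assoc)
  show "x = inv (y \<otimes> z)" using inv_equality[of x "y \<otimes> z"] assms by (simp add: m_assoc)
  show "y = inv (z \<otimes> x)" using inv_equality[of y "z \<otimes> x"] rotate(1)[OF assms] assms by (simp add: m_assoc)
qed

lemma triplesI:
  assumes "(x, y, z) \<in> triples G" "x' \<in> carrier G" "y' \<in> carrier G" "z' \<in> carrier G"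
    "x' \<otimes> y' \<otimes> z' = \<one>" "{x, y} \<subseteq> generate G {x', y', z'} \<or> {y, z} \<subseteq> generate G {x', y', z'}"
  shows "(x', y', z') \<in> triples G"
proof -
  have c: "x \<in> carrier G" "y \<in> carrier G" "z \<in> carrier G" and e: "x \<otimes> y \<otimes> z = \<one>"
    and g: "generate G {x, y, z} = carrier G"
    using assms(1) by (auto simp: triples_def)
  have sub: "subgroup (generate G {x', y', z'}) G"
    using assms by (intro generate_is_subgroup) auto
  interpret S: subgroup "generate G {x', y', z'}" G by (rule sub)
  have "z = inv (x \<otimes> y)" "x = inv (y \<otimes> z)"
    by (rule triple_inv[OF e c])+
  have "{x, y, z} \<subseteq> generate G {x', y', z'}"
    using assms(6)
  proof
    assume a: "{x, y} \<subseteq> generate G {x', y', z'}"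
    then have "inv (x \<otimes> y) \<in> generate G {x', y', z'}" by (intro S.m_inv_closed S.m_closed) auto
    with a show ?thesis using \<open>z = inv (x \<otimes> y)\<close> by simp
  next
    assume a: "{y, z} \<subseteq> generate G {x', y', z'}"
    then have "inv (y \<otimes> z) \<in> generate G {x', y', z'}" by (intro S.m_inv_closed S.m_closed) auto
    with a show ?thesis using \<open>x = inv (y \<otimes> z)\<close> by simp
  qed
  then have "carrier G \<subseteq> generate G {x', y', z'}"
    using generate_subgroup_incl[OF _ sub] g by metis
  then show ?thesis
    using assms S.subset by (auto simp: triples_def)
qed

lemma theta_triples: "t \<in> triples G \<Longrightarrow> theta G t \<in> triples G"
proof (cases t)
  fix x y z assume t: "t \<in> triples G" and [simp]: "t = (x, y, z)"
  then have c: "x \<in> carrier G" "y \<in> carrier G" "z \<in> carrier G" and e: "x \<otimes> y \<otimes> z = \<one>"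
    by (auto simp: triples_def)
  have "y \<otimes> z \<otimes> x = \<one>" by (rule rotate(1)[OF e c])
  moreover have "y \<otimes> x \<otimes> (inv x \<otimes> z \<otimes> x) = y \<otimes> z \<otimes> x"
    using c by (simp add: m_assoc)
  ultimately have "y \<otimes> x \<otimes> conj_by G z x = \<one>" by (simp add: conj_by_def)
  moreover have "{x, y} \<subseteq> generate G {y, x, conj_by G z x}" by (auto intro: generate.incl)
  ultimately have "(y, x, conj_by G z x) \<in> triples G"
    using t c by (rule_tac triplesI[of x y z]) simp_all
  then show ?thesis by (simp add: theta_def)
qed

lemma delta_triples: "t \<in> triples G \<Longrightarrow> delta G t \<in> triples G"
proof (cases t)
  fix x y z assume t: "t \<in> triples G" and [simp]: "t = (x, y, z)"
  then have c: "x \<in> carrier G" "y \<in> carrier G" "z \<in> carrier G" and e: "x \<otimes> y \<otimes> z = \<one>"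
    by (auto simp: triples_def)
  have "z \<otimes> x \<otimes> y = \<one>" by (rule rotate(2)[OF e c])
  moreover have "z \<otimes> y \<otimes> (inv y \<otimes> x \<otimes> y) = z \<otimes> x \<otimes> y"
    using c by (simp add: m_assoc)
  ultimately have "z \<otimes> y \<otimes> conj_by G x y = \<one>" by (simp add: conj_by_def)
  moreover have "{y, z} \<subseteq> generate G {z, y, conj_by G x y}" by (auto intro: generate.incl)
  ultimately have "(z, y, conj_by G x y) \<in> triples G"
    using t c by (rule_tac triplesI[of x y z]) simp_all
  then show ?thesis by (simp add: delta_def)
qed

lemma auto_triples: "\<alpha> \<in> auto G \<Longrightarrow> t \<in> triples G \<Longrightarrow> map_triple \<alpha> t \<in> triples G"
proof (cases t)
  fix x y z assume a: "\<alpha> \<in> auto G" and t: "t \<in> triples G" and [simp]: "t = (x, y, z)"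
  interpret a: group_hom G G \<alpha>
    using autoD(1)[OF a] by (simp add: group_hom_def group_hom_axioms_def is_group)
  have c: "x \<in> carrier G" "y \<in> carrier G" "z \<in> carrier G" and e: "x \<otimes> y \<otimes> z = \<one>"
    and g: "generate G {x, y, z} = carrier G"
    using t by (auto simp: triples_def)
  have "\<alpha> x \<otimes> \<alpha> y \<otimes> \<alpha> z = \<one>" using c e a.hom_mult[of "x \<otimes> y" z] a.hom_mult[of x y] by simp
  moreover have "generate G {\<alpha> x, \<alpha> y, \<alpha> z} = carrier G"
    using a.generate_img[of "{x, y, z}"] c g autoD(2)[OF a] by simp
  ultimately show ?thesis using c by (simp add: triples_def map_triple_def)
qed

lemma triples_carrier: "(x, y, z) \<in> triples G \<Longrightarrow> x \<in> carrier G \<and> y \<in> carrier G \<and> z \<in> carrier G"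
  by (simp add: triples_def)

lemma auto_triple_class:
  assumes "\<alpha> \<in> auto G" "t \<in> triples G"
  shows "map_triple \<alpha> ` triple_class G t = triple_class G (map_triple \<alpha> t)"
proof -
  obtain x y z where t: "t = (x, y, z)" by (cases t)
  have "map_triple \<alpha> ` triple_class G t
      = (\<lambda>h. map_triple (\<lambda>g. conj_by G g (\<alpha> h)) (map_triple \<alpha> t)) ` carrier G"
    using triples_carrier[of x y z] assms
    by (auto simp: triple_class_def image_image map_triple_def t auto_conj_by intro!: image_cong)
  also have "\<dots> = (\<lambda>h. map_triple (\<lambda>g. conj_by G g h) (map_triple \<alpha> t)) ` \<alpha> ` carrier G"
    by (simp add: image_image)
  finally show ?thesis by (simp add: autoD(2)[OF assms(1)] triple_class_def)
qed

lemma theta_triple_class: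
  assumes "t \<in> triples G" shows "theta G ` triple_class G t = triple_class G (theta G t)"
proof -
  obtain x y z where t: "t = (x, y, z)" by (cases t)
  show ?thesis
    unfolding triple_class_def image_image
  proof (rule image_cong)
    fix h assume h: "h \<in> carrier G"
    have "conj_by G (conj_by G z h) (conj_by G x h) = conj_by G (conj_by G z x) h"
      using triples_carrier[of x y z] assms t h auto_conj_by[OF inner_auto[OF h], of z x] by simp
    then show "theta G (map_triple (\<lambda>g. conj_by G g h) t) = map_triple (\<lambda>g. conj_by G g h) (theta G t)"
      by (simp add: theta_def map_triple_def t)
  qed simp
qed

lemma delta_triple_class:
  assumes "t \<in> triples G" shows "delta G ` triple_class G t = triple_class G (delta G t)"
proof -
  obtain x y z where t: "t = (x, y, z)" by (cases t)
  show ?thesis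
    unfolding triple_class_def image_image
  proof (rule image_cong)
    fix h assume h: "h \<in> carrier G"
    have "conj_by G (conj_by G x h) (conj_by G y h) = conj_by G (conj_by G x y) h"
      using triples_carrier[of x y z] assms t h auto_conj_by[OF inner_auto[OF h], of x y] by simp
    then show "delta G (map_triple (\<lambda>g. conj_by G g h) t) = map_triple (\<lambda>g. conj_by G g h) (delta G t)"
      by (simp add: delta_def map_triple_def t)
  qed simp
qed

lemma triple_class_conj:
  assumes "t \<in> triples G" "h \<in> carrier G"
  shows "triple_class G (map_triple (\<lambda>g. conj_by G g h) t) = triple_class G t"
proof -
  obtain x y z where t: "t = (x, y, z)" by (cases t)
  have "triple_class G (map_triple (\<lambda>g. conj_by G g h) t)
      = (\<lambda>k. map_triple (\<lambda>g. conj_by G g (h \<otimes> k)) t) ` carrier G"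
    using triples_carrier[of x y z] assms
    by (auto simp: triple_class_def map_triple_def t conj_by_conj_by intro!: image_cong)
  also have "\<dots> = (\<lambda>k. map_triple (\<lambda>g. conj_by G g k) t) ` (\<lambda>k. h \<otimes> k) ` carrier G"
    by (simp add: image_image)
  also have "(\<lambda>k. h \<otimes> k) ` carrier G = carrier G"
    using assms(2) by (rule surj_const_mult)
  finally show ?thesis by (simp add: triple_class_def)
qed

lemma triple_classesE:
  assumes "c \<in> triple_classes G" obtains t where "t \<in> triples G" "c = triple_class G t"
  using assms by (auto simp: triple_classes_def)

lemma S3_relations:
  assumes "c \<in> triple_classes G"
  shows "theta G ` theta G ` c = c" "delta G ` delta G ` c = c"
    "theta G ` c \<in> triple_classes G" "delta G ` c \<in> triple_classes G"
    "delta G ` theta G ` delta G ` c = theta G ` delta G ` theta G ` c"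
proof -
  obtain t where t: "t \<in> triples G" "c = triple_class G t" by (rule triple_classesE[OF assms])
  obtain x y z where xyz: "t = (x, y, z)" by (cases t)
  have c: "x \<in> carrier G" "y \<in> carrier G" "z \<in> carrier G" and e: "x \<otimes> y \<otimes> z = \<one>"
    using t xyz by (auto simp: triples_def)
  note cl = theta_triples delta_triples theta_triple_class delta_triple_class
  have ezxy: "z = inv (x \<otimes> y)" "x = inv (y \<otimes> z)"
    by (rule triple_inv[OF e c])+
  have cp: "conj_by G x x = x" "conj_by G z z = z" "conj_by G y y = y"
    using c by (simp_all add: conj_by_def m_assoc)
  have cinv: "conj_by G (inv w) w = inv w" if "w \<in> carrier G" for w
    using that by (simp add: conj_by_def m_assoc)
  have p: "conj_by G z (x \<otimes> y) = z" "conj_by G x (y \<otimes> z) = x"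
    using cinv[of "x \<otimes> y"] cinv[of "y \<otimes> z"] c ezxy(1)[symmetric] ezxy(2)[symmetric] by simp_all
  show "theta G ` theta G ` c = c"
  proof -
    have "theta G (theta G t) = t"
      using c p by (simp add: theta_def xyz conj_by_conj_by)
    then show ?thesis using t by (simp add: cl)
  qed
  show "delta G ` delta G ` c = c"
  proof -
    have "delta G (delta G t) = map_triple (\<lambda>g. conj_by G g y) t"
      using c cp by (simp add: delta_def xyz map_triple_def)
    then show ?thesis using t c by (simp add: cl triple_class_conj)
  qed
  show "theta G ` c \<in> triple_classes G" "delta G ` c \<in> triple_classes G"
    using t by (auto simp: cl triple_classes_def)
  show "delta G ` theta G ` delta G ` c = theta G ` delta G ` theta G ` c"
  proof -
    have yzx: "y \<otimes> z \<otimes> x = \<one>" and zxy: "z \<otimes> x \<otimes> y = \<one>"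
      using rotate[OF e c] by auto
    have 1: "theta G (delta G t) = (y, z, x)"
      using c p by (simp add: theta_def delta_def xyz conj_by_conj_by)
    have 2: "delta G (theta G t) = map_triple (\<lambda>g. conj_by G g x) (z, x, y)"
      using c cp by (simp add: theta_def delta_def xyz map_triple_def)
    have tr: "(y, z, x) \<in> triples G" "(z, x, y) \<in> triples G"
      using t c yzx zxy unfolding xyz
      by (rule_tac triplesI[of x y z]; auto intro: generate.incl)+
    have 3: "delta G ` theta G ` delta G ` c = triple_class G (delta G (y, z, x))"
      using t tr by (simp add: cl flip: 1)
    have "theta G ` delta G ` theta G ` c = theta G ` triple_class G (delta G (theta G t))"
      using t by (simp add: cl)
    also have "\<dots> = theta G ` triple_class G (z, x, y)"
      unfolding 2 using tr c by (simp add: triple_class_conj)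
    also have "\<dots> = triple_class G (theta G (z, x, y))" using tr by (simp add: cl)
    also have "theta G (z, x, y) = delta G (y, z, x)" by (simp add: theta_def delta_def)
    finally show ?thesis using 3 by simp
  qed
qed

lemma Out_coset:
  assumes "A \<in> carrier (Out G)"
  shows "A \<noteq> {}" "A \<subseteq> auto G"
    "\<And>\<alpha> \<beta> t. \<alpha> \<in> A \<Longrightarrow> \<beta> \<in> A \<Longrightarrow> t \<in> triples G \<Longrightarrow>
       triple_class G (map_triple \<alpha> t) = triple_class G (map_triple \<beta> t)"
proof -
  obtain \<gamma> where g: "\<gamma> \<in> auto G" and A: "A = Inn G #>\<^bsub>AutoGroup G\<^esub> \<gamma>"
    using assms by (auto simp: Out_def FactGroup_def RCOSETS_def AutoGroup_simps)
  have A': "A = (\<lambda>h. compose (carrier G) (\<lambda>g\<in>carrier G. conj_by G g h) \<gamma>) ` carrier G"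
    unfolding A r_coset_def using g by (auto simp: Inn_def AutoGroup_simps inner_auto)
  show "A \<noteq> {}" by (auto simp: A')
  show "A \<subseteq> auto G"
  proof -
    interpret A: group "AutoGroup G" by (rule AutoGroup)
    show ?thesis
      using A.m_closed[of "\<lambda>g\<in>carrier G. conj_by G g h" \<gamma> for h] g
      by (auto simp: A' AutoGroup_simps inner_auto)
  qed
  have *: "triple_class G (map_triple \<alpha> t) = triple_class G (map_triple \<gamma> t)"
    if \<alpha>: "\<alpha> \<in> A" and t: "t \<in> triples G" for \<alpha> t
  proof -
    obtain h where h: "h \<in> carrier G" "\<alpha> = compose (carrier G) (\<lambda>g\<in>carrier G. conj_by G g h) \<gamma>"
      using \<alpha> by (auto simp: A')
    obtain x y z where xyz: "t = (x, y, z)" by (cases t)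
    have "map_triple \<alpha> t = map_triple (\<lambda>g. conj_by G g h) (map_triple \<gamma> t)"
      using triples_carrier[of x y z] t g
      by (simp add: xyz map_triple_def h(2) compose_eq autoD)
    then show ?thesis
      by (simp add: triple_class_conj auto_triples g t h)
  qed
  show "triple_class G (map_triple \<alpha> t) = triple_class G (map_triple \<beta> t)"
    if "\<alpha> \<in> A" "\<beta> \<in> A" "t \<in> triples G" for \<alpha> \<beta> t
    using *[of \<alpha> t] *[of \<beta> t] that by simp
qed

lemma Out_act_eq:
  assumes "A \<in> carrier (Out G)" "\<alpha> \<in> A" "c \<in> triple_classes G"
  shows "Out_act A c = map_triple \<alpha> ` c"
proof -
  obtain t where t: "t \<in> triples G" "c = triple_class G t" by (rule triple_classesE[OF assms(3)])
  have "map_triple \<beta> ` c = triple_class G (map_triple \<alpha> t)" if "\<beta> \<in> A" for \<beta>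
    using Out_coset(2,3)[OF assms(1)] that t assms(2) auto_triple_class by blast
  then show ?thesis using assms(2) by (auto simp: Out_act_def)
qed

lemma Out_act_class:
  assumes "A \<in> carrier (Out G)" "\<alpha> \<in> A" "t \<in> triples G"
  shows "Out_act A (triple_class G t) = triple_class G (map_triple \<alpha> t)"
proof -
  have "triple_class G t \<in> triple_classes G" using assms(3) by (simp add: triple_classes_def)
  moreover have "\<alpha> \<in> auto G" using Out_coset(2)[OF assms(1)] assms(2) by auto
  ultimately show ?thesis using assms by (simp add: Out_act_eq auto_triple_class)
qed

lemma Out_act_closed:
  assumes "A \<in> carrier (Out G)" "c \<in> triple_classes G"
  shows "Out_act A c \<in> triple_classes G"
proof -
  obtain \<alpha> where a: "\<alpha> \<in> A" using Out_coset(1)[OF assms(1)] by blast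
  then have au: "\<alpha> \<in> auto G" using Out_coset(2)[OF assms(1)] by auto
  obtain t where t: "t \<in> triples G" "c = triple_class G t" by (rule triple_classesE[OF assms(2)])
  have "Out_act A c = triple_class G (map_triple \<alpha> t)"
    unfolding t(2) by (rule Out_act_class[OF assms(1) a t(1)])
  then show ?thesis using auto_triples[OF au t(1)] by (simp add: triple_classes_def)
qed

lemma Out_act_mult:
  assumes "A \<in> carrier (Out G)" "B \<in> carrier (Out G)" "c \<in> triple_classes G"
  shows "Out_act (A \<otimes>\<^bsub>Out G\<^esub> B) c = Out_act A (Out_act B c)"
proof -
  obtain \<alpha> \<beta> where ab: "\<alpha> \<in> A" "\<beta> \<in> B"
    using Out_coset(1)[OF assms(1)] Out_coset(1)[OF assms(2)] by blast
  then have au: "\<alpha> \<in> auto G" "\<beta> \<in> auto G"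
    using Out_coset(2)[OF assms(1)] Out_coset(2)[OF assms(2)] by auto
  obtain t where t: "t \<in> triples G" "c = triple_class G t" by (rule triple_classesE[OF assms(3)])
  interpret O: group "Out G"
    unfolding Out_def by (rule normal.factorgroup_is_group[OF Inn_normal])
  have "\<alpha> \<otimes>\<^bsub>AutoGroup G\<^esub> \<beta> \<in> A \<otimes>\<^bsub>Out G\<^esub> B"
    using ab by (auto simp: Out_def FactGroup_def set_mult_def)
  then have "Out_act (A \<otimes>\<^bsub>Out G\<^esub> B) c = triple_class G (map_triple (\<alpha> \<otimes>\<^bsub>AutoGroup G\<^esub> \<beta>) t)"
    unfolding t(2) by (intro Out_act_class) (use t assms in auto)
  also have "map_triple (\<alpha> \<otimes>\<^bsub>AutoGroup G\<^esub> \<beta>) t = map_triple \<alpha> (map_triple \<beta> t)"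
    using t(1) au by (cases t) (auto simp: map_triple_def AutoGroup_simps compose_eq triples_def)
  also have "triple_class G \<dots> = Out_act A (Out_act B c)"
    using ab t assms au by (simp add: Out_act_class auto_triples)
  finally show ?thesis .
qed

lemma Out_act_one:
  assumes "c \<in> triple_classes G"
  shows "Out_act \<one>\<^bsub>Out G\<^esub> c = c"
proof -
  obtain t where t: "t \<in> triples G" "c = triple_class G t" by (rule triple_classesE[OF assms])
  interpret O: group "Out G"
    unfolding Out_def by (rule normal.factorgroup_is_group[OF Inn_normal])
  have "\<one>\<^bsub>AutoGroup G\<^esub> \<in> \<one>\<^bsub>Out G\<^esub>"
    using subgroup.one_closed[OF normal_imp_subgroup[OF Inn_normal]]
    by (simp add: Out_def FactGroup_def)
  then have "Out_act \<one>\<^bsub>Out G\<^esub> c = triple_class G (map_triple \<one>\<^bsub>AutoGroup G\<^esub> t)"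
    unfolding t(2) by (intro Out_act_class) (use t in auto)
  also have "map_triple \<one>\<^bsub>AutoGroup G\<^esub> t = t"
    using t(1) by (cases t) (auto simp: map_triple_def AutoGroup_simps triples_def)
  finally show ?thesis by (simp add: t)
qed

lemma Out_act_theta_delta:
  assumes "A \<in> carrier (Out G)" "c \<in> triple_classes G"
  shows "Out_act A (theta G ` c) = theta G ` Out_act A c"
    "Out_act A (delta G ` c) = delta G ` Out_act A c"
proof -
  obtain \<alpha> where a: "\<alpha> \<in> A" using Out_coset(1)[OF assms(1)] by blast
  then have au: "\<alpha> \<in> auto G" using Out_coset(2)[OF assms(1)] by auto
  obtain t where t: "t \<in> triples G" "c = triple_class G t" by (rule triple_classesE[OF assms(2)])
  have "map_triple \<alpha> (theta G t) = theta G (map_triple \<alpha> t)"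
    "map_triple \<alpha> (delta G t) = delta G (map_triple \<alpha> t)"
    using t(1) au by (cases t; auto simp: theta_def delta_def map_triple_def auto_conj_by triples_def)+
  then show "Out_act A (theta G ` c) = theta G ` Out_act A c"
    "Out_act A (delta G ` c) = delta G ` Out_act A c"
    using t a au assms(1) by (simp_all add: Out_act_class auto_triples theta_triple_class
      delta_triple_class theta_triples delta_triples)
qed

end

lemma S3_cases:
  assumes "p \<in> carrier (sym_group 3)"
  defines "a \<equiv> Transposition.transpose (1::nat) 2" and "b \<equiv> Transposition.transpose (1::nat) 3"
  obtains "p = id" | "p = a" | "p = b" | "p = a \<circ> b" | "p = b \<circ> a" | "p = a \<circ> (b \<circ> a)"
proof -
  have p: "p permutes {1, 2, 3}"
  proof -
    have "{1..3} = {1, 2, 3::nat}" by auto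
    then show ?thesis using assms(1) by (simp add: sym_group_carrier)
  qed
  have out: "p x = x" if "x \<noteq> 1" "x \<noteq> 2" "x \<noteq> 3" for x
    using p that by (auto simp: permutes_def)
  have inj: "p 1 \<noteq> p 2" "p 1 \<noteq> p 3" "p 2 \<noteq> p 3"
    by (simp_all add: inj_eq[OF permutes_inj[OF p]])
  have "p 1 \<in> {1, 2, 3}" "p 2 \<in> {1, 2, 3}" "p 3 \<in> {1, 2, 3}"
    using permutes_in_image[OF p] by blast+
  then consider "p 1 = 1" "p 2 = 2" "p 3 = 3" | "p 1 = 2" "p 2 = 1" "p 3 = 3"
    | "p 1 = 3" "p 2 = 2" "p 3 = 1" | "p 1 = 3" "p 2 = 1" "p 3 = 2"
    | "p 1 = 2" "p 2 = 3" "p 3 = 1" | "p 1 = 1" "p 2 = 3" "p 3 = 2"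
    using inj by auto
  note cs = this
  have eq: "p = q" if "q 1 = p 1" "q 2 = p 2" "q 3 = p 3"
    "\<And>x. x \<noteq> 1 \<Longrightarrow> x \<noteq> 2 \<Longrightarrow> x \<noteq> 3 \<Longrightarrow> q x = x" for q
  proof
    fix x show "p x = q x"
      using that out[of x] by (cases "x = 1"; cases "x = 2"; cases "x = 3") auto
  qed
  show thesis
  proof (rule cs)
    assume "p 1 = 1" "p 2 = 2" "p 3 = 3"
    then have "p = id"
      by - (rule eq, simp_all add: a_def b_def Transposition.transpose_def)
    then show thesis by (rule that(1))
  next
    assume "p 1 = 2" "p 2 = 1" "p 3 = 3"
    then have "p = a"
      by - (rule eq, simp_all add: a_def b_def Transposition.transpose_def)
    then show thesis by (rule that(2))
  next
    assume "p 1 = 3" "p 2 = 2" "p 3 = 1"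
    then have "p = b"
      by - (rule eq, simp_all add: a_def b_def Transposition.transpose_def)
    then show thesis by (rule that(3))
  next
    assume "p 1 = 3" "p 2 = 1" "p 3 = 2"
    then have "p = a \<circ> b"
      by - (rule eq, simp_all add: a_def b_def Transposition.transpose_def)
    then show thesis by (rule that(4))
  next
    assume "p 1 = 2" "p 2 = 3" "p 3 = 1"
    then have "p = b \<circ> a"
      by - (rule eq, simp_all add: a_def b_def Transposition.transpose_def)
    then show thesis by (rule that(5))
  next
    assume "p 1 = 1" "p 2 = 3" "p 3 = 2"
    then have "p = a \<circ> (b \<circ> a)"
      by - (rule eq, simp_all add: a_def b_def Transposition.transpose_def)
    then show thesis by (rule that(6))
  qed
qed

lemma S3_act_simps:
  defines "a \<equiv> Transposition.transpose (1::nat) 2" and "b \<equiv> Transposition.transpose (1::nat) 3"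
  shows "S3_act G id c = c" "S3_act G a c = theta G ` c" "S3_act G b c = delta G ` c"
    "S3_act G (a \<circ> b) c = theta G ` delta G ` c" "S3_act G (b \<circ> a) c = delta G ` theta G ` c"
    "S3_act G (a \<circ> (b \<circ> a)) c = theta G ` delta G ` theta G ` c"
proof -
  define f where "f = (\<lambda>p. (p (1::nat), p (2::nat)) :: nat \<times> nat)"
  have ne: "p \<noteq> q" if "f p \<noteq> f q" for p q using that by auto
  have "f id = (1, 2)" "f a = (2, 1)" "f b = (3, 2)" "f (a \<circ> b) = (3, 1)" "f (b \<circ> a) = (2, 3)"
    "f (a \<circ> (b \<circ> a)) = (1, 3)"
    by (simp_all add: f_def a_def b_def Transposition.transpose_def)
  note d = this
  show "S3_act G id c = c" "S3_act G a c = theta G ` c" "S3_act G b c = delta G ` c"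
    "S3_act G (a \<circ> b) c = theta G ` delta G ` c" "S3_act G (b \<circ> a) c = delta G ` theta G ` c"
    "S3_act G (a \<circ> (b \<circ> a)) c = theta G ` delta G ` theta G ` c"
    unfolding S3_act_def a_def[symmetric] b_def[symmetric]
    by (simp_all add: ne d)
qed

context group begin

lemma S3_act_closed: "c \<in> triple_classes G \<Longrightarrow> S3_act G p c \<in> triple_classes G"
  by (simp add: S3_act_def S3_relations)

lemma S3_act_mult_gen:
  assumes "p \<in> carrier (sym_group 3)" "c \<in> triple_classes G"
  shows "S3_act G (Transposition.transpose 1 2 \<circ> p) c = theta G ` S3_act G p c"
    "S3_act G (Transposition.transpose 1 3 \<circ> p) c = delta G ` S3_act G p c"
proof -
  define a b where ab: "a = Transposition.transpose (1::nat) 2" "b = Transposition.transpose (1::nat) 3"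
  have aa: "a \<circ> a = id" "b \<circ> b = id" by (simp_all add: ab)
  have aa': "a \<circ> (a \<circ> f) = f" "b \<circ> (b \<circ> f) = f" for f :: "'x \<Rightarrow> nat"
    by (simp_all add: fun_eq_iff ab)
  have bab: "b \<circ> (a \<circ> b) = a \<circ> (b \<circ> a)"
    by (auto simp: fun_eq_iff ab Transposition.transpose_def)
  have bab': "b \<circ> (a \<circ> (b \<circ> a)) = a \<circ> b"
    by (auto simp: fun_eq_iff ab Transposition.transpose_def)
  note S = S3_act_simps[folded ab] S3_relations aa aa' bab bab' assms(2)
  have "S3_act G (a \<circ> p) c = theta G ` S3_act G p c \<and> S3_act G (b \<circ> p) c = delta G ` S3_act G p c"
    by (rule S3_cases[OF assms(1), folded ab]) (simp_all add: S comp_assoc)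
  then show "S3_act G (Transposition.transpose 1 2 \<circ> p) c = theta G ` S3_act G p c"
    "S3_act G (Transposition.transpose 1 3 \<circ> p) c = delta G ` S3_act G p c"
    by (simp_all add: ab)
qed

lemma S3_act_mult:
  assumes "p \<in> carrier (sym_group 3)" "q \<in> carrier (sym_group 3)" "c \<in> triple_classes G"
  shows "S3_act G (p \<circ> q) c = S3_act G p (S3_act G q c)"
proof -
  define a b where ab: "a = Transposition.transpose (1::nat) 2" "b = Transposition.transpose (1::nat) 3"
  have g: "a \<in> carrier (sym_group 3)" "b \<in> carrier (sym_group 3)"
    unfolding ab sym_group_carrier by (rule permutes_swap_id; simp)+
  have cl: "r \<circ> s \<in> carrier (sym_group 3)"
    if "r \<in> carrier (sym_group 3)" "s \<in> carrier (sym_group 3)" for r s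
    using that unfolding sym_group_carrier by (rule permutes_compose[rotated])
  note S = S3_act_simps[folded ab] S3_act_mult_gen[folded ab, OF _ assms(3)] g cl assms(2) comp_assoc
  show ?thesis
    by (rule S3_cases[OF assms(1), folded ab]) (simp_all only: S id_comp)
qed

lemma Out_act_S3_act:
  "A \<in> carrier (Out G) \<Longrightarrow> c \<in> triple_classes G \<Longrightarrow>
    Out_act A (S3_act G p c) = S3_act G p (Out_act A c)"
  by (simp add: S3_act_def Out_act_theta_delta S3_relations)

theorem H_action: "group_action (H_group G) (triple_classes G) (H_act G)"
proof -
  interpret O: group "Out G"
    unfolding Out_def by (rule normal.factorgroup_is_group[OF Inn_normal])
  interpret S: group "sym_group 3" by (rule sym_group_is_group)
  have H: "group (H_group G)"
    unfolding H_group_def by (rule DirProd_group[OF O.is_group S.is_group])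
  interpret H: group "H_group G" by (rule H)
  have cl: "H_act G h c \<in> triple_classes G"
    if "h \<in> carrier (H_group G)" "c \<in> triple_classes G" for h c
    using that by (auto simp: H_act_def H_group_def Out_act_closed S3_act_closed)
  have mult: "H_act G (h \<otimes>\<^bsub>H_group G\<^esub> k) c = H_act G h (H_act G k c)"
    if "h \<in> carrier (H_group G)" "k \<in> carrier (H_group G)" "c \<in> triple_classes G" for h k c
    using that by (auto simp: H_act_def H_group_def Out_act_closed S3_act_closed S3_act_mult
      Out_act_mult Out_act_S3_act sym_group_mult)
  have one: "H_act G \<one>\<^bsub>H_group G\<^esub> c = c" if "c \<in> triple_classes G" for c
    using that by (simp add: H_act_def H_group_def Out_act_one sym_group_one S3_act_simps)
  have "H_act G h \<in> Bij (triple_classes G)" if h: "h \<in> carrier (H_group G)" for h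
  proof -
    have "bij_betw (H_act G h) (triple_classes G) (triple_classes G)"
      using h by (intro bij_betw_byWitness[where f' = "H_act G (inv\<^bsub>H_group G\<^esub> h)"])
        (auto simp: cl one simp flip: mult)
    then show ?thesis by (simp add: Bij_def H_act_def)
  qed
  note bij = this
  have "H_act G (h \<otimes>\<^bsub>H_group G\<^esub> k) = compose (triple_classes G) (H_act G h) (H_act G k)"
    if "h \<in> carrier (H_group G)" "k \<in> carrier (H_group G)" for h k
  proof
    fix c show "H_act G (h \<otimes>\<^bsub>H_group G\<^esub> k) c = compose (triple_classes G) (H_act G h) (H_act G k) c"
      using mult[OF that, of c] by (cases "c \<in> triple_classes G") (simp_all add: compose_def H_act_def)
  qed
  then have "H_act G \<in> hom (H_group G) (BijGroup (triple_classes G))"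
    using bij by (intro homI) (simp_all add: BijGroup_def)
  then show ?thesis
    by (simp add: group_action_def group_hom_def group_hom_axioms_def H group_BijGroup)
qed

end

context group begin

lemma conjugate_refl: "x \<in> carrier G \<Longrightarrow> conjugate G x x"
  unfolding conjugate_def by (rule bexI[of _ \<one>]) simp_all

lemma conjugate_sym:
  assumes "conjugate G x y" "y \<in> carrier G" shows "conjugate G y x"
proof -
  obtain h where "h \<in> carrier G" "x = conj_by G y h" using assms(1) by (auto simp: conjugate_def)
  then show ?thesis unfolding conjugate_def
    using assms(2) by (intro bexI[of _ "inv h"]) (simp_all add: conj_by_conj_by)
qed

lemma conjugate_trans:
  assumes "conjugate G x y" "conjugate G y z" "z \<in> carrier G" shows "conjugate G x z"
proof -
  obtain h k where "h \<in> carrier G" "x = conj_by G y h" "k \<in> carrier G" "y = conj_by G z k"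
    using assms by (auto simp: conjugate_def)
  then show ?thesis unfolding conjugate_def
    using assms(3) by (intro bexI[of _ "k \<otimes> h"]) (simp_all add: conj_by_conj_by)
qed

lemma triple_class_members:
  assumes "(x, y, z) \<in> triples G" "(x', y', z') \<in> triple_class G (x, y, z)"
  shows "conjugate G x' x" "conjugate G y' y" "conjugate G z' z"
    "x' \<in> carrier G" "y' \<in> carrier G" "z' \<in> carrier G"
  using assms triples_carrier[OF assms(1)]
  by (auto simp: triple_class_def map_triple_def conjugate_def)

lemma triple_class_self: "t \<in> triples G \<Longrightarrow> t \<in> triple_class G t"
  by (cases t) (auto simp: triple_class_def map_triple_def triples_def intro!: image_eqI[of _ _ \<one>])

lemma class_equiv_iff:
  assumes "(x, y, z) \<in> triples G" "(x', y', z') \<in> triples G"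
  shows "class_equiv G (triple_class G (x, y, z)) (triple_class G (x', y', z')) \<longleftrightarrow>
    conjugate G x x' \<and> conjugate G y y' \<and> conjugate G z z'" (is "?L \<longleftrightarrow> ?R")
proof
  assume ?R
  then show ?L
    unfolding class_equiv_def
    using triple_class_self[OF assms(1)] triple_class_self[OF assms(2)] by blast
next
  have c: "x \<in> carrier G" "y \<in> carrier G" "z \<in> carrier G"
      "x' \<in> carrier G" "y' \<in> carrier G" "z' \<in> carrier G"
    using triples_carrier assms by auto
  assume ?L
  then obtain a b d a' b' d' where
    1: "(a, b, d) \<in> triple_class G (x, y, z)" and
    2: "(a', b', d') \<in> triple_class G (x', y', z')" and
    3: "conjugate G a a'" "conjugate G b b'" "conjugate G d d'"
    unfolding class_equiv_def by blast
  note m = triple_class_members[OF assms(1) 1] triple_class_members[OF assms(2) 2]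
  show ?R
    using conjugate_trans[OF conjugate_sym[OF m(1) c(1)] conjugate_trans[OF 3(1) m(7) c(4)] c(4)]
      conjugate_trans[OF conjugate_sym[OF m(2) c(2)] conjugate_trans[OF 3(2) m(8) c(5)] c(5)]
      conjugate_trans[OF conjugate_sym[OF m(3) c(3)] conjugate_trans[OF 3(3) m(9) c(6)] c(6)]
    by blast
qed

lemma triple_classesE3:
  assumes "c \<in> triple_classes G"
  obtains x y z where "(x, y, z) \<in> triples G" "c = triple_class G (x, y, z)"
  using assms by (auto simp: triple_classes_def)

lemma class_equiv_refl: "c \<in> triple_classes G \<Longrightarrow> class_equiv G c c"
  by (erule triple_classesE3) (auto simp: class_equiv_iff conjugate_refl dest: triples_carrier)

lemma class_equiv_sym:
  "class_equiv G c d \<Longrightarrow> c \<in> triple_classes G \<Longrightarrow> d \<in> triple_classes G \<Longrightarrow> class_equiv G d c"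
  by (erule triple_classesE3)+ (auto simp: class_equiv_iff dest: triples_carrier intro: conjugate_sym)

lemma class_equiv_trans:
  "class_equiv G c d \<Longrightarrow> class_equiv G d e \<Longrightarrow> c \<in> triple_classes G \<Longrightarrow> d \<in> triple_classes G \<Longrightarrow>
    e \<in> triple_classes G \<Longrightarrow> class_equiv G c e"
  by (erule triple_classesE3)+ (auto simp: class_equiv_iff dest: triples_carrier intro: conjugate_trans)

theorem group_GT1: "group (GT1 G)"
proof -
  let ?T = "triple_classes G"
  let ?C = "carrier (GT1 G)"
  interpret B: group "BijGroup ?T" by (rule group_BijGroup)
  interpret A: group_action "H_group G" ?T "H_act G" by (rule H_action)
  have C: "?C = {\<phi> \<in> Bij ?T. (\<forall>h\<in>carrier (H_group G). \<forall>c\<in>?T. \<phi> (H_act G h c) = H_act G h (\<phi> c)) \<and>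
      (\<forall>c\<in>?T. class_equiv G (\<phi> c) c)}"
    by (simp add: GT1_def)
  have H: "H_act G h c \<in> ?T" if "h \<in> carrier (H_group G)" "c \<in> ?T" for h c
    using A.element_image that by blast
  have T: "\<phi> c \<in> ?T" if "\<phi> \<in> Bij ?T" "c \<in> ?T" for \<phi> c
    using that by (auto simp: Bij_def bij_betw_def)
  have "subgroup ?C (BijGroup ?T)"
  proof (rule B.subgroupI)
    show "?C \<subseteq> carrier (BijGroup ?T)" by (auto simp: C BijGroup_def)
    have "(\<lambda>c\<in>?T. c) \<in> ?C" by (auto simp: C id_Bij H class_equiv_refl)
    then show "?C \<noteq> {}" by blast
  next
    fix \<phi> assume p: "\<phi> \<in> ?C"
    then have b: "\<phi> \<in> Bij ?T" by (simp add: C)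
    define \<psi> where "\<psi> = (\<lambda>c\<in>?T. inv_into ?T \<phi> c)"
    have q: "\<psi> \<in> Bij ?T" unfolding \<psi>_def by (rule restrict_inv_into_Bij[OF b])
    have pq: "\<phi> (\<psi> c) = c" "\<psi> (\<phi> c) = c" if "c \<in> ?T" for c
      using b that T[OF b that] by (auto simp: \<psi>_def Bij_def bij_betw_def f_inv_into_f)
    have "\<psi> (H_act G h c) = H_act G h (\<psi> c)" if "h \<in> carrier (H_group G)" "c \<in> ?T" for h c
    proof -
      have "\<phi> (H_act G h (\<psi> c)) = H_act G h c"
        using p that T[OF q that(2)] by (simp add: C pq)
      then have "\<psi> (H_act G h c) = \<psi> (\<phi> (H_act G h (\<psi> c)))" by simp
      also have "\<dots> = H_act G h (\<psi> c)" by (rule pq(2)[OF H[OF that(1) T[OF q that(2)]]])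
      finally show ?thesis .
    qed
    moreover have "class_equiv G (\<psi> c) c" if "c \<in> ?T" for c
    proof -
      have "class_equiv G (\<phi> (\<psi> c)) (\<psi> c)" using p T[OF q that] by (simp add: C)
      then show ?thesis using that T[OF q that] by (simp add: pq class_equiv_sym)
    qed
    ultimately show "inv\<^bsub>BijGroup ?T\<^esub> \<phi> \<in> ?C"
      using q by (simp add: inv_BijGroup[OF b] C flip: \<psi>_def)
  next
    fix \<phi> \<psi> assume p: "\<phi> \<in> ?C" and q: "\<psi> \<in> ?C"
    then have b: "\<phi> \<in> Bij ?T" "\<psi> \<in> Bij ?T" by (simp_all add: C)
    have "class_equiv G (\<phi> (\<psi> c)) c" if "c \<in> ?T" for c
      using p q that T b class_equiv_trans[of "\<phi> (\<psi> c)" "\<psi> c" c] by (simp add: C)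
    then show "\<phi> \<otimes>\<^bsub>BijGroup ?T\<^esub> \<psi> \<in> ?C"
      using p q b T H compose_Bij[OF b] by (simp add: C BijGroup_def compose_eq)
  qed
  then have "group (BijGroup ?T \<lparr>carrier := ?C\<rparr>)"
    by (rule subgroup.subgroup_is_group[OF _ B.is_group])
  moreover have "BijGroup ?T \<lparr>carrier := ?C\<rparr> = GT1 G" by (simp add: GT1_def)
  ultimately show ?thesis by simp
qed

end

lemma group_dihedral:
  assumes "n > 0" shows "group (dihedral n)"
proof (rule groupI)
  fix x assume x: "x \<in> carrier (dihedral n)"
  obtain k b where [simp]: "x = (k, b)" by (cases x)
  show "\<exists>y\<in>carrier (dihedral n). y \<otimes>\<^bsub>dihedral n\<^esub> x = \<one>\<^bsub>dihedral n\<^esub>"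
    using assms x
    by (intro bexI[of _ "(if b then k else (- k) mod int n, b)"])
      (auto simp: dihedral_def mod_simps)
next
  fix x y z :: "int \<times> bool"
  obtain k b l c m d where [simp]: "x = (k, b)" "y = (l, c)" "z = (m, d)"
    by (cases x; cases y; cases z)
  show "x \<otimes>\<^bsub>dihedral n\<^esub> y \<otimes>\<^bsub>dihedral n\<^esub> z = x \<otimes>\<^bsub>dihedral n\<^esub> (y \<otimes>\<^bsub>dihedral n\<^esub> z)"
    by (cases b; cases c) (simp_all add: dihedral_def mod_simps algebra_simps)
qed (use assms in \<open>auto simp: dihedral_def\<close>)

lemma order_dihedral: "order (dihedral n) = 2 * n"
  by (simp add: order_def dihedral_def card_cartesian_product)

end

theory Submission
  imports Defs "HOL-Number_Theory.Residues"
begin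

text \<open>
  Everything is governed by traces.  A generating triple of \<open>PSL(2, k)\<close> lifts to a pair \<open>A\<close>, \<open>B\<close>
  in \<open>SL(2, k)\<close> which does not commute and has no common eigenvector, and such a pair is determined up
  to conjugation in \<open>GL(2, k)\<close> by the traces of \<open>A\<close>, \<open>B\<close> and \<open>AB\<close> (\<open>simultaneously_similar\<close>).
  The conjugacy classes of the three members of a triple fix these traces up to sign, and the signs
  of \<open>A\<close> and \<open>B\<close> may be chosen at will, so that at most the sign of the trace of \<open>AB\<close> remains
  (\<open>class_equiv_lifts\<close>).  Conjugation by a matrix of \<open>GL(2, k)\<close> is inner on \<open>PSL(2, k)\<close> as soon as
  its determinant is a square.

  In characteristic two there are no signs and every determinant is a square.  Hence \<open>\<equiv>\<close> is equality
  of classes, and only the identity preserves all its classes.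

  In odd characteristic the matrices of non-square determinant induce one outer automorphism class
  \<open>\<tau>\<close>, of order two, which fixes no class of triples.  A fibre, that is a class of \<open>\<equiv>\<close>, consists of
  elements of at most two pairs \<open>{c, \<tau> c}\<close>.  An element \<open>f\<close> of \<open>GT\<^sub>1\<close> permutes every fibre and
  commutes with \<open>\<tau>\<close>; therefore \<open>f (f c)\<close> is always \<open>c\<close> or \<open>\<tau> c\<close> (\<open>perm_square_cases\<close>).  If the
  square of every \<open>f\<close> is the identity, then \<open>GT\<^sub>1\<close> is elementary abelian.

  Otherwise some \<open>f\<close> is a four-cycle on some fibre, with square \<open>\<tau>\<close>.  An element of \<open>Out(G) \<times> S\<^sub>3\<close>
  stabilising this fibre commutes with \<open>f\<close> and so acts on it as a power of \<open>f\<close>.  It cannot be an odd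
  power: then its sixth power would send some class \<open>c\<close> to \<open>\<tau> c\<close>, but the sixth power has no
  component in \<open>S\<^sub>3\<close> and is the square of an outer automorphism, whereas \<open>\<tau>\<close> has no square root in
  \<open>Out(G)\<close>.  So the stabiliser acts on the fibre through \<open>\<tau>\<close> alone, every permutation of the
  fibre commuting with \<open>\<tau>\<close> extends to the translates of the fibre, and these permutations form the
  centraliser of a fixed-point-free involution in the symmetric group on four points, which is
  \<open>D\<^sub>8\<close> (\<open>perms_four_cycles_iso_D8\<close>).  The translates split off as a direct factor (\<open>perms_split\<close>), and
  induction on the number of remaining classes gives the theorem (\<open>perms_iso\<close>).

  The class \<open>\<tau>\<close> has no square root for the following reason
  (\<open>auto_squared_psl_conj_imp_square\<close>).  An automorphism of \<open>PSL(2, q)\<close> can be composed with an inner one so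
  as to preserve the group of upper unipotent matrices, a copy of the additive group of the field.
  There it acts as \<open>u \<mapsto> e F(u)\<close> with a field automorphism \<open>F\<close>, so its square takes \<open>1\<close> to
  \<open>e F(e)\<close>.  This is always a square, because \<open>F\<close> preserves both squares and non-squares and the
  product of two non-squares is a square; but conjugation by a matrix of non-square determinant that
  preserves this group multiplies it by a non-square.
\<close>

section \<open>Pairs of two-by-two matrices with given traces\<close>

definition mat22 :: "'k \<Rightarrow> 'k \<Rightarrow> 'k \<Rightarrow> 'k \<Rightarrow> 'k::field ^ 2 ^ 2" where
  "mat22 a b c d = (\<chi> i j. if i = 1 then (if j = 1 then a else b) else (if j = 1 then c else d))"

lemma mat22_nth [simp]:
  "mat22 a b c d $ 1 $ 1 = a" "mat22 a b c d $ 1 $ 2 = b"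
  "mat22 a b c d $ 2 $ 1 = c" "mat22 a b c d $ 2 $ 2 = d"
  by (simp_all add: mat22_def)

lemma mat22_eq_iff:
  fixes A B :: "'k::field ^ 2 ^ 2"
  shows "A = B \<longleftrightarrow> A $ 1 $ 1 = B $ 1 $ 1 \<and> A $ 1 $ 2 = B $ 1 $ 2 \<and>
    A $ 2 $ 1 = B $ 2 $ 1 \<and> A $ 2 $ 2 = B $ 2 $ 2"
  by (auto simp: vec_eq_iff forall_2)

lemma mat22_cases:
  fixes A :: "'k::field ^ 2 ^ 2"
  obtains a b c d where "A = mat22 a b c d"
proof
  show "A = mat22 (A $ 1 $ 1) (A $ 1 $ 2) (A $ 2 $ 1) (A $ 2 $ 2)" by (simp add: mat22_eq_iff)
qed

lemma mat22_inject [simp]: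
  "mat22 a b c d = mat22 a' b' c' d' \<longleftrightarrow> a = a' \<and> b = b' \<and> c = c' \<and> d = d'"
  by (simp add: mat22_eq_iff)

lemma mat22_simps:
  "mat22 a b c d ** mat22 a' b' c' d' =
    mat22 (a * a' + b * c') (a * b' + b * d') (c * a' + d * c') (c * b' + d * d')"
  "mat22 a b c d + mat22 a' b' c' d' = mat22 (a + a') (b + b') (c + c') (d + d')"
  "mat22 a b c d - mat22 a' b' c' d' = mat22 (a - a') (b - b') (c - c') (d - d')"
  "- mat22 a b c d = mat22 (- a) (- b) (- c) (- d)"
  "mat x = mat22 x 0 0 x"
  "det (mat22 a b c d) = a * d - b * c"
  "trace (mat22 a b c d) = a + d"
  by (simp_all add: mat22_eq_iff matrix_matrix_mult_def sum_2 mat_def det_2 trace_def)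

lemma zero_mat22: "0 = mat22 0 0 0 0"
  by (simp add: mat22_eq_iff)

text \<open>The zero vector satisfies this too, so that the vectors in question are required to be nonzero where the
  predicate is used.\<close>

definition has_eigenvector :: "'k::field ^ 2 ^ 2 \<Rightarrow> 'k ^ 2 \<Rightarrow> bool" where
  "has_eigenvector A v \<longleftrightarrow> (\<exists>c. A *v v = c *s v)"

lemma kernel_line:
  fixes g :: "'k::field ^ 2 ^ 2"
  assumes "g \<noteq> 0" "g *v u = 0" "g *v v = 0" "v \<noteq> 0"
  shows "\<exists>c. u = c *s v"
proof -
  obtain a b c d where g: "g = mat22 a b c d" by (rule mat22_cases)
  have 1: "a * u $ 1 + b * u $ 2 = 0" "c * u $ 1 + d * u $ 2 = 0"
      "a * v $ 1 + b * v $ 2 = 0" "c * v $ 1 + d * v $ 2 = 0"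
    using assms(2,3) by (simp_all add: g vec_eq_iff matrix_vector_mult_def sum_2 forall_2)
  have "a \<noteq> 0 \<or> b \<noteq> 0 \<or> c \<noteq> 0 \<or> d \<noteq> 0"
    using assms(1) by (auto simp: g zero_mat22)
  moreover have m: "x * (u $ 1 * v $ 2 - u $ 2 * v $ 1) = 0 \<and> y * (u $ 1 * v $ 2 - u $ 2 * v $ 1) = 0"
    if "x * u $ 1 + y * u $ 2 = 0" "x * v $ 1 + y * v $ 2 = 0" for x y
  proof -
    have "x * (u $ 1 * v $ 2 - u $ 2 * v $ 1) =
        v $ 2 * (x * u $ 1 + y * u $ 2) - u $ 2 * (x * v $ 1 + y * v $ 2)"
      "y * (u $ 1 * v $ 2 - u $ 2 * v $ 1) =
        u $ 1 * (x * v $ 1 + y * v $ 2) - v $ 1 * (x * u $ 1 + y * u $ 2)"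
      by (simp_all only: algebra_simps)
    then show ?thesis using that by simp
  qed
  ultimately have e: "u $ 1 * v $ 2 = u $ 2 * v $ 1"
    using m[OF 1(1,3)] m[OF 1(2,4)] by auto
  from assms(4) consider "v $ 1 \<noteq> 0" | "v $ 2 \<noteq> 0" by (auto simp: vec_eq_iff forall_2)
  then show ?thesis
  proof cases
    case 1
    then show ?thesis using e
      by (intro exI[of _ "u $ 1 / v $ 1"]) (simp add: vec_eq_iff forall_2)
  next
    case 2
    then show ?thesis using e
      by (intro exI[of _ "u $ 2 / v $ 2"]) (simp add: vec_eq_iff forall_2 flip: e)
  qed
qed

lemma singular_kernel:
  fixes g :: "'k::field ^ 2 ^ 2"
  assumes "det g = 0"
  shows "\<exists>v. v \<noteq> 0 \<and> g *v v = 0"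
  using assms invertible_det_nz[of g] invertible_left_inverse[of g] matrix_left_invertible_ker[of g]
  by blast

text \<open>A singular nonzero intertwiner has a line as its kernel, and this line is preserved by both
  matrices.\<close>

lemma intertwiner_invertible:
  fixes A B A' B' g :: "'k::field ^ 2 ^ 2"
  assumes "g \<noteq> 0" "g ** A = A' ** g" "g ** B = B' ** g"
    and irr: "\<And>v. v \<noteq> 0 \<Longrightarrow> has_eigenvector A v \<Longrightarrow> has_eigenvector B v \<Longrightarrow> False"
  shows "det g \<noteq> 0"
proof
  assume "det g = 0"
  then obtain v where v: "v \<noteq> 0" "g *v v = 0" using singular_kernel by blast
  have "has_eigenvector W v" if "g ** W = Y ** g" for W Y :: "'k ^ 2 ^ 2"
  proof -
    have "g *v (W *v v) = Y *v (g *v v)"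
      using that by (simp add: matrix_vector_mul_assoc)
    then have "g *v (W *v v) = 0" by (simp add: v)
    then show ?thesis
      unfolding has_eigenvector_def using kernel_line[OF assms(1) _ v(2,1)] by blast
  qed
  then show False using irr v(1) assms(2,3) by blast
qed

text \<open>A matrix that is not scalar has a vector \<open>v\<close> independent of \<open>A v\<close>; in the basis
  \<open>v\<close>, \<open>A v\<close> it is the companion matrix of its characteristic polynomial.\<close>

lemma companion_basis:
  fixes A :: "'k::field ^ 2 ^ 2"
  assumes "\<And>c. A \<noteq> mat c"
  shows "\<exists>P. det P \<noteq> 0 \<and> A ** P = P ** mat22 0 (- det A) 1 (trace A)"
proof -
  obtain a b c d where A: "A = mat22 a b c d" by (rule mat22_cases)
  have "c \<noteq> 0 \<or> b \<noteq> 0 \<or> a \<noteq> d" using assms[of a] by (auto simp: A mat22_simps)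
  then have "\<exists>x y. x * (c * x + d * y) - (a * x + b * y) * y \<noteq> 0"
  proof (elim disjE)
    assume "c \<noteq> 0" then show ?thesis by (intro exI[of _ 1] exI[of _ 0]) simp
  next
    assume "b \<noteq> 0" then show ?thesis by (intro exI[of _ 0] exI[of _ 1]) simp
  next
    assume "a \<noteq> d"
    show ?thesis
    proof (cases "c = 0 \<and> b = 0")
      case True then show ?thesis using \<open>a \<noteq> d\<close> by (intro exI[of _ 1] exI[of _ 1]) simp
    next
      case False
      then show ?thesis
      proof (cases "c = 0")
        case True then show ?thesis using False by (intro exI[of _ 0] exI[of _ 1]) simp
      next
        case False then show ?thesis by (intro exI[of _ 1] exI[of _ 0]) simp
      qed
    qed
  qed
  then obtain x y where "x * (c * x + d * y) - (a * x + b * y) * y \<noteq> 0" by blast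
  then show ?thesis
    by (intro exI[of _ "mat22 x (a * x + b * y) y (c * x + d * y)"])
      (simp add: A mat22_simps algebra_simps)
qed

lemma similar_of_trace_det:
  fixes A A' :: "'k::field ^ 2 ^ 2"
  assumes "\<And>c. A \<noteq> mat c" "\<And>c. A' \<noteq> mat c" "trace A = trace A'" "det A = det A'"
  shows "\<exists>g. det g \<noteq> 0 \<and> g ** A = A' ** g"
proof -
  let ?K = "mat22 0 (- det A) 1 (trace A)"
  obtain P where P: "det P \<noteq> 0" "A ** P = P ** ?K"
    using companion_basis[OF assms(1)] by blast
  obtain P' where P': "det P' \<noteq> 0" "A' ** P' = P' ** ?K"
    using companion_basis[OF assms(2)] assms(3,4) by auto
  obtain Q where Q: "P ** Q = mat 1" "Q ** P = mat 1"
    using P(1) invertible_det_nz[of P] unfolding invertible_def by blast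
  have "det Q \<noteq> 0" using Q(2) det_mul[of Q P] by (auto simp: det_I)
  moreover have "(P' ** Q) ** A = A' ** (P' ** Q)"
  proof -
    have "(P' ** Q) ** A = P' ** Q ** (A ** P) ** Q"
      using Q by (simp flip: matrix_mul_assoc)
    also have "\<dots> = P' ** (Q ** P) ** ?K ** Q" by (simp add: P(2) matrix_mul_assoc)
    also have "\<dots> = A' ** (P' ** Q)" by (simp add: Q P'(2)[symmetric] matrix_mul_assoc)
    finally show ?thesis .
  qed
  ultimately show ?thesis using P'(1) by (intro exI[of _ "P' ** Q"]) (simp add: det_mul)
qed

text \<open>For the commutator \<open>N\<close> the traces of \<open>N\<close>, \<open>AN\<close> and
  \<open>BN\<close> vanish, so the polarised Cayley--Hamilton identity becomes \<open>NA = (tr A - A) N\<close>, and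
  likewise for \<open>B\<close>.  Hence \<open>A\<close> and \<open>B\<close> preserve the kernel of \<open>N\<close>,
  which is a line.\<close>

lemma commutator_kernel_eigenvector:
  fixes A B :: "'k::field ^ 2 ^ 2"
  assumes "A ** B \<noteq> B ** A" "(A ** B - B ** A) *v v = 0" "v \<noteq> 0"
  shows "has_eigenvector A v" "has_eigenvector B v"
proof -
  define N where "N = A ** B - B ** A"
  have N0: "N \<noteq> 0" using assms(1) by (simp add: N_def)
  obtain a b c d where A: "A = mat22 a b c d" by (rule mat22_cases)
  obtain a' b' c' d' where B: "B = mat22 a' b' c' d'" by (rule mat22_cases)
  have 1: "N ** A = (mat (trace A) - A) ** N" "N ** B = (mat (trace B) - B) ** N"
    unfolding N_def A B by (simp_all add: mat22_simps algebra_simps)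
  have "N *v (W *v v) = 0" if "N ** W = Y ** N" for W Y :: "'k ^ 2 ^ 2"
  proof -
    have "N *v (W *v v) = Y *v (N *v v)" using that by (simp add: matrix_vector_mul_assoc)
    then show ?thesis using assms(2) by (simp add: N_def)
  qed
  then show "has_eigenvector A v" "has_eigenvector B v"
    using kernel_line[OF N0 _ _ assms(3)] 1 assms(2) unfolding has_eigenvector_def N_def[symmetric]
    by blast+
qed

text \<open>The polarised Cayley--Hamilton identity for \<open>A\<close> and \<open>D\<close>.\<close>

lemma trace_zero_anticommute:
  fixes A D :: "'k::field ^ 2 ^ 2"
  assumes "trace D = 0" "trace (A ** D) = 0"
  shows "A ** D = D ** (mat (trace A) - A)"
proof -
  obtain a b c d where A: "A = mat22 a b c d" by (rule mat22_cases)
  obtain p q r s where D: "D = mat22 p q r s" by (rule mat22_cases)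
  have s: "s = - p" using assms(1) by (simp add: D mat22_simps add_eq_0_iff)
  have "b * r = d * p - a * p - c * q" using assms(2) by (simp add: A D s mat22_simps algebra_simps eq_neg_iff_add_eq_0)
  then show ?thesis unfolding A D s by (simp add: mat22_simps algebra_simps)
qed

text \<open>Write \<open>N\<close> for the commutator and \<open>D = B - B'\<close>.  Moving \<open>A\<close> through
  \<open>N\<close> or through \<open>D\<close> turns it into its adjugate \<open>tr A - A\<close> and back, so it
  commutes with \<open>DN\<close>.  As \<open>B\<close> and \<open>B'\<close> have the same trace \<open>b\<close> and
  determinant \<open>1\<close>, their inverses are \<open>b - B\<close> and \<open>b - B'\<close>, which gives
  \<open>NB = B\<^sup>-\<^sup>1N\<close> and \<open>DB\<^sup>-\<^sup>1 = 1 - B'B\<^sup>-\<^sup>1 =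
  B'(B'\<^sup>-\<^sup>1 - B\<^sup>-\<^sup>1) = B'D\<close>.\<close>

lemma intertwiner_same_first:
  fixes A B B' :: "'k::field ^ 2 ^ 2"
  assumes "det B = 1" "det B' = 1" "trace B = trace B'" "trace (A ** B) = trace (A ** B')"
  defines "g \<equiv> (B - B') ** (A ** B - B ** A)"
  shows "g ** A = A ** g" "g ** B = B' ** g"
proof -
  have N: "(A ** B - B ** A) ** W = (mat (trace W) - W) ** (A ** B - B ** A)" if "W = A \<or> W = B" for W :: "'k ^ 2 ^ 2"
  proof -
    obtain a b c d where A: "A = mat22 a b c d" by (rule mat22_cases)
    obtain p q r s where B: "B = mat22 p q r s" by (rule mat22_cases)
    show ?thesis using that by (elim disjE; simp add: A B mat22_simps algebra_simps)
  qed
  have t: "trace (B - B') = 0" "trace (A ** (B - B')) = 0"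
    using assms(3,4) by (simp_all add: trace_def sum_2 matrix_matrix_mult_def algebra_simps)
  have "g ** A = (B - B') ** ((A ** B - B ** A) ** A)" unfolding g_def by (simp only: matrix_mul_assoc)
  also have "\<dots> = ((B - B') ** (mat (trace A) - A)) ** (A ** B - B ** A)"
    by (simp add: N matrix_mul_assoc)
  also have "\<dots> = A ** g" unfolding trace_zero_anticommute[OF t, symmetric] g_def by (simp only: matrix_mul_assoc)
  finally show "g ** A = A ** g" .
  have C: "(B - B') ** (mat (trace B) - B) = B' ** (B - B')"
  proof -
    obtain p q r s where B: "B = mat22 p q r s" by (rule mat22_cases)
    obtain p' q' r' s' where B': "B' = mat22 p' q' r' s'" by (rule mat22_cases)
    have s: "s = p' + s' - p" using assms(3) by (simp add: B B' mat22_simps algebra_simps)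
    have "p * s = 1 + q * r" "p' * s' = 1 + q' * r'" using assms(1,2) 
      by (simp_all add: B B' mat22_simps algebra_simps)
    then show ?thesis
      by (simp add: B B' s mat22_simps algebra_simps)
  qed
  have "g ** B = (B - B') ** ((A ** B - B ** A) ** B)" unfolding g_def by (simp only: matrix_mul_assoc)
  also have "\<dots> = ((B - B') ** (mat (trace B) - B)) ** (A ** B - B ** A)"
    by (simp add: N matrix_mul_assoc)
  also have "\<dots> = B' ** g" unfolding C g_def by (simp only: matrix_mul_assoc)
  finally show "g ** B = B' ** g" .
qed
text \<open>Bringing \<open>A\<close> and \<open>A'\<close> to the same companion form reduces the claim to \<open>A =
  A'\<close>, where the intertwiner can be written down: it is \<open>(B - B')(AB - BA)\<close>.  It is nonzero
  because the commutator is invertible, by the absence of a common eigenvector, and it is then invertible for the same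
  reason.\<close>

lemma simultaneously_similar:
  fixes A B A' B' :: "'k::field ^ 2 ^ 2"
  assumes det: "det A = 1" "det B = 1" "det A' = 1" "det B' = 1"
    and trace: "trace A = trace A'" "trace B = trace B'" "trace (A ** B) = trace (A' ** B')"
    and irr: "A ** B \<noteq> B ** A" "\<And>v. v \<noteq> 0 \<Longrightarrow> has_eigenvector A v \<Longrightarrow> has_eigenvector B v \<Longrightarrow> False"
    and irr': "A' ** B' \<noteq> B' ** A'"
  shows "\<exists>g. det g \<noteq> 0 \<and> g ** A = A' ** g \<and> g ** B = B' ** g"
proof -
  have "A \<noteq> mat c" for c using irr(1) by (auto simp: mat_mul_left mat_mul_right)
  moreover have "A' \<noteq> mat c" for c using irr' by (auto simp: mat_mul_left mat_mul_right)
  ultimately obtain h where h: "det h \<noteq> 0" "h ** A = A' ** h"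
    using similar_of_trace_det[of A A'] det trace(1) by auto
  obtain k where k: "h ** k = mat 1" "k ** h = mat 1"
    using h(1) invertible_det_nz[of h] unfolding invertible_def by blast
  \<comment> \<open>Conjugating the second pair by \<open>h\<close> makes its first member equal to
    \<open>A\<close>.\<close>
  define C where "C = k ** B' ** h"
  have hC: "h ** C = B' ** h" by (simp add: C_def matrix_mul_assoc k)
  have tr: "trace (k ** M ** h) = trace M" for M :: "'k ^ 2 ^ 2"
    using trace_mul_sym[of "k ** M" h] by (simp add: matrix_mul_assoc k)
  have A: "A = k ** A' ** h" using h(2) k by (metis matrix_mul_assoc matrix_mul_lid)
  have C: "det C = 1" "trace B = trace C" "trace (A ** B) = trace (A ** C)"
  proof -
    have "det h * det C = det h * 1" using arg_cong[OF hC, of det] by (simp add: det_mul det)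
    then show "det C = 1" using h(1) by (simp only: mult_cancel_left) simp
    show "trace B = trace C" by (simp add: C_def tr trace(2))
    have "A ** C = k ** (A' ** B') ** h"
    proof -
      have "A ** C = k ** A' ** (h ** k) ** B' ** h"
        unfolding C_def by (subst A) (simp only: matrix_mul_assoc)
      then show ?thesis by (simp add: k matrix_mul_assoc)
    qed
    then show "trace (A ** B) = trace (A ** C)" by (simp only: tr trace(3))
  qed
  have *: "\<exists>g. det g \<noteq> 0 \<and> g ** A = A ** g \<and> g ** B = C ** g"
  proof (cases "B = C")
    case True
    then show ?thesis by (intro exI[of _ "mat 1"]) (simp add: det_I)
  next
    case False
    define N where "N = A ** B - B ** A"
    have "det N \<noteq> 0"
    proof
      assume "det N = 0"
      then obtain v where "v \<noteq> 0" "N *v v = 0" using singular_kernel by blast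
      then show False
        using commutator_kernel_eigenvector[OF irr(1), of v] irr(2)[of v] by (simp add: N_def)
    qed
    then obtain M where M: "N ** M = mat 1" using invertible_det_nz[of N] unfolding invertible_def by blast
    define g where "g = (B - C) ** N"
    have "g \<noteq> 0"
    proof
      assume "g = 0"
      then have "(B - C) ** (N ** M) = 0" by (simp add: g_def matrix_mul_assoc)
      then show False using False by (simp add: M)
    qed
    moreover have "g ** A = A ** g" "g ** B = C ** g"
      unfolding g_def N_def by (rule intertwiner_same_first[OF det(2) C])+
    ultimately show ?thesis using intertwiner_invertible[of g A A B C] irr(2) by blast
  qed
  then obtain g where g: "det g \<noteq> 0" "g ** A = A ** g" "g ** B = C ** g" by blast
  have "h ** g ** A = A' ** (h ** g)"
    using g(2) h(2) by (metis matrix_mul_assoc)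
  moreover have "h ** g ** B = B' ** (h ** g)"
    using g(3) hC by (metis matrix_mul_assoc)
  ultimately show ?thesis
    using g(1) h(1) by (intro exI[of _ "h ** g"]) (simp add: det_mul)
qed

section \<open>Matrices representing elements of \<open>PSL\<close>, and conjugation by \<open>GL\<close>\<close>

lemma matrix_inv_mult:
  fixes g :: "'k::field ^ 'n::finite ^ 'n"
  assumes "det g \<noteq> 0"
  shows "g ** matrix_inv g = mat 1" "matrix_inv g ** g = mat 1"
proof -
  have "\<exists>h. g ** h = mat 1 \<and> h ** g = mat 1"
    using assms invertible_det_nz[of g] by (simp add: invertible_def)
  then have "g ** matrix_inv g = mat 1 \<and> matrix_inv g ** g = mat 1"
    unfolding matrix_inv_def by (rule someI_ex)
  then show "g ** matrix_inv g = mat 1" "matrix_inv g ** g = mat 1" by blast+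
qed

lemma det_matrix_inv:
  fixes g :: "'k::field ^ 'n::finite ^ 'n"
  assumes "det g \<noteq> 0"
  shows "det (matrix_inv g) = inverse (det g)"
proof -
  have "det g * det (matrix_inv g) = 1"
    using matrix_inv_mult(1)[OF assms] by (metis det_I det_mul)
  then show ?thesis by (metis inverse_unique)
qed

definition psl :: "'k::field ^ 'n::finite ^ 'n \<Rightarrow> ('k ^ 'n ^ 'n) set" where
  "psl A = SL_scalars #>\<^bsub>SL\<^esub> A"

lemma carrier_SL [simp]: "A \<in> carrier SL \<longleftrightarrow> det A = 1"
  and mult_SL [simp]: "A \<otimes>\<^bsub>SL\<^esub> B = A ** B"
  and one_SL [simp]: "\<one>\<^bsub>SL\<^esub> = mat 1"
  by (simp_all add: SL_def)

lemma psl_closed [simp, intro]: "det A = 1 \<Longrightarrow> psl A \<in> carrier PSL"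
  by (auto simp: PSL_def FactGroup_def RCOSETS_def psl_def)

lemma psl_cases:
  assumes "W \<in> carrier PSL" obtains A where "det A = 1" "W = psl A"
  using assms by (auto simp: PSL_def FactGroup_def RCOSETS_def psl_def)

lemma psl_mult: "det A = 1 \<Longrightarrow> det B = 1 \<Longrightarrow> psl A \<otimes>\<^bsub>PSL\<^esub> psl B = psl (A ** B)"
  using hom_mult[OF normal.r_coset_hom_Mod[OF normal_SL_scalars], of A B]
  by (simp add: PSL_def psl_def)

lemma psl_one: "psl (mat 1) = \<one>\<^bsub>PSL\<^esub>"
proof -
  have "psl (mat 1 :: 'a ^ 'b ^ 'b) \<otimes>\<^bsub>PSL\<^esub> psl (mat 1) = psl (mat 1)"
    by (subst psl_mult) (simp_all add: det_I)
  then show ?thesis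
    by (intro group.l_cancel_one'[OF group_PSL, THEN iffD1, symmetric]
        group.l_cancel_one[OF group_PSL, THEN iffD1]) (simp_all add: det_I)
qed

lemma psl_inv: "det A = 1 \<Longrightarrow> inv\<^bsub>PSL\<^esub> psl A = psl (matrix_inv A)"
  by (intro group.inv_equality[OF group_PSL])
    (simp_all add: psl_mult det_matrix_inv matrix_inv_mult psl_one)

lemma psl_eq:
  fixes A :: "'k::field ^ 2 ^ 2"
  shows "psl A = {A, - A}"
proof -
  have S: "SL_scalars = {mat 1, - mat 1 :: 'k ^ 2 ^ 2}"
  proof -
    have "det (mat c :: 'k ^ 2 ^ 2) = 1 \<longleftrightarrow> c = 1 \<or> c = -1" for c :: 'k
      by (simp add: mat22_simps flip: power2_eq_square add: power2_eq_1_iff)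
    then show ?thesis
      by (auto simp: SL_scalars_def mat22_simps)
  qed
  have "(- mat 1) ** A = - A"
    by (rule mat22_cases[of A]) (simp add: mat22_simps)
  then show ?thesis by (auto simp: psl_def r_coset_def S)
qed

lemma psl_eq_iff:
  fixes A B :: "'k::field ^ 2 ^ 2"
  shows "psl A = psl B \<longleftrightarrow> A = B \<or> A = - B"
  by (auto simp: psl_eq doubleton_eq_iff)

lemma det_uminus22: "det (- A) = det A" for A :: "'k::field ^ 2 ^ 2"
  by (simp add: det_2)

lemma trace_uminus: "trace (- A) = - trace A" for A :: "'k::field ^ 'n::finite ^ 'n"
  by (simp add: trace_def sum_negf)

lemma uminus_matrix_mult: "(- A) ** B = - (A ** B)" "A ** (- B) = - (A ** B)"
  for A B :: "'k::field ^ 'n::finite ^ 'n"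
  by (simp_all add: matrix_matrix_mult_def vec_eq_iff sum_negf)

text \<open>The elements with a representative satisfying \<open>P\<close> form a subgroup containing two
  generators.\<close>

lemma psl_generated_induct:
  fixes A B M :: "'k::field ^ 2 ^ 2"
  assumes t: "(psl A, psl B, z) \<in> triples PSL" and det: "det A = 1" "det B = 1" "det M = 1"
    and P: "P A" "P B" "P (mat 1)" "\<And>M. P M \<Longrightarrow> P (- M)"
      "\<And>M N. P M \<Longrightarrow> P N \<Longrightarrow> P (M ** N)"
      "\<And>M. det M = 1 \<Longrightarrow> P M \<Longrightarrow> P (matrix_inv M)"
  shows "P M"
proof -
  interpret G: group "PSL :: ('k ^ 2 ^ 2) set monoid" by (rule group_PSL)
  define S where "S = psl ` {M :: 'k ^ 2 ^ 2. det M = 1 \<and> P M}"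
  have S: "subgroup S PSL"
  proof (rule G.subgroupI)
    show "S \<subseteq> carrier PSL" by (auto simp: S_def)
    show "S \<noteq> {}" using P(3) det_I[where 'a = 'k and 'n = 2] unfolding S_def by blast
  next
    fix a assume "a \<in> S"
    then show "inv\<^bsub>PSL\<^esub> a \<in> S" using P(6) by (auto simp: S_def psl_inv det_matrix_inv)
  next
    fix a b assume "a \<in> S" "b \<in> S"
    then show "a \<otimes>\<^bsub>PSL\<^esub> b \<in> S" using P(5) by (auto simp: S_def psl_mult det_mul)
  qed
  have c: "psl A \<in> carrier PSL" "psl B \<in> carrier PSL" "z \<in> carrier PSL"
    and e: "psl A \<otimes>\<^bsub>PSL\<^esub> psl B \<otimes>\<^bsub>PSL\<^esub> z = \<one>\<^bsub>PSL\<^esub>"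
    and gen: "generate PSL {psl A, psl B, z} = carrier PSL"
    using t by (auto simp: triples_def)
  have AB: "psl A \<in> S" "psl B \<in> S" using P det by (auto simp: S_def)
  have "z = inv\<^bsub>PSL\<^esub> (psl A \<otimes>\<^bsub>PSL\<^esub> psl B)" by (rule G.triple_inv(1)[OF e c])
  then have "z \<in> S" using AB S by (simp add: subgroup.m_closed subgroup.m_inv_closed)
  then have "generate PSL {psl A, psl B, z} \<subseteq> S"
    using AB by (intro G.generate_subgroup_incl[OF _ S]) auto
  then have "psl M \<in> S" using gen det(3) by auto
  then obtain N where "P N" "M = N \<or> M = - N" by (auto simp: S_def psl_eq_iff)
  then show ?thesis using P(4) by auto
qed

text \<open>If \<open>A\<close> and \<open>B\<close> commuted, then \<open>SL(2, k)\<close> would be abelian; a common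
  eigenvector of \<open>A\<close> and \<open>B\<close> would be one of all of \<open>SL(2, k)\<close>.  The two
  elementary transvections refute both.\<close>

lemma triple_irreducible:
  fixes A B :: "'k::field ^ 2 ^ 2"
  assumes t: "(psl A, psl B, z) \<in> triples PSL" and det: "det A = 1" "det B = 1"
  shows "A ** B \<noteq> B ** A" "v \<noteq> 0 \<Longrightarrow> has_eigenvector A v \<Longrightarrow> has_eigenvector B v \<Longrightarrow> False"
proof -
  note ind = psl_generated_induct[OF t det]
  have E: "det (mat22 1 1 0 1 :: 'k ^ 2 ^ 2) = 1" "det (mat22 1 0 1 1 :: 'k ^ 2 ^ 2) = 1"
    by (simp_all add: mat22_simps)
  show "A ** B \<noteq> B ** A"
  proof
    assume AB: "A ** B = B ** A"
    have *: "M ** C = C ** M" if "A ** C = C ** A" "B ** C = C ** B" "det M = 1"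
      for M C :: "'k ^ 2 ^ 2"
    proof (rule ind[where P = "\<lambda>M. M ** C = C ** M"])
      fix M N :: "'k ^ 2 ^ 2" assume "M ** C = C ** M" "N ** C = C ** N"
      then show "M ** N ** C = C ** (M ** N)" by (metis matrix_mul_assoc)
    next
      fix M :: "'k ^ 2 ^ 2" assume M: "det M = 1" "M ** C = C ** M"
      then show "matrix_inv M ** C = C ** matrix_inv M"
        using matrix_inv_mult[of M] by (metis matrix_mul_assoc matrix_mul_lid matrix_mul_rid zero_neq_one)
    qed (use that in \<open>simp_all add: uminus_matrix_mult\<close>)
    have "M ** A = A ** M" "M ** B = B ** M" if "det M = 1" for M :: "'k ^ 2 ^ 2"
      using *[of A M] *[of B M] AB that by auto
    then have "M ** N = N ** M" if "det M = 1" "det N = 1" for M N :: "'k ^ 2 ^ 2"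
      using *[of N M] that by auto
    from this[OF E] have "(1 + 1 :: 'k) = 1" by (simp add: mat22_simps)
    then have "(1 :: 'k) = 0" by (metis add_left_cancel add_0_right)
    then show False by simp
  qed
  show False if v: "v \<noteq> 0" "has_eigenvector A v" "has_eigenvector B v"
  proof -
    have *: "has_eigenvector M v" if "det M = 1" for M :: "'k ^ 2 ^ 2"
      using that
    proof (rule ind[where P = "\<lambda>M. has_eigenvector M v"])
      show "has_eigenvector (mat 1) v" by (auto simp: has_eigenvector_def intro: exI[of _ 1])
    next
      fix M :: "'k ^ 2 ^ 2" assume "has_eigenvector M v"
      then obtain c where "M *v v = c *s v" by (auto simp: has_eigenvector_def)
      then have "(- M) *v v = (- c) *s v"
        by (simp add: matrix_vector_mult_def vec_eq_iff sum_negf)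
      then show "has_eigenvector (- M) v" unfolding has_eigenvector_def by blast
    next
      fix M N :: "'k ^ 2 ^ 2" assume "has_eigenvector M v" "has_eigenvector N v"
      then obtain c d where "M *v v = c *s v" "N *v v = d *s v" by (auto simp: has_eigenvector_def)
      then have "(M ** N) *v v = (d * c) *s v"
        by (simp add: matrix_vector_mult_scaleR flip: matrix_vector_mul_assoc add: vector_scalar_commute)
      then show "has_eigenvector (M ** N) v" by (auto simp: has_eigenvector_def)
    next
      fix M :: "'k ^ 2 ^ 2" assume M: "det M = 1" "has_eigenvector M v"
      then obtain c where c: "M *v v = c *s v" by (auto simp: has_eigenvector_def)
      have "matrix_inv M *v (M *v v) = v" using M(1) by (simp add: matrix_vector_mul_assoc matrix_inv_mult)
      then have e: "c *s (matrix_inv M *v v) = v" by (simp add: c vector_scalar_commute)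
      then have "c \<noteq> 0" using v(1) by auto
      then have "matrix_inv M *v v = inverse c *s v" using e
        by (metis left_inverse vector_smult_assoc vector_smult_lid)
      then show "has_eigenvector (matrix_inv M) v" by (auto simp: has_eigenvector_def)
    qed (use v in auto)
    from *[OF E(1)] *[OF E(2)] obtain c d where
      "v $ 1 + v $ 2 = c * v $ 1" "v $ 2 = c * v $ 2" "v $ 1 = d * v $ 1" "v $ 1 + v $ 2 = d * v $ 2"
      by (auto simp: has_eigenvector_def vec_eq_iff matrix_vector_mult_def sum_2 forall_2)
    moreover from this have "v $ 2 = 0" by (cases "c = 1") auto
    ultimately have "v $ 1 = 0 \<and> v $ 2 = 0" by simp
    then show False using v(1) by (simp add: vec_eq_iff forall_2)
  qed
qed

text \<open>The elements of \<open>PSL\<close> are cosets, so that conjugates are formed as images.  For invertible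
  \<open>g\<close> of any determinant this is an automorphism.\<close>

definition psl_conj :: "'k::field ^ 2 ^ 2 \<Rightarrow> ('k ^ 2 ^ 2) set \<Rightarrow> ('k ^ 2 ^ 2) set" where
  "psl_conj g = (\<lambda>W\<in>carrier PSL. (\<lambda>M. g ** M ** matrix_inv g) ` W)"

lemma psl_conj_psl: "det A = 1 \<Longrightarrow> psl_conj g (psl A) = psl (g ** A ** matrix_inv g)"
  using psl_closed[of A] by (simp add: psl_conj_def psl_eq uminus_matrix_mult)

lemma det_conj: "det g \<noteq> 0 \<Longrightarrow> det (g ** A ** matrix_inv g) = det A" for g A :: "'k::field ^ 2 ^ 2"
  by (simp add: det_mul det_matrix_inv)

lemma psl_conj_eqI:
  assumes "det A = 1" "det g \<noteq> 0" "g ** A = A' ** g"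
  shows "psl_conj g (psl A) = psl A'"
proof -
  have "g ** A ** matrix_inv g = A'"
    using assms matrix_inv_mult[of g] by (metis matrix_mul_assoc matrix_mul_rid)
  then show ?thesis using assms by (simp add: psl_conj_psl)
qed

lemma psl_conj_mult:
  assumes "det g \<noteq> 0" "det h \<noteq> 0" "W \<in> carrier PSL"
  shows "psl_conj g (psl_conj h W) = psl_conj (g ** h) W"
proof -
  obtain A where A: "det A = 1" "W = psl A" by (rule psl_cases[OF assms(3)])
  let ?B = "g ** (h ** A ** matrix_inv h) ** matrix_inv g"
  have "(g ** h) ** A = ?B ** (g ** h)"
  proof -
    have "?B ** (g ** h) = g ** h ** A ** matrix_inv h ** (matrix_inv g ** g) ** h"
      by (simp only: matrix_mul_assoc)
    also have "\<dots> = g ** h ** A ** (matrix_inv h ** h)" 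
      by (simp add: matrix_inv_mult assms flip: matrix_mul_assoc)
    finally show ?thesis by (simp add: matrix_inv_mult assms)
  qed
  then have "psl_conj (g ** h) W = psl ?B"
    unfolding A(2) using A(1) assms by (intro psl_conj_eqI) (simp_all add: det_mul)
  then show ?thesis using A assms by (simp add: psl_conj_psl det_conj)
qed

lemma psl_conj_inner:
  assumes "det g = 1" "W \<in> carrier PSL"
  shows "psl_conj g W = conj_by PSL W (psl (matrix_inv g))"
proof -
  interpret G: group "PSL :: ('a ^ 2 ^ 2) set monoid" by (rule group_PSL)
  obtain A where A: "det A = 1" "W = psl A" by (rule psl_cases[OF assms(2)])
  have "psl (matrix_inv g) = inv\<^bsub>PSL\<^esub> psl g" using assms by (simp add: psl_inv)
  then have "conj_by PSL W (psl (matrix_inv g)) = psl g \<otimes>\<^bsub>PSL\<^esub> psl A \<otimes>\<^bsub>PSL\<^esub> psl (matrix_inv g)"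
    using assms A by (simp add: conj_by_def)
  then show ?thesis using A assms by (simp add: psl_mult psl_conj_psl det_mul det_matrix_inv)
qed

lemma conj_by_psl:
  assumes "det h = 1" "W \<in> carrier PSL"
  shows "conj_by PSL W (psl h) = psl_conj (matrix_inv h) W"
proof -
  have "matrix_inv (matrix_inv h) = h"
    using assms(1) matrix_inv_mult[of h] matrix_inv_mult[of "matrix_inv h"]
    by (metis det_matrix_inv inverse_1 matrix_mul_assoc matrix_mul_lid matrix_mul_rid one_neq_zero)
  then show ?thesis using psl_conj_inner[of "matrix_inv h" W] assms by (simp add: det_matrix_inv)
qed

lemma psl_conj_one: "W \<in> carrier PSL \<Longrightarrow> psl_conj (mat 1) W = W"
  by (erule psl_cases) (simp add: psl_conj_eqI det_I)

lemma psl_conj_closed: "det g \<noteq> 0 \<Longrightarrow> W \<in> carrier PSL \<Longrightarrow> psl_conj g W \<in> carrier PSL"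
  by (erule psl_cases) (simp add: psl_conj_psl psl_closed det_conj)

lemma psl_conj_auto:
  assumes "det g \<noteq> 0" shows "psl_conj g \<in> auto PSL"
proof -
  have inv: "det (matrix_inv g) \<noteq> 0" using assms by (simp add: det_matrix_inv)
  have "bij_betw (psl_conj g) (carrier PSL) (carrier PSL)"
    by (rule bij_betw_byWitness[where f' = "psl_conj (matrix_inv g)"])
      (auto simp: psl_conj_mult assms inv matrix_inv_mult psl_conj_one psl_conj_closed)
  moreover have "psl_conj g \<in> hom PSL PSL"
  proof (rule homI)
    fix x y :: "('a ^ 2 ^ 2) set" assume "x \<in> carrier PSL" "y \<in> carrier PSL"
    then obtain A B where AB: "det A = 1" "x = psl A" "det B = 1" "y = psl B"
      by (meson psl_cases)
    have "g ** A ** matrix_inv g ** (g ** B ** matrix_inv g) =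
        g ** A ** (matrix_inv g ** g) ** B ** matrix_inv g"
      by (simp only: matrix_mul_assoc)
    then have "g ** A ** matrix_inv g ** (g ** B ** matrix_inv g) = g ** (A ** B) ** matrix_inv g"
      by (simp add: matrix_inv_mult assms flip: matrix_mul_assoc)
    then show "psl_conj g (x \<otimes>\<^bsub>PSL\<^esub> y) = psl_conj g x \<otimes>\<^bsub>PSL\<^esub> psl_conj g y"
      using AB assms det_mul[of A B] by (simp add: psl_conj_psl psl_mult det_conj)
  qed (rule psl_conj_closed[OF assms])
  ultimately show ?thesis by (simp add: auto_def Bij_def psl_conj_def)
qed

lemma psl_conj_scalar:
  fixes g :: "'k::field ^ 2 ^ 2"
  assumes "det g \<noteq> 0" "s \<noteq> 0" "W \<in> carrier PSL"
  shows "psl_conj (mat s ** g) W = psl_conj g W"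
proof -
  obtain A where A: "det A = 1" "W = psl A" by (rule psl_cases[OF assms(3)])
  have d: "det (mat s ** g) \<noteq> 0" using assms by (simp add: det_mul mat22_simps)
  have c: "mat s ** N = N ** mat s" for N :: "'k ^ 2 ^ 2" by (simp add: mat_mul_left mat_mul_right)
  let ?B = "g ** A ** matrix_inv g"
  have "?B ** (mat s ** g) = mat s ** (?B ** g)"
    using c by (metis matrix_mul_assoc)
  also have "?B ** g = g ** A" by (simp add: matrix_inv_mult assms flip: matrix_mul_assoc)
  finally have "mat s ** g ** A = ?B ** (mat s ** g)" by (simp add: matrix_mul_assoc)
  then show ?thesis using A assms d by (simp add: psl_conj_eqI psl_conj_psl)
qed

text \<open>Dividing \<open>g\<close> by a root of its determinant gives a matrix in \<open>SL\<close> that induces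
  the same automorphism.\<close>

lemma psl_conj_square_inner:
  fixes g :: "'k::field ^ 2 ^ 2"
  assumes "det g = s ^ 2" "s \<noteq> 0"
  shows "\<exists>h\<in>carrier PSL. \<forall>W\<in>carrier PSL. psl_conj g W = conj_by PSL W h"
proof -
  define g' where "g' = mat (inverse s) ** g"
  have "g = mat s ** g'"
    using assms(2) by (simp add: g'_def matrix_mul_assoc mat_mul_left) (simp add: mat_def vec_eq_iff)
  have d: "det g' = 1" using assms
    by (simp add: g'_def det_mul mat22_simps) (simp add: power2_eq_square divide_simps)
  have "psl_conj g W = conj_by PSL W (psl (matrix_inv g'))" if "W \<in> carrier PSL" for W
    unfolding \<open>g = mat s ** g'\<close> using psl_conj_scalar[of g' s W] psl_conj_inner[of g' W] d assms that by simp
  then show ?thesis using d by (intro bexI[of _ "psl (matrix_inv g')"]) (simp_all add: det_matrix_inv psl_closed)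
qed

section \<open>An automorphism whose square is conjugation by a matrix\<close>

lemma square_roots_card_le: "card {x. x ^ 2 = (s :: 'k::{field,finite})} \<le> 2"
proof (cases "\<exists>y. y ^ 2 = s")
  case True
  then obtain y where "y ^ 2 = s" by blast
  then have "{x. x ^ 2 = s} \<subseteq> {y, - y}" by (auto simp: power2_eq_iff)
  then have "card {x. x ^ 2 = s} \<le> card {y, - y}" by (intro card_mono) auto
  also have "\<dots> \<le> 2" by (simp add: card_insert_if)
  finally show ?thesis .
qed simp

text \<open>Squaring is at most two-to-one, so at least half of the nonzero elements are squares; a coset of the
  squares other than the squares themselves must therefore contain all the remaining elements.\<close>

lemma nonsquare_mult_nonsquare:
  fixes e f :: "'k::{field,finite}"
  assumes "\<And>s. e \<noteq> s ^ 2" "\<And>s. f \<noteq> s ^ 2"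
  shows "\<exists>s. e * f = s ^ 2"
proof -
  define S where "S = (\<lambda>x :: 'k. x ^ 2) ` (UNIV - {0})"
  have e0: "e \<noteq> 0" "f \<noteq> 0" using assms(1)[of 0] assms(2)[of 0] by auto
  have "UNIV - {0} \<subseteq> (\<Union>s\<in>S. {x. x ^ 2 = s})" by (auto simp: S_def)
  then have "card (UNIV - {0 :: 'k}) \<le> card (\<Union>s\<in>S. {x. x ^ 2 = s})"
    by (intro card_mono) auto
  also have "\<dots> \<le> (\<Sum>s\<in>S. card {x. x ^ 2 = s})" by (rule card_UN_le) simp
  also have "\<dots> \<le> (\<Sum>s\<in>S. 2)" by (intro sum_mono square_roots_card_le)
  also have "\<dots> = card S + card ((\<lambda>x. e * x) ` S)"
    using e0 by (subst card_image) (auto simp: inj_on_def)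
  also have "\<dots> = card (S \<union> (\<lambda>x. e * x) ` S)"
  proof (rule card_Un_disjoint[symmetric])
    show "S \<inter> (\<lambda>x. e * x) ` S = {}"
    proof -
      have "False" if "a ^ 2 = e * b ^ 2" "b \<noteq> 0" for a b
        using assms(1)[of "a / b"] that by (simp add: power_divide)
      then show ?thesis by (auto simp: S_def)
    qed
  qed auto
  finally have "S \<union> (\<lambda>x. e * x) ` S = UNIV - {0}"
    using e0 by (intro card_seteq) (auto simp: S_def)
  then have "f \<in> S \<union> (\<lambda>x. e * x) ` S" using e0 by auto
  then obtain y where "f = e * y ^ 2" using assms(2) by (auto simp: S_def)
  then show ?thesis by (intro exI[of _ "e * y"]) (simp add: power2_eq_square mult_ac)
qed

lemma nonsquare_exists:
  assumes "(2 :: 'k::{field,finite}) \<noteq> 0"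
  shows "\<exists>e :: 'k. \<forall>s. e \<noteq> s ^ 2"
proof (rule ccontr)
  assume "\<not> ?thesis"
  then have "surj (\<lambda>s :: 'k. s ^ 2)" by (auto simp: surj_def)
  then have "inj (\<lambda>s :: 'k. s ^ 2)" by (simp add: finite_UNIV_surj_inj)
  then have "(1 :: 'k) = - 1" by (rule injD) simp
  then show False using assms by (metis add.right_inverse one_add_one)
qed

lemma square_char_2:
  assumes "(2 :: 'k::{field,finite}) = 0"
  shows "\<exists>s :: 'k. x = s ^ 2"
proof -
  have "inj (\<lambda>s :: 'k. s ^ 2)"
  proof (rule injI)
    fix a b :: 'k assume "a ^ 2 = b ^ 2"
    then have "a = b \<or> a = - b" by (simp add: power2_eq_iff)
    moreover have "b + b = 0" using assms by (metis mult_2 mult_zero_left)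
    ultimately show "a = b" by (auto simp: add_eq_0_iff)
  qed
  then have "surj (\<lambda>s :: 'k. s ^ 2)" by (simp add: finite_UNIV_inj_surj)
  then show ?thesis by (rule surjD)
qed

primrec matpow :: "'k::field ^ 'n::finite ^ 'n \<Rightarrow> nat \<Rightarrow> 'k ^ 'n ^ 'n" where
  "matpow M 0 = mat 1"
| "matpow M (Suc n) = matpow M n ** M"

lemma det_matpow: "det M = 1 \<Longrightarrow> det (matpow M n) = 1"
  by (induction n) (simp_all add: det_mul det_I)

lemma psl_pow: "det M = 1 \<Longrightarrow> psl M [^]\<^bsub>PSL\<^esub> n = psl (matpow M n)"
  by (induction n) (simp_all add: psl_one psl_mult det_matpow group.is_monoid[OF group_PSL])

text \<open>Reduction of \<open>x\<^sup>n\<close> modulo the characteristic polynomial and Cayley--Hamilton reduction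
  of \<open>M\<^sup>n\<close> run in parallel.  This transfers statements about powers of \<open>M\<close> to the ring
  of polynomials.\<close>

lemma matpow_remainder:
  fixes M :: "'k::field ^ 2 ^ 2"
  assumes "det M = 1"
  shows "\<exists>q a b. [:0, 1:] ^ n = [:1, - trace M, 1:] * q + [:b, a:] \<and> matpow M n = mat a ** M + mat b"
proof (induction n)
  case 0
  have "[:0, 1:] ^ 0 = [:1, - trace M, 1:] * 0 + [:1, 0:]" by (simp add: one_pCons)
  moreover have "matpow M 0 = mat 0 ** M + mat 1"
    by (rule mat22_cases[of M]) (simp add: mat22_simps)
  ultimately show ?case by blast
next
  case (Suc n)
  then obtain q a b where IH: "[:0, 1:] ^ n = [:1, - trace M, 1:] * q + [:b, a:]"
      "matpow M n = mat a ** M + mat b" by blast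
  obtain w x y z where M: "M = mat22 w x y z" by (rule mat22_cases)
  have d: "w * z = 1 + x * y" using assms by (simp add: M mat22_simps algebra_simps)
  have "[:0, 1:] ^ Suc n = [:1, - trace M, 1:] * (q * [:0, 1:] + [:a:]) + [:- a, a * trace M + b:]"
    unfolding power_Suc2 IH(1) by (simp add: algebra_simps)
  moreover have "matpow M (Suc n) = mat (a * trace M + b) ** M + mat (- a)"
    unfolding matpow.simps IH(2) by (simp add: M mat22_simps algebra_simps d)
  ultimately show ?case by blast
qed

text \<open>The characteristic polynomial of \<open>M\<close> divides \<open>x\<^sup>n - c\<close>, which in
  characteristic \<open>n\<close> equals \<open>(x - c)\<^sup>n\<close>.  So \<open>c = \<plusminus>1\<close> is an
  eigenvalue, and since the determinant is \<open>1\<close> it is a double one.\<close>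

lemma trace_of_char_power_scalar:
  fixes M :: "'k::field ^ 2 ^ 2" and c :: 'k
  assumes "det M = 1" "\<And>d. M \<noteq> mat d" "matpow M n = mat c" "Factorial_Ring.prime n" "odd n" "n = CHAR('k)" "c ^ 2 = 1"
  shows "trace M = 2 * c"
proof -
  obtain q a b where qab: "[:0, 1:] ^ n = [:1, - trace M, 1:] * q + [:b, a:]"
      "matpow M n = mat a ** M + mat b" using matpow_remainder[OF assms(1)] by blast
  have a: "a = 0"
  proof (rule ccontr)
    assume "a \<noteq> 0"
    then have "M = mat ((c - b) / a)"
      using qab(2) assms(3) by (rule_tac mat22_cases[of M]) (simp add: mat22_simps field_simps)
    then show False using assms(2) by blast
  qed
  then have b: "b = c"
    using qab(2) assms(3) by (rule_tac mat22_cases[of M]) (simp add: mat22_simps)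
  have cc: "c = 1 \<or> c = - 1" using assms(7) by (simp add: power2_eq_1_iff)
  let ?h = "[:1, - trace M, 1:]"
  have C: "CHAR('k poly) = n"
    using assms(6) by simp
  have "[:- c, 1:] ^ n = ([:0, 1:] + [:- c:]) ^ n" by simp
  also have "\<dots> = [:0, 1:] ^ n + [:- c:] ^ n"
    by (rule freshmans_dream) (use assms(4) C in auto)
  also have "[:- c:] ^ n = [:- c:]" using cc assms(5) by (auto simp: poly_const_pow)
  also have "[:0, 1:] ^ n + [:- c:] = ?h * q" by (simp add: qab(1) a b)
  finally have e: "?h * q = [:- c, 1:] ^ n" by simp
  then have q0: "?h * q \<noteq> 0" by simp
  then have "Polynomial.degree (?h * q) = 2 + Polynomial.degree q" by (subst degree_mult_eq) auto
  moreover have "Polynomial.degree ([:- c, 1:] ^ n) = n" by (simp add: degree_power_eq)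
  ultimately have "Polynomial.degree q + 2 = n" using e by simp
  moreover have "Polynomial.order c ?h + Polynomial.order c q = n"
    using order_mult[OF q0, of c] order_power_n_n[of c n] unfolding e by simp
  \<comment> \<open>The cofactor \<open>q\<close> has degree \<open>n - 2\<close> and cannot absorb all
    \<open>n\<close> factors \<open>x - c\<close>.\<close>
  moreover have "Polynomial.order c q \<le> Polynomial.degree q" using q0 by (intro order_degree) auto
  ultimately have "Polynomial.order c ?h \<noteq> 0" by linarith
  then have "poly ?h c = 0" using order_root by blast
  then have "trace M * c = c ^ 2 + 1" by (simp add: algebra_simps power2_eq_square)
  then have "trace M * c = 2" using assms(7) by simp
  then have "trace M * c ^ 2 = 2 * c" by (simp add: power2_eq_square flip: mult.assoc)
  then show ?thesis using assms(7) by simp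
qed

abbreviation upper :: "'k \<Rightarrow> 'k::field ^ 2 ^ 2" where
  "upper t \<equiv> mat22 1 t 0 1"

lemma unipotent_conj_upper:
  fixes N :: "'k::field ^ 2 ^ 2"
  assumes "det N = 1" "trace N = 2" "N \<noteq> mat 1"
  shows "\<exists>P t. det P = 1 \<and> t \<noteq> 0 \<and> N ** P = P ** upper t"
proof -
  obtain a b c d where N: "N = mat22 a b c d" by (rule mat22_cases)
  have d: "d = 2 - a" using assms(2) by (simp add: N mat22_simps algebra_simps)
  have bc: "b * c = - ((a - 1) * (a - 1))" using assms(1) by (simp add: N d mat22_simps algebra_simps)
  show ?thesis
  proof (cases "c = 0")
    case True
    then have "a = 1" using bc by simp
    then show ?thesis using assms(3) True
      by (intro exI[of _ "mat 1"] exI[of _ b]) (simp add: N d mat22_simps)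
  next
    case False
    then have b: "b = - ((a - 1) * (a - 1)) / c" using bc by (simp add: field_simps)
    \<comment> \<open>The first column is the fixed vector of \<open>N\<close>; the second one makes the determinant
      \<open>1\<close>.\<close>
    show ?thesis using False
      by (intro exI[of _ "mat22 (a - 1) (- 1 / c) c 0"] exI[of _ "- 1 / c"])
        (simp add: N d b mat22_simps field_simps)
  qed
qed

text \<open>In \<open>PSL\<close> the relation between the three matrices holds only up to sign; the negative sign
  would force the first column of \<open>M\<close> to vanish.\<close>

lemma upper_normalizer:
  fixes M :: "'k::field ^ 2 ^ 2"
  assumes "(2 :: 'k) \<noteq> 0" "det M \<noteq> 0" "s \<noteq> 0"
    and "M ** upper s = upper t ** M \<or> M ** upper s = - (upper t ** M)"
  shows "M $ 2 $ 1 = 0 \<and> M $ 1 $ 1 * s = t * M $ 2 $ 2"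
proof -
  have two: "x = - x \<longleftrightarrow> x = 0" for x :: 'k
    using assms(1) by (metis add.inverse_neutral add_eq_0_iff mult_2 mult_eq_0_iff)
  obtain p q r d where M: "M = mat22 p q r d" by (rule mat22_cases)
  from assms(4) show ?thesis
  proof
    assume "M ** upper s = upper t ** M"
    then show ?thesis using assms(3) by (simp add: M mat22_simps)
  next
    assume "M ** upper s = - (upper t ** M)"
    then have "r = - r" "p = - (p + t * r)" by (simp_all add: M mat22_simps)
    then have "r = 0" "p = 0" by (simp_all add: two)
    then show ?thesis using assms(2) by (simp add: M mat22_simps)
  qed
qed


lemma psl_upper_inject:
  assumes "(2 :: 'k::field) \<noteq> 0" "psl (upper a) = psl (upper (b :: 'k))"
  shows "a = b"
proof -
  have "(1 :: 'k) \<noteq> - 1" using assms(1) by (metis add.right_inverse one_add_one)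
  then show ?thesis using assms(2) by (auto simp: psl_eq_iff mat22_simps)
qed

text \<open>Away from characteristic two every element is a difference of two squares.\<close>

lemma square_mult_additive_imp_mult:
  fixes F :: "'k::field \<Rightarrow> 'k"
  assumes "(2 :: 'k) \<noteq> 0" "\<And>a b. F (a + b) = F a + F b" "\<And>r s. F (r ^ 2 * s) = F (r ^ 2) * F s"
  shows "F (x * y) = F x * F y"
proof -
  have diff: "F (a - b) = F a - F b" for a b using assms(2)[of "a - b" b] by simp
  define u v where "u = (x + 1) / 2" and "v = (x - 1) / 2"
  have x: "x = u ^ 2 - v ^ 2"
  proof -
    have "u ^ 2 - v ^ 2 = (u + v) * (u - v)" by (simp add: algebra_simps power2_eq_square)
    also have "u + v = (2 * x) / 2" by (simp add: u_def v_def flip: add_divide_distrib)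
    also have "u - v = 2 / 2" by (simp add: u_def v_def flip: diff_divide_distrib)
    finally show ?thesis using assms(1) by simp
  qed
  show ?thesis
    unfolding x by (simp add: diff assms(3) left_diff_distrib)
qed

text \<open>The automorphism permutes the upper unipotents, acting on the parameter by an additive map
  \<open>f\<close>.  Diagonal matrices multiply the parameter by arbitrary squares, and their images can again only
  multiply it by a constant; hence \<open>F = f / f 1\<close> is multiplicative on squares, and so a field
  automorphism.  The square of the automorphism takes the parameter \<open>1\<close> to \<open>f (f 1) = e
  F(e)\<close> with \<open>e = f 1\<close>.  For conjugation by \<open>g\<close> this number is the ratio of the
  diagonal entries of \<open>g\<close>.\<close>

lemma auto_fixing_unipotents_square:
  fixes g :: "'k::{field,finite} ^ 2 ^ 2"
  assumes two: "(2 :: 'k) \<noteq> 0" and \<beta>: "\<beta> \<in> auto PSL" and g: "det g \<noteq> 0"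
    and sq: "\<And>W. W \<in> carrier PSL \<Longrightarrow> \<beta> (\<beta> W) = psl_conj g W"
    and t: "\<beta> (psl (upper 1)) = psl (upper t)" "t \<noteq> 0"
  shows "\<exists>s. det g = s ^ 2"
proof -
  interpret G: group "PSL :: ('k ^ 2 ^ 2) set monoid" by (rule group_PSL)
  have U: "det (upper s) = 1" for s :: 'k by (simp add: mat22_simps)
  have hom: "\<beta> (psl A) \<otimes>\<^bsub>PSL\<^esub> \<beta> (psl B) = \<beta> (psl (A ** B))" if "det A = 1" "det B = 1" for A B
    using hom_mult[OF G.autoD(1)[OF \<beta>], of "psl A" "psl B"] that
    by (simp add: psl_mult)
  have inj: "A = B \<or> A = - B" if "\<beta> (psl A) = \<beta> (psl B)" "det A = 1" "det B = 1" for A B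
    using inj_onD[OF G.autoD(4)[OF \<beta>] that(1)] that(2,3) by (simp add: psl_eq_iff)
  have lift: "\<exists>B. det B = 1 \<and> \<beta> (psl A) = psl B" if "det A = 1" for A
    using G.autoD(3)[OF \<beta>, of "psl A"] that by (metis psl_closed psl_cases)
  \<comment> \<open>An element commuting with one nontrivial upper unipotent is itself upper unipotent.\<close>
  have "\<exists>s'. \<beta> (psl (upper s)) = psl (upper s')" for s
  proof -
    obtain B where B: "det B = 1" "\<beta> (psl (upper s)) = psl B" using lift[OF U] by blast
    have "psl B \<otimes>\<^bsub>PSL\<^esub> psl (upper t) = psl (upper t) \<otimes>\<^bsub>PSL\<^esub> psl B"
      using hom[OF U[of s] U[of 1]] hom[OF U[of 1] U[of s]] B(2) t(1)
      by (simp add: mat22_simps add.commute)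
    then have "B ** upper t = upper t ** B \<or> B ** upper t = - (upper t ** B)"
      using B(1) U by (simp add: psl_mult psl_eq_iff)
    then have 1: "B $ 2 $ 1 = 0" "B $ 1 $ 1 = B $ 2 $ 2"
      using upper_normalizer[OF two _ t(2), of B t] B(1) t(2) by auto
    obtain p q where Bpq: "B = mat22 p q 0 p"
      using 1 by (rule_tac mat22_cases[of B]) auto
    then have "p = 1 \<or> p = - 1"
      using B(1) by (simp add: mat22_simps power2_eq_1_iff flip: power2_eq_square)
    then have "psl B = psl (upper (q / p))" by (auto simp: Bpq psl_eq_iff mat22_simps)
    then show ?thesis using B(2) by metis
  qed
  then obtain f where f: "\<And>s. \<beta> (psl (upper s)) = psl (upper (f s))" by metis
  have f1: "f 1 = t" using psl_upper_inject[OF two] f[of 1] t(1) by simp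
  have add: "f (a + b) = f a + f b" for a b
  proof -
    have "psl (upper (f (a + b))) = psl (upper (f a + f b))"
      using hom[OF U[of a] U[of b]] U by (simp add: f psl_mult mat22_simps add.commute)
    then show ?thesis by (rule psl_upper_inject[OF two])
  qed
  have "f 0 = f 0 + f 0" using add[of 0 0] by (simp only: add_0_left)
  then have f0: "f 0 = 0" by (simp only: add_cancel_right_right)
  have finj: "a = b" if "f a = f b" for a b
  proof -
    have "\<beta> (psl (upper a)) = \<beta> (psl (upper b))" by (simp add: f that)
    from inj[OF this U U] have "psl (upper a) = psl (upper b)" by (simp add: psl_eq_iff)
    then show ?thesis by (rule psl_upper_inject[OF two])
  qed
  \<comment> \<open>Conjugation by \<open>diag(r, 1/r)\<close> multiplies the parameter by \<open>r\<^sup>2\<close>,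
    and its image \<open>B\<close> multiplies it by the square of the first diagonal entry of
    \<open>B\<close>.\<close>
  have scale: "f (r ^ 2 * s) * f 1 = f (r ^ 2) * f s" for r s
  proof (cases "r = 0")
    case False
    let ?D = "mat22 r 0 0 (inverse r)"
    have D: "det ?D = 1" using False by (simp add: mat22_simps)
    obtain B where B: "det B = 1" "\<beta> (psl ?D) = psl B" using lift[OF D] by blast
    have *: "B $ 2 $ 1 = 0 \<and> B $ 1 $ 1 * f u = f (r ^ 2 * u) * B $ 2 $ 2" if "u \<noteq> 0" for u
    proof -
      have "?D ** upper u = upper (r ^ 2 * u) ** ?D"
        using False by (simp add: mat22_simps power2_eq_square)
      then have "\<beta> (psl ?D) \<otimes>\<^bsub>PSL\<^esub> \<beta> (psl (upper u)) = \<beta> (psl (upper (r ^ 2 * u))) \<otimes>\<^bsub>PSL\<^esub> \<beta> (psl ?D)"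
        using hom[OF D U[of u]] hom[OF U[of "r ^ 2 * u"] D] by simp
      then have "B ** upper (f u) = upper (f (r ^ 2 * u)) ** B \<or> B ** upper (f u) = - (upper (f (r ^ 2 * u)) ** B)"
        using B U by (simp add: f psl_mult psl_eq_iff)
      moreover have "f u \<noteq> 0" using finj[of u 0] f0 that by auto
      ultimately show ?thesis using upper_normalizer[OF two, of B "f u"] B(1) by auto
    qed
    have B1: "B $ 1 $ 1 * B $ 2 $ 2 = 1" using B(1) *[of 1] by (simp add: det_2)
    have **: "f (r ^ 2 * u) = (B $ 1 $ 1) ^ 2 * f u" for u
    proof (cases "u = 0")
      case False
      have "f (r ^ 2 * u) = f (r ^ 2 * u) * (B $ 1 $ 1 * B $ 2 $ 2)" by (simp only: B1 mult_1_right)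
      also have "\<dots> = B $ 1 $ 1 * (f (r ^ 2 * u) * B $ 2 $ 2)" by (simp only: mult_ac)
      also have "f (r ^ 2 * u) * B $ 2 $ 2 = B $ 1 $ 1 * f u" using *[OF False] by simp
      finally show ?thesis by (simp only: power2_eq_square mult.assoc)
    qed (simp add: f0)
    show ?thesis using **[of s] **[of 1] by simp
  qed (simp add: f0)
  define F where "F = (\<lambda>x. f x / f 1)"
  have F: "F (a + b) = F a + F b" "F (r ^ 2 * s) = F (r ^ 2) * F s" for a b r s
    using scale[of r s] t(2) by (simp_all add: F_def add add_divide_distrib f1 frac_eq_eq mult_ac)
  note Fm = square_mult_additive_imp_mult[of F, OF two F]
  have "inj F" using finj t(2) by (auto simp: inj_def F_def f1)
  then have "surj F" by (simp add: finite_UNIV_inj_surj)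
  have e: "f (f 1) = f 1 * F (f 1)" using t(2) by (simp add: F_def f1)
  \<comment> \<open>If \<open>f 1\<close> is not a square, neither is its image under the field automorphism
    \<open>F\<close>, and their product is a square.\<close>
  have "\<exists>s. f 1 * F (f 1) = s ^ 2"
  proof (cases "\<exists>r. f 1 = r ^ 2")
    case True
    then obtain r where r: "f 1 = r ^ 2" by blast
    show ?thesis unfolding r
      by (rule exI[of _ "r * F r"]) (simp add: power2_eq_square Fm mult_ac)
  next
    case False
    have "F (f 1) \<noteq> s ^ 2" for s
    proof
      assume a: "F (f 1) = s ^ 2"
      obtain s' where "s = F s'" using \<open>surj F\<close> by (metis surjD)
      then have "F (f 1) = F (s' ^ 2)" using a by (simp add: power2_eq_square Fm)
      then show False using \<open>inj F\<close> False by (auto dest: injD)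
    qed
    then show ?thesis using False nonsquare_mult_nonsquare by blast
  qed
  then obtain s where s: "f (f 1) = s ^ 2" using e by metis
  have "psl (g ** upper 1 ** matrix_inv g) = psl (upper (f (f 1)))"
    using sq[of "psl (upper 1)"] psl_closed[OF U, of 1] psl_conj_psl[OF U, of g 1] by (simp add: f)
  then have "g ** upper 1 ** matrix_inv g = upper (f (f 1)) \<or> g ** upper 1 ** matrix_inv g = - upper (f (f 1))"
    by (simp add: psl_eq_iff)
  moreover have "(g ** upper 1 ** matrix_inv g) ** g = g ** upper 1"
    by (simp add: matrix_inv_mult g flip: matrix_mul_assoc)
  ultimately have "g ** upper 1 = upper (f (f 1)) ** g \<or> g ** upper 1 = - (upper (f (f 1)) ** g)"
    by (elim disjE) (simp_all only: uminus_matrix_mult(1) simp_thms)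
  then have "g $ 2 $ 1 = 0 \<and> g $ 1 $ 1 = f (f 1) * g $ 2 $ 2"
    using upper_normalizer[OF two g, of 1 "f (f 1)"] by simp
  then have "det g = (s * g $ 2 $ 2) ^ 2" by (simp add: det_2 s power2_eq_square mult_ac)
  then show ?thesis by blast
qed


lemma matpow_upper: "matpow (upper t) n = upper (of_nat n * t)"
  by (induction n) (simp_all add: mat22_simps(1,5) distrib_right add.commute)

lemma CHAR_finite_field_odd:
  assumes "(2 :: 'k::{field,finite}) \<noteq> 0"
  shows "Factorial_Ring.prime CHAR('k)" "odd CHAR('k)"
proof -
  show p: "Factorial_Ring.prime CHAR('k)"
    by (rule prime_CHAR_semidom) (rule finite_imp_CHAR_pos, simp)
  have "CHAR('k) \<noteq> 2"
  proof
    assume "CHAR('k) = 2"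
    then have "(of_nat 2 :: 'k) = 0" by (metis of_nat_CHAR)
    then show False using assms by (simp only: of_nat_numeral)
  qed
  then have "CHAR('k) > 2" using prime_ge_2_nat[OF p] by linarith
  then show "odd CHAR('k)" by (rule prime_odd_nat[OF p])
qed

text \<open>The image of a transvection has order the characteristic \<open>p\<close>.  A matrix whose
  \<open>p\<close>-th power is \<open>\<plusminus>1\<close> is unipotent up to sign, so it is conjugate in
  \<open>SL\<close> to an upper unipotent matrix.\<close>

lemma auto_image_unipotent:
  fixes \<beta> :: "('k::{field,finite} ^ 2 ^ 2) set \<Rightarrow> _"
  assumes two: "(2 :: 'k) \<noteq> 0" and \<beta>: "\<beta> \<in> auto PSL"
  shows "\<exists>P t. det P = 1 \<and> t \<noteq> 0 \<and> psl_conj (matrix_inv P) (\<beta> (psl (upper 1))) = psl (upper t)"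
proof -
  interpret G: group "PSL :: ('k ^ 2 ^ 2) set monoid" by (rule group_PSL)
  interpret b: group_hom "PSL :: ('k ^ 2 ^ 2) set monoid" "PSL :: ('k ^ 2 ^ 2) set monoid" \<beta>
    using G.autoD(1)[OF \<beta>] by (simp add: group_hom_def group_hom_axioms_def G.is_group)
  let ?n = "CHAR('k)"
  have U: "det (upper s) = 1" for s :: 'k by (simp add: mat22_simps)
  obtain M where M: "det M = 1" "\<beta> (psl (upper 1)) = psl M"
    using b.hom_closed[OF psl_closed[OF U]] by (metis psl_cases)
  have "psl (matpow M ?n) = \<beta> (psl (upper 1)) [^]\<^bsub>PSL\<^esub> ?n" using M by (simp add: psl_pow)
  also have "\<dots> = \<beta> (psl (upper 1) [^]\<^bsub>PSL\<^esub> ?n)"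
    using b.hom_nat_pow[OF psl_closed[OF U]] by simp
  also have "psl (upper 1) [^]\<^bsub>PSL\<^esub> ?n = psl (mat 1 :: 'k ^ 2 ^ 2)"
    using psl_pow[OF U, of 1 ?n] by (simp add: matpow_upper mat22_simps(5))
  finally have "psl (matpow M ?n) = psl (mat 1)" by (simp add: psl_one)
  then have "matpow M ?n = mat 1 \<or> matpow M ?n = mat (- 1)" by (simp add: psl_eq_iff mat22_simps)
  then obtain c :: 'k where c: "matpow M ?n = mat c" "c ^ 2 = 1" by (metis one_power2 power2_minus)
  have nonscalar: "M \<noteq> mat d" for d
  proof
    assume "M = mat d"
    then have "M = mat 1 \<or> M = - mat 1"
      using M(1) by (simp add: mat22_simps power2_eq_1_iff flip: power2_eq_square)
    then have "psl M = psl (mat 1)" by (simp add: psl_eq_iff)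
    then have "\<beta> (psl (upper 1)) = \<beta> (psl (mat 1))" using M(2) by (simp add: psl_one)
    then have "psl (upper 1) = psl (mat 1 :: 'k ^ 2 ^ 2)"
      using inj_onD[OF G.autoD(4)[OF \<beta>]] U by (simp add: det_I)
    then show False by (simp add: psl_eq_iff mat22_simps)
  qed
  have tr: "trace M = 2 * c"
    by (rule trace_of_char_power_scalar[OF M(1) nonscalar c(1)])
      (use CHAR_finite_field_odd[OF two] c(2) in auto)
  have c1: "c = 1 \<or> c = - 1" using c(2) by (simp add: power2_eq_1_iff)
  \<comment> \<open>The sign is chosen to make both eigenvalues equal to \<open>1\<close>.\<close>
  define N where "N = (if c = 1 then M else - M)"
  have N: "psl N = psl M" "det N = 1" "N \<noteq> mat 1" "trace N = 2"
  proof -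
    show "psl N = psl M" "det N = 1" using M(1) by (simp_all add: N_def psl_eq_iff det_uminus22)
    show "trace N = 2" using c1 tr by (auto simp: N_def trace_uminus)
    have "- (- M) \<noteq> - mat 1" using nonscalar[of "- 1"] by (simp add: mat22_simps)
    then have "- M \<noteq> mat 1" by metis
    then show "N \<noteq> mat 1" using nonscalar[of 1] by (simp add: N_def)
  qed
  then obtain P t where P: "det P = 1" "t \<noteq> 0" "N ** P = P ** upper t"
    using unipotent_conj_upper by blast
  have "matrix_inv P ** N = upper t ** matrix_inv P"
  proof -
    have "matrix_inv P ** N ** P = upper t"
      using P by (simp add: matrix_inv_mult flip: matrix_mul_assoc) (simp add: matrix_inv_mult matrix_mul_assoc)
    then have "matrix_inv P ** N ** (P ** matrix_inv P) = upper t ** matrix_inv P"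
      by (simp add: matrix_mul_assoc)
    then show ?thesis using P(1) by (simp add: matrix_inv_mult)
  qed
  then have "psl_conj (matrix_inv P) (psl N) = psl (upper t)"
    using N P by (intro psl_conj_eqI) (simp_all add: det_matrix_inv)
  then show ?thesis using P N(1) M(2) by metis
qed

text \<open>Composing \<open>\<beta>\<close> with an inner automorphism changes \<open>g\<close> by a factor in
  \<open>SL\<close>, so the image of the transvection can be assumed to be upper unipotent.\<close>

theorem auto_squared_psl_conj_imp_square:
  fixes g :: "'k::{field,finite} ^ 2 ^ 2"
  assumes two: "(2 :: 'k) \<noteq> 0" and \<beta>: "\<beta> \<in> auto PSL" and g: "det g \<noteq> 0"
    and sq: "\<And>W. W \<in> carrier PSL \<Longrightarrow> \<beta> (\<beta> W) = psl_conj g W"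
  shows "\<exists>s. det g = s ^ 2"
proof -
  interpret G: group "PSL :: ('k ^ 2 ^ 2) set monoid" by (rule group_PSL)
  interpret A: group "AutoGroup (PSL :: ('k ^ 2 ^ 2) set monoid)" by (rule G.AutoGroup)
  obtain P t where P: "det P = 1" "t \<noteq> 0" "psl_conj (matrix_inv P) (\<beta> (psl (upper 1))) = psl (upper t)"
    using auto_image_unipotent[OF two \<beta>] by blast
  let ?P = "matrix_inv P"
  have dP: "det ?P = 1" using P(1) by (simp add: det_matrix_inv)
  define \<gamma> where "\<gamma> = compose (carrier PSL) (psl_conj ?P) \<beta>"
  have \<gamma>W: "\<gamma> W = psl_conj ?P (\<beta> W)" if "W \<in> carrier PSL" for W
    using that by (simp add: \<gamma>_def compose_eq)
  have P_auto: "psl_conj ?P \<in> auto PSL" by (rule psl_conj_auto) (simp add: dP)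
  have "\<gamma> \<in> auto PSL"
    using A.m_closed[of "psl_conj ?P" \<beta>] P_auto \<beta> by (simp add: G.AutoGroup_simps \<gamma>_def)
  obtain h where h: "h \<in> carrier PSL" "\<And>W. W \<in> carrier PSL \<Longrightarrow> psl_conj ?P W = conj_by PSL W h"
  proof
    show "psl (matrix_inv ?P) \<in> carrier PSL" by (rule psl_closed) (simp add: det_matrix_inv dP)
  qed (rule psl_conj_inner[OF dP])
  obtain Q where Q: "det Q = 1" "\<beta> h = psl Q" using G.autoD(3)[OF \<beta> h(1)] by (rule psl_cases)
  let ?Q = "matrix_inv Q"
  have dQ: "det ?Q = 1" using Q(1) by (simp add: det_matrix_inv)
  have cl: "psl_conj g W \<in> carrier PSL" if "W \<in> carrier PSL" for W
    by (rule psl_conj_closed[OF g that])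
  have "\<gamma> (\<gamma> W) = psl_conj (?P ** ?Q ** g) W" if W: "W \<in> carrier PSL" for W
  proof -
    have bW: "\<beta> W \<in> carrier PSL" by (rule G.autoD(3)[OF \<beta> W])
    have "\<beta> (psl_conj ?P (\<beta> W)) = conj_by PSL (psl_conj g W) (psl Q)"
      using h bW by (simp add: G.auto_conj_by[OF \<beta>] Q(2) sq[OF W])
    also have "\<dots> = psl_conj ?Q (psl_conj g W)" by (rule conj_by_psl[OF Q(1) cl[OF W]])
    finally have "\<gamma> (\<gamma> W) = psl_conj ?P (psl_conj ?Q (psl_conj g W))"
      using W bW dP by (simp add: \<gamma>W psl_conj_closed)
    also have "\<dots> = psl_conj ?P (psl_conj (?Q ** g) W)"
      by (subst psl_conj_mult) (simp_all add: W g dQ)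
    also have "\<dots> = psl_conj (?P ** (?Q ** g)) W"
      by (subst psl_conj_mult) (simp_all add: W g dQ dP det_mul)
    finally show ?thesis by (simp only: matrix_mul_assoc)
  qed
  moreover have "\<gamma> (psl (upper 1)) = psl (upper t)"
    using P(3) by (simp add: \<gamma>W mat22_simps)
  moreover have d: "det (?P ** ?Q ** g) = det g" by (simp add: det_mul dP dQ)
  ultimately have "\<exists>s. det (?P ** ?Q ** g) = s ^ 2"
    using g P(2) by (intro auto_fixing_unipotents_square[OF two \<open>\<gamma> \<in> auto PSL\<close>, of _ t]) simp_all
  then show ?thesis by (simp only: d)
qed

section \<open>Recognising powers of \<open>C\<^sub>2\<close> and dihedral groups\<close>

lemma group_power_Suc_iso: "(G \<times>\<times> group_power G n) \<cong> group_power G (Suc n)"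
proof (rule is_isoI, rule isoI)
  let ?f = "\<lambda>x. (snd x)(n := fst x)"
  have cl: "?f x \<in> carrier (group_power G (Suc n))" if "x \<in> carrier (G \<times>\<times> group_power G n)" for x
  proof -
    have "fst x \<in> carrier G" "snd x \<in> (\<Pi>\<^sub>E i\<in>{..<n}. carrier G)"
      using that unfolding carrier_DirProd carrier_product_group mem_Times_iff by blast+
    then show ?thesis using PiE_fun_upd[of "fst x" "\<lambda>_. carrier G" n "snd x" "{..<n}"]
      by (simp only: carrier_product_group lessThan_Suc)
  qed
  show "?f \<in> hom (G \<times>\<times> group_power G n) (group_power G (Suc n))"
  proof (rule homI)
    fix x assume "x \<in> carrier (G \<times>\<times> group_power G n)"
    then show "?f x \<in> carrier (group_power G (Suc n))" by (rule cl)
  next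
    fix x y
    show "?f (x \<otimes>\<^bsub>G \<times>\<times> group_power G n\<^esub> y) = ?f x \<otimes>\<^bsub>group_power G (Suc n)\<^esub> ?f y"
    proof
      fix i show "?f (x \<otimes>\<^bsub>G \<times>\<times> group_power G n\<^esub> y) i = (?f x \<otimes>\<^bsub>group_power G (Suc n)\<^esub> ?f y) i"
        by (simp add: mult_DirProd' restrict_def)
    qed
  qed
  show "bij_betw ?f (carrier (G \<times>\<times> group_power G n)) (carrier (group_power G (Suc n)))"
  proof (rule bij_betw_byWitness[where f' = "\<lambda>u. (u n, restrict u {..<n})"])
    show "\<forall>x\<in>carrier (G \<times>\<times> group_power G n). (?f x n, restrict (?f x) {..<n}) = x"
    proof
      fix x assume "x \<in> carrier (G \<times>\<times> group_power G n)"
      then have "snd x \<in> extensional {..<n}"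
        unfolding carrier_DirProd carrier_product_group mem_Times_iff PiE_def by blast
      then have "restrict (?f x) {..<n} = snd x"
        by (intro extensionalityI[of _ "{..<n}"]) auto
      then show "(?f x n, restrict (?f x) {..<n}) = x" by simp
    qed
    show "\<forall>u\<in>carrier (group_power G (Suc n)). ?f (u n, restrict u {..<n}) = u"
    proof
      fix u assume "u \<in> carrier (group_power G (Suc n))"
      then have "u \<in> extensional {..<Suc n}" unfolding carrier_product_group PiE_def by blast
      then show "?f (u n, restrict u {..<n}) = u"
        by (intro extensionalityI[of _ "{..<Suc n}"]) (auto simp: extensional_def)
    qed
    show "?f ` carrier (G \<times>\<times> group_power G n) \<subseteq> carrier (group_power G (Suc n))"
      using cl by blast
    show "(\<lambda>u. (u n, restrict u {..<n})) ` carrier (group_power G (Suc n)) \<subseteq>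
        carrier (G \<times>\<times> group_power G n)"
      by (simp add: image_subset_iff PiE_iff)
  qed
qed

lemma DirProd_group_power_0_iso: "K \<cong> G \<Longrightarrow> K \<cong> (G \<times>\<times> group_power H 0)"
proof -
  assume "K \<cong> G"
  also have "G \<cong> (G \<times>\<times> group_power H 0)"
  proof (rule is_isoI, rule isoI)
    let ?f = "\<lambda>x. (x, \<lambda>_. undefined)"
    show "?f \<in> hom G (G \<times>\<times> group_power H 0)" by (auto simp: hom_def)
    show "bij_betw ?f (carrier G) (carrier (G \<times>\<times> group_power H 0))"
      by (rule bij_betw_byWitness[where f' = fst]) auto
  qed
  finally show ?thesis .
qed

text \<open>In a group of exponent two, which is abelian, an embedded group and an element outside it generate a
  direct product.\<close>

lemma extend_iso_image_exponent_two:
  assumes K: "group K" and two: "\<And>x. x \<in> carrier K \<Longrightarrow> x \<otimes>\<^bsub>K\<^esub> x = \<one>\<^bsub>K\<^esub>"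
    and G: "group G" and f: "f \<in> hom G K" "inj_on f (carrier G)"
    and a: "a \<in> carrier K" "a \<notin> f ` carrier G"
  shows "\<exists>h. h \<in> hom (C2 \<times>\<times> G) K \<and> inj_on h (carrier (C2 \<times>\<times> G))"
proof -
  interpret K: group K by (rule K)
  interpret G: group G by (rule G)
  interpret f: group_hom G K f using f(1) by (simp add: group_hom_def group_hom_axioms_def K G)
  have inv: "inv\<^bsub>K\<^esub> x = x" if "x \<in> carrier K" for x
    using two[OF that] that by (intro K.inv_equality)
  have comm: "x \<otimes>\<^bsub>K\<^esub> y = y \<otimes>\<^bsub>K\<^esub> x" if "x \<in> carrier K" "y \<in> carrier K" for x y
    using K.inv_mult_group[OF that] inv that by simp
  interpret K: comm_group K by (rule K.group_comm_groupI) (rule comm)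
  define p where "p = (\<lambda>c :: int. if c = 0 then \<one>\<^bsub>K\<^esub> else a)"
  define h where "h = (\<lambda>(c, v). p c \<otimes>\<^bsub>K\<^esub> f v)"
  have C2: "carrier C2 = {0, 1}" by (auto simp: carrier_integer_mod_group)
  have p: "p c \<in> carrier K" for c using a by (simp add: p_def)
  have pm: "p ((c + d) mod 2) = p c \<otimes>\<^bsub>K\<^esub> p d" if "c \<in> {0, 1}" "d \<in> {0, 1}" for c d
    using that a two[OF a(1)] by (auto simp: p_def)
  have "h \<in> hom (C2 \<times>\<times> G) K"
  proof (rule homI)
    fix x y assume "x \<in> carrier (C2 \<times>\<times> G)" "y \<in> carrier (C2 \<times>\<times> G)"
    then show "h (x \<otimes>\<^bsub>C2 \<times>\<times> G\<^esub> y) = h x \<otimes>\<^bsub>K\<^esub> h y"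
      by (cases x; cases y) (simp add: h_def C2 pm p K.m_ac)
  qed (auto simp: h_def p)
  moreover have "inj_on h (carrier (C2 \<times>\<times> G))"
  proof (rule inj_onI)
    fix x y assume xy: "x \<in> carrier (C2 \<times>\<times> G)" "y \<in> carrier (C2 \<times>\<times> G)" "h x = h y"
    obtain c v d w where [simp]: "x = (c, v)" "y = (d, w)" by (cases x; cases y)
    have vw: "v \<in> carrier G" "w \<in> carrier G" "c \<in> {0, 1}" "d \<in> {0, 1}" using xy(1,2) by (auto simp: C2)
    have "a \<otimes>\<^bsub>K\<^esub> f u \<noteq> f u'" if "u \<in> carrier G" "u' \<in> carrier G" for u u'
    proof
      assume "a \<otimes>\<^bsub>K\<^esub> f u = f u'"
      then have "a = f u' \<otimes>\<^bsub>K\<^esub> inv\<^bsub>K\<^esub> f u" using that a(1) K.inv_solve_right by simp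
      then have "a = f (u' \<otimes>\<^bsub>G\<^esub> inv\<^bsub>G\<^esub> u)" using that by simp
      then show False using a(2) that by blast
    qed
    note ne = this this[symmetric]
    have e: "p c \<otimes>\<^bsub>K\<^esub> f v = p d \<otimes>\<^bsub>K\<^esub> f w" using xy(3) by (simp add: h_def)
    have "c = d" using e vw ne by (auto simp: p_def)
    then have "f v = f w" using e p vw by simp
    then show "x = y" using \<open>c = d\<close> inj_onD[OF f(2)] vw by simp
  qed
  ultimately show ?thesis by blast
qed

text \<open>A power of \<open>C\<^sub>2\<close> of the largest rank that embeds must be everything.\<close>

theorem exponent_two_iso_C2_power:
  assumes K: "group K" and fin: "finite (carrier K)"
    and two: "\<And>x. x \<in> carrier K \<Longrightarrow> x \<otimes>\<^bsub>K\<^esub> x = \<one>\<^bsub>K\<^esub>"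
  shows "\<exists>n. K \<cong> group_power C2 n"
proof -
  interpret K: group K by (rule K)
  define Q where "Q n \<longleftrightarrow> (\<exists>f. f \<in> hom (group_power C2 n) K \<and> inj_on f (carrier (group_power C2 n)))" for n
  have gp: "group (group_power C2 n)" for n by simp
  \<comment> \<open>The rank is bounded because \<open>2\<^sup>n\<close> cannot exceed the order of
    \<open>K\<close>.\<close>
  have "Q 0"
    unfolding Q_def by (intro exI[of _ "\<lambda>_. \<one>\<^bsub>K\<^esub>"]) (auto simp: hom_def)
  moreover have "n \<le> card (carrier K)" if "Q n" for n
  proof -
    obtain f where "f \<in> hom (group_power C2 n) K" "inj_on f (carrier (group_power C2 n))"
      using \<open>Q n\<close> by (auto simp: Q_def)
    then have "card (carrier (group_power C2 n)) \<le> card (carrier K)"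
      using fin by (intro card_inj_on_le[of f]) (auto simp: hom_def)
    moreover have "card (carrier (group_power C2 n)) = 2 ^ n"
      by (simp add: card_PiE carrier_integer_mod_group)
    ultimately show ?thesis using less_exp[of n] by linarith
  qed
  ultimately obtain n where n: "Q n" "\<And>m. Q m \<Longrightarrow> m \<le> n"
    using Nat.ex_has_greatest_nat[of Q 0 "card (carrier K)"] by blast
  obtain f where f: "f \<in> hom (group_power C2 n) K" "inj_on f (carrier (group_power C2 n))"
    using n(1) by (auto simp: Q_def)
  have "f ` carrier (group_power C2 n) = carrier K"
  proof (rule ccontr)
    assume "f ` carrier (group_power C2 n) \<noteq> carrier K"
    then obtain a where "a \<in> carrier K" "a \<notin> f ` carrier (group_power C2 n)"
      using f(1) by (auto simp: hom_def)
    then obtain h where h: "h \<in> hom (C2 \<times>\<times> group_power C2 n) K" "inj_on h (carrier (C2 \<times>\<times> group_power C2 n))"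
      using extend_iso_image_exponent_two[OF K two gp f] by blast
    obtain i where i: "i \<in> iso (group_power C2 (Suc n)) (C2 \<times>\<times> group_power C2 n)"
      using group.iso_sym[OF DirProd_group[OF group_integer_mod_group gp] group_power_Suc_iso]
      by (auto simp: is_iso_def)
    have "h \<circ> i \<in> hom (group_power C2 (Suc n)) K"
      using i h(1) by (auto intro: hom_compose simp: iso_def)
    moreover have "inj_on (h \<circ> i) (carrier (group_power C2 (Suc n)))"
      using i h(2) unfolding iso_def bij_betw_def by (intro comp_inj_on) auto
    ultimately have "Q (Suc n)" by (auto simp: Q_def)
    then show False using n(2) by fastforce
  qed
  then have "group_power C2 n \<cong> K" using f by (intro is_isoI isoI) (auto simp: bij_betw_def)
  then show ?thesis using group.iso_sym[OF gp] by blast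
qed

theorem dihedral_iso:
  assumes K: "group K" and n: "n > 0" and rs: "r \<in> carrier K" "s \<in> carrier K"
    and rel: "group.ord K r = n" "s \<otimes>\<^bsub>K\<^esub> s = \<one>\<^bsub>K\<^esub>" "s \<otimes>\<^bsub>K\<^esub> r \<otimes>\<^bsub>K\<^esub> s = inv\<^bsub>K\<^esub> r"
    and ns: "\<And>k :: int. r [^]\<^bsub>K\<^esub> k \<noteq> s"
    and gen: "\<And>x. x \<in> carrier K \<Longrightarrow> \<exists>k :: int. x = r [^]\<^bsub>K\<^esub> k \<or> x = r [^]\<^bsub>K\<^esub> k \<otimes>\<^bsub>K\<^esub> s"
  shows "K \<cong> dihedral n"
proof -
  interpret K: group K by (rule K)
  define f where "f = (\<lambda>(k :: int, b). r [^]\<^bsub>K\<^esub> k \<otimes>\<^bsub>K\<^esub> (if b then s else \<one>\<^bsub>K\<^esub>))"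
  have per: "r [^]\<^bsub>K\<^esub> (k mod int n) = r [^]\<^bsub>K\<^esub> k" for k :: int
    using K.int_pow_eq[OF rs(1), of k "k mod int n"] rel(1) by (simp add: mod_eq_dvd_iff[symmetric])
  have invs: "inv\<^bsub>K\<^esub> s = s" using rel(2) rs by (intro K.inv_equality)
  have flip: "s \<otimes>\<^bsub>K\<^esub> r [^]\<^bsub>K\<^esub> l \<otimes>\<^bsub>K\<^esub> s = r [^]\<^bsub>K\<^esub> (- l)" for l :: int
  proof -
    have "(\<lambda>x. s \<otimes>\<^bsub>K\<^esub> x \<otimes>\<^bsub>K\<^esub> s) \<in> hom K K"
    proof (rule homI)
      fix x y assume xy: "x \<in> carrier K" "y \<in> carrier K"
      have "s \<otimes>\<^bsub>K\<^esub> (s \<otimes>\<^bsub>K\<^esub> z) = z" if "z \<in> carrier K" for z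
        using that rs rel(2) by (simp flip: K.m_assoc)
      then show "s \<otimes>\<^bsub>K\<^esub> (x \<otimes>\<^bsub>K\<^esub> y) \<otimes>\<^bsub>K\<^esub> s = s \<otimes>\<^bsub>K\<^esub> x \<otimes>\<^bsub>K\<^esub> s \<otimes>\<^bsub>K\<^esub> (s \<otimes>\<^bsub>K\<^esub> y \<otimes>\<^bsub>K\<^esub> s)"
        using xy rs by (simp add: K.m_assoc)
    qed (use rs in auto)
    from hom_int_pow[OF this rs(1) K K, of l] show ?thesis
      using rs(1) by (simp add: rel(3) K.int_pow_inv K.int_pow_neg)
  qed
  have flip': "s \<otimes>\<^bsub>K\<^esub> r [^]\<^bsub>K\<^esub> l = r [^]\<^bsub>K\<^esub> (- l) \<otimes>\<^bsub>K\<^esub> s" for l :: int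
    using rs flip[of l] K.inv_solve_right[of "s \<otimes>\<^bsub>K\<^esub> r [^]\<^bsub>K\<^esub> l" "r [^]\<^bsub>K\<^esub> (- l)" s] invs
    by (metis K.int_pow_closed K.inv_solve_right K.m_closed)
  have "f \<in> hom (dihedral n) K"
  proof (rule homI)
    fix x y :: "int \<times> bool"
    obtain k b l c where [simp]: "x = (k, b)" "y = (l, c)" by (cases x; cases y)
    have "s \<otimes>\<^bsub>K\<^esub> (r [^]\<^bsub>K\<^esub> l \<otimes>\<^bsub>K\<^esub> z) = r [^]\<^bsub>K\<^esub> (- l) \<otimes>\<^bsub>K\<^esub> (s \<otimes>\<^bsub>K\<^esub> z)" if "z \<in> carrier K" for z
      using that rs flip'[of l] by (simp flip: K.m_assoc)
    then show "f (x \<otimes>\<^bsub>dihedral n\<^esub> y) = f x \<otimes>\<^bsub>K\<^esub> f y"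
      using rs rel(2) flip'[of l]
      by (cases b; cases c) (simp_all add: f_def dihedral_def per K.int_pow_mult K.m_assoc diff_conv_add_uminus del: add_uminus_conv_diff)
  qed (use rs in \<open>auto simp: f_def\<close>)
  moreover have "bij_betw f (carrier (dihedral n)) (carrier K)"
    unfolding bij_betw_def
  proof
    have inj: "k = l" if "r [^]\<^bsub>K\<^esub> k = r [^]\<^bsub>K\<^esub> l" "k \<in> {0..<int n}" "l \<in> {0..<int n}" for k l :: int
    proof -
      have "k mod int n = l mod int n" using that(1) K.int_pow_eq[OF rs(1), of k l] rel(1)
        by (simp add: mod_eq_dvd_iff dvd_diff_commute)
      then show ?thesis using that by simp
    qed
    have "r [^]\<^bsub>K\<^esub> k \<otimes>\<^bsub>K\<^esub> s \<noteq> r [^]\<^bsub>K\<^esub> l" for k l :: int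
    proof
      assume "r [^]\<^bsub>K\<^esub> k \<otimes>\<^bsub>K\<^esub> s = r [^]\<^bsub>K\<^esub> l"
      then have "s = inv\<^bsub>K\<^esub> (r [^]\<^bsub>K\<^esub> k) \<otimes>\<^bsub>K\<^esub> r [^]\<^bsub>K\<^esub> l"
        using rs by (metis K.cancel_inv(2) K.int_pow_closed)
      then have "s = r [^]\<^bsub>K\<^esub> (- k + l)"
        using K.int_pow_mult[OF rs(1), of "- k" l] K.int_pow_neg[OF rs(1), of k] by simp
      then show False using ns by metis
    qed
    note ne = this this[symmetric]
    show "inj_on f (carrier (dihedral n))"
    proof (rule inj_onI)
      fix x y assume xy: "x \<in> carrier (dihedral n)" "y \<in> carrier (dihedral n)" "f x = f y"
      obtain k b l c where [simp]: "x = (k, b)" "y = (l, c)" by (cases x; cases y)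
      show "x = y" using xy ne[of k l] ne[of l k] inj[of k l] rs
        by (cases b; cases c) (auto simp: f_def dihedral_def)
    qed
    show "f ` carrier (dihedral n) = carrier K"
    proof
      show "f ` carrier (dihedral n) \<subseteq> carrier K" using rs by (auto simp: f_def)
      show "carrier K \<subseteq> f ` carrier (dihedral n)"
      proof
        fix x assume "x \<in> carrier K"
        then obtain k :: int and b where "x = f (k, b)"
          using gen[of x] rs by (auto simp: f_def split: if_splits) (metis K.int_pow_closed K.r_one)+
        then have "x = f (k mod int n, b)" by (simp add: f_def per)
        then show "x \<in> f ` carrier (dihedral n)" using n by (auto simp: dihedral_def)
      qed
    qed
  qed
  ultimately have "dihedral n \<cong> K" by (intro is_isoI isoI)
  then show ?thesis by (rule group.iso_sym[OF group_dihedral[OF n]])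
qed

lemma DirProd_assoc_iso: "((G \<times>\<times> H) \<times>\<times> I) \<cong> (G \<times>\<times> (H \<times>\<times> I))"
proof (rule is_isoI, rule isoI)
  let ?f = "\<lambda>((x, y), z). (x, (y, z))"
  show "?f \<in> hom ((G \<times>\<times> H) \<times>\<times> I) (G \<times>\<times> (H \<times>\<times> I))"
    by (auto simp: hom_def mult_DirProd')
  show "bij_betw ?f (carrier ((G \<times>\<times> H) \<times>\<times> I)) (carrier (G \<times>\<times> (H \<times>\<times> I)))"
    by (rule bij_betw_byWitness[where f' = "\<lambda>(x, (y, z)). ((x, y), z)"]) auto
qed

section \<open>Permutations commuting with a group and preserving small fibres\<close>

text \<open>The fibres are the classes of \<open>R\<close> on \<open>E\<close>: the permutations map each of them to
  itself.  The group \<open>GT\<^sub>1\<close> has this form, and so does its restriction to invariant subsets, over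
  which the structure theorem is proved by induction.\<close>

definition fibre_perms ::
  "('g, 'm) monoid_scheme \<Rightarrow> ('g \<Rightarrow> 'x \<Rightarrow> 'x) \<Rightarrow> ('x \<Rightarrow> 'x \<Rightarrow> bool) \<Rightarrow> 'x set \<Rightarrow> ('x \<Rightarrow> 'x) monoid" where
  "fibre_perms G \<phi> R E = BijGroup E
     \<lparr>carrier := {f \<in> Bij E. (\<forall>h\<in>carrier G. \<forall>x\<in>E. f (\<phi> h x) = \<phi> h (f x)) \<and> (\<forall>x\<in>E. R (f x) x)}\<rparr>"

lemma fibre_perms_mult:
  assumes "f \<in> carrier (fibre_perms G \<phi> R E)" "g \<in> carrier (fibre_perms G \<phi> R E)"
  shows "f \<otimes>\<^bsub>fibre_perms G \<phi> R E\<^esub> g = compose E f g"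
  using assms by (simp add: fibre_perms_def BijGroup_def)

lemma fibre_perms_one: "\<one>\<^bsub>fibre_perms G \<phi> R E\<^esub> = (\<lambda>x\<in>E. x)"
  by (simp add: fibre_perms_def BijGroup_def)

lemma fibre_permsD:
  assumes "f \<in> carrier (fibre_perms G \<phi> R E)"
  shows "f \<in> extensional E" "bij_betw f E E" "inj_on f E" "x \<in> E \<Longrightarrow> f x \<in> E"
    "h \<in> carrier G \<Longrightarrow> x \<in> E \<Longrightarrow> f (\<phi> h x) = \<phi> h (f x)" "x \<in> E \<Longrightarrow> R (f x) x"
  using assms by (auto simp: fibre_perms_def Bij_def bij_betw_def)

lemma fibre_permsI:
  assumes "finite E" "f \<in> extensional E" "inj_on f E" "\<And>x. x \<in> E \<Longrightarrow> f x \<in> E"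
    "\<And>h x. h \<in> carrier G \<Longrightarrow> x \<in> E \<Longrightarrow> f (\<phi> h x) = \<phi> h (f x)" "\<And>x. x \<in> E \<Longrightarrow> R (f x) x"
  shows "f \<in> carrier (fibre_perms G \<phi> R E)"
proof -
  have "f ` E = E" using assms(1,3,4) by (intro endo_inj_surj) auto
  then show ?thesis using assms by (simp add: fibre_perms_def Bij_def bij_betw_def)
qed

lemma finite_fibre_perms:
  assumes "finite E" shows "finite (carrier (fibre_perms G \<phi> R E))"
proof (rule finite_subset)
  show "carrier (fibre_perms G \<phi> R E) \<subseteq> (E \<rightarrow>\<^sub>E E)"
    by (rule subsetI) (simp add: PiE_iff fibre_permsD)
  show "finite (E \<rightarrow>\<^sub>E E)" using assms by (simp add: finite_PiE)
qed

text \<open>The properties of generating triples of \<open>PSL(2, q)\<close>, \<open>q\<close> odd, that determine the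
  shape of \<open>GT\<^sub>1\<close>.  The element \<open>h0\<close> acts as the involution \<open>\<tau>\<close>.
  The assumption \<open>two_pairs\<close> says that a fibre meets at most two orbits of \<open>\<tau>\<close>.  In
  \<open>no_sixth_root\<close>, the exponent six serves to kill the component in \<open>S\<^sub>3\<close>; at the same
  time \<open>6\<close> is congruent to \<open>2\<close> modulo \<open>4\<close>, so that an element acting on a fibre
  as a four-cycle with square \<open>\<tau>\<close> has a sixth power acting as \<open>\<tau>\<close>.\<close>

locale paired_fibres = group_action G E \<phi> for G (structure) and E :: "'x set" and \<phi> +
  fixes R :: "'x \<Rightarrow> 'x \<Rightarrow> bool" and h0
  assumes finite_E: "finite E"
    and R_refl: "x \<in> E \<Longrightarrow> R x x"
    and R_sym: "R x y \<Longrightarrow> x \<in> E \<Longrightarrow> y \<in> E \<Longrightarrow> R y x"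
    and R_trans: "R x y \<Longrightarrow> R y z \<Longrightarrow> x \<in> E \<Longrightarrow> y \<in> E \<Longrightarrow> z \<in> E \<Longrightarrow> R x z"
    and R_act: "R x y \<Longrightarrow> h \<in> carrier G \<Longrightarrow> x \<in> E \<Longrightarrow> y \<in> E \<Longrightarrow> R (\<phi> h x) (\<phi> h y)"
    and h0: "h0 \<in> carrier G"
    and tau_tau: "x \<in> E \<Longrightarrow> \<phi> h0 (\<phi> h0 x) = x"
    and tau_free: "x \<in> E \<Longrightarrow> \<phi> h0 x \<noteq> x"
    and two_pairs: "R x y \<Longrightarrow> R x z \<Longrightarrow> x \<in> E \<Longrightarrow> y \<in> E \<Longrightarrow> z \<in> E \<Longrightarrow>
      y \<in> {x, \<phi> h0 x} \<or> z \<in> {x, \<phi> h0 x} \<or> z \<in> {y, \<phi> h0 y}"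
    and no_sixth_root: "h \<in> carrier G \<Longrightarrow> x \<in> E \<Longrightarrow> \<phi> (h [^] (6::nat)) x \<noteq> \<phi> h0 x"
begin

sublocale grp: group G
  using group_hom group_hom.axioms(1) by blast

abbreviation \<tau> where "\<tau> \<equiv> \<phi> h0"

text \<open>Passing to a block, or to the complement of one, keeps all the structure, which makes induction
  possible.\<close>

definition block :: "'x set \<Rightarrow> bool" where
  "block B \<longleftrightarrow> B \<subseteq> E \<and> (\<forall>h\<in>carrier G. \<forall>x\<in>B. \<phi> h x \<in> B) \<and> (\<forall>x\<in>B. \<forall>y\<in>E. R x y \<longrightarrow> y \<in> B)"

lemma blockD:
  assumes "block B"
  shows "B \<subseteq> E" "x \<in> B \<Longrightarrow> x \<in> E" "h \<in> carrier G \<Longrightarrow> x \<in> B \<Longrightarrow> \<phi> h x \<in> B"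
    "x \<in> B \<Longrightarrow> y \<in> E \<Longrightarrow> R x y \<Longrightarrow> y \<in> B" "finite B"
  using assms finite_E finite_subset by (auto simp: block_def)

lemma act_closed: "h \<in> carrier G \<Longrightarrow> x \<in> E \<Longrightarrow> \<phi> h x \<in> E"
  using element_image by blast

lemma block_E: "block E"
  using act_closed by (auto simp: block_def)

lemma block_Diff:
  assumes "block B" "block C" shows "block (B - C)"
  unfolding block_def
proof (intro conjI ballI impI)
  show "B - C \<subseteq> E" using blockD(1)[OF assms(1)] by blast
next
  fix h x assume h: "h \<in> carrier G" and x: "x \<in> B - C"
  have "\<phi> h x \<notin> C"
  proof
    assume "\<phi> h x \<in> C"
    then have "\<phi> (inv h) (\<phi> h x) \<in> C" using blockD(3)[OF assms(2)] h by blast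
    moreover have "\<phi> (inv h) (\<phi> h x) = x" using orbit_sym_aux[OF h] x blockD(2)[OF assms(1)] by blast
    ultimately show False using x by simp
  qed
  then show "\<phi> h x \<in> B - C" using blockD(3)[OF assms(1) h] x by blast
next
  fix x y assume x: "x \<in> B - C" and y: "y \<in> E" "R x y"
  have "x \<in> E" using x blockD(2)[OF assms(1)] by blast
  then have "y \<notin> C" using blockD(4)[OF assms(2), of y x] R_sym[OF y(2)] x y by blast
  then show "y \<in> B - C" using blockD(4)[OF assms(1), of x y] x y by blast
qed

abbreviation perms where "perms B \<equiv> fibre_perms G \<phi> R B"

lemma perm_R: "block B \<Longrightarrow> f \<in> carrier (perms B) \<Longrightarrow> x \<in> B \<Longrightarrow> R x (f x)"
  by (rule R_sym) (simp_all add: fibre_permsD blockD(2))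

lemma compose_perms:
  assumes "block B" "f \<in> carrier (perms B)" "g \<in> carrier (perms B)"
  shows "compose B f g \<in> carrier (perms B)"
proof (rule fibre_permsI)
  note f = fibre_permsD[OF assms(2)] and g = fibre_permsD[OF assms(3)]
  show "inj_on (compose B f g) B"
    using f(3,4) g(3,4) by (intro inj_onI) (metis compose_eq inj_onD)
  fix x assume x: "x \<in> B"
  show "compose B f g x \<in> B" using x f g by (simp add: compose_eq)
  show "R (compose B f g x) x"
    using R_trans[OF f(6)[OF g(4)[OF x]] g(6)[OF x]] x f(4)[OF g(4)[OF x]] g(4)[OF x]
      blockD(2)[OF assms(1)] by (simp add: compose_eq)
  fix h assume "h \<in> carrier G"
  then show "compose B f g (\<phi> h x) = \<phi> h (compose B f g x)"
    using x f g blockD(3)[OF assms(1)] by (simp add: compose_eq)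
qed (simp_all add: blockD(5)[OF assms(1)])

lemma group_perms: assumes B: "block B" shows "group (perms B)"
proof -
  interpret S: group "BijGroup B" by (rule group_BijGroup)
  have "subgroup (carrier (perms B)) (BijGroup B)"
  proof (rule S.subgroupI)
    show "carrier (perms B) \<subseteq> carrier (BijGroup B)" by (auto simp: fibre_perms_def BijGroup_def)
    have "(\<lambda>x\<in>B. x) \<in> carrier (perms B)"
      by (rule fibre_permsI) (simp_all add: inj_on_def R_refl blockD(2,3,5)[OF B])
    then show "carrier (perms B) \<noteq> {}" by blast
  next
    fix f assume f: "f \<in> carrier (perms B)"
    note fD = fibre_permsD[OF f]
    define g where "g = (\<lambda>x\<in>B. inv_into B f x)"
    have fb: "f \<in> Bij B" using f by (simp add: fibre_perms_def)
    have fg: "g x \<in> B" "f (g x) = x" if "x \<in> B" for x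
      using that fD(2) by (auto simp: g_def bij_betw_def f_inv_into_f inv_into_into)
    have "g \<in> carrier (perms B)"
    proof (rule fibre_permsI)
      show "inj_on g B" using fg(2) by (metis inj_onI)
      fix x assume x: "x \<in> B"
      show "g x \<in> B" by (rule fg(1)[OF x])
      show "R (g x) x" using perm_R[OF B f fg(1)[OF x]] fg(2)[OF x] by simp
      fix h assume h: "h \<in> carrier G"
      have "f (g (\<phi> h x)) = f (\<phi> h (g x))"
        using fD(5)[OF h fg(1)[OF x]] fg(2) x blockD(3)[OF B h] by simp
      then show "g (\<phi> h x) = \<phi> h (g x)"
        using inj_onD[OF fD(3)] fg(1) x blockD(3)[OF B h] by blast
    qed (simp_all add: blockD(5)[OF B] g_def)
    then show "inv\<^bsub>BijGroup B\<^esub> f \<in> carrier (perms B)" using inv_BijGroup[OF fb] by (simp add: g_def)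
  next
    fix f g assume "f \<in> carrier (perms B)" "g \<in> carrier (perms B)"
    then show "f \<otimes>\<^bsub>BijGroup B\<^esub> g \<in> carrier (perms B)"
      using compose_perms[OF B] fibre_perms_mult[of f G \<phi> R B g] by (simp add: fibre_perms_def)
  qed
  then have "group (BijGroup B \<lparr>carrier := carrier (perms B)\<rparr>)"
    by (rule subgroup.subgroup_is_group[OF _ S.is_group])
  then show ?thesis by (simp add: fibre_perms_def)
qed

lemma perm_sub_block:
  assumes "block B" "block C" "C \<subseteq> B" "f \<in> carrier (perms B)" "x \<in> C"
  shows "f x \<in> C"
  using blockD(4)[OF assms(2,5)] perm_R[OF assms(1,4)] fibre_permsD(4)[OF assms(4)] assms(3,5)
    blockD(2)[OF assms(1)] by blast

lemma restrict_perms: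
  assumes "block B" "block C" "C \<subseteq> B" "f \<in> carrier (perms B)"
  shows "restrict f C \<in> carrier (perms C)"
proof (rule fibre_permsI)
  note f = fibre_permsD[OF assms(4)]
  show "inj_on (restrict f C) C" using inj_on_subset[OF f(3) assms(3)] by simp
  fix x assume x: "x \<in> C"
  then have "x \<in> B" using assms(3) by blast
  show "restrict f C x \<in> C" using perm_sub_block[OF assms x] x by simp
  show "R (restrict f C x) x" using f(6)[OF \<open>x \<in> B\<close>] x by simp
  fix h assume h: "h \<in> carrier G"
  show "restrict f C (\<phi> h x) = \<phi> h (restrict f C x)"
    using f(5)[OF h \<open>x \<in> B\<close>] x blockD(3)[OF assms(2) h x] by simp
qed (simp_all add: blockD(5)[OF assms(2)])

text \<open>Permutations preserve every union of fibres, so they restrict to the two parts; conversely, permutations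
  of the two parts can be glued because neither the action nor \<open>R\<close> connects them.\<close>

lemma perms_split:
  assumes B: "block B" and C: "block C" "C \<subseteq> B"
  shows "perms B \<cong> (perms C \<times>\<times> perms (B - C))"
proof (rule is_isoI, rule isoI)
  let ?D = "B - C"
  have D: "block ?D" "?D \<subseteq> B" using block_Diff[OF B C(1)] by auto
  let ?r = "\<lambda>f. (restrict f C, restrict f ?D)"
  note rC = restrict_perms[OF B C] and rD = restrict_perms[OF B D]
  show "?r \<in> hom (perms B) (perms C \<times>\<times> perms ?D)"
  proof (rule homI)
    fix f assume "f \<in> carrier (perms B)"
    then show "?r f \<in> carrier (perms C \<times>\<times> perms ?D)" using rC rD by simp
  next
    fix f g assume fg: "f \<in> carrier (perms B)" "g \<in> carrier (perms B)"
    have e: "restrict (compose B f g) A = compose A (restrict f A) (restrict g A)"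
      if "block A" "A \<subseteq> B" for A
      using perm_sub_block[OF B that fg(2)] that(2) by (auto simp: fun_eq_iff compose_def restrict_def)
    show "?r (f \<otimes>\<^bsub>perms B\<^esub> g) = ?r f \<otimes>\<^bsub>perms C \<times>\<times> perms ?D\<^esub> ?r g"
      using e[OF C] e[OF D] fg rC rD by (simp add: fibre_perms_mult)
  qed
  show "bij_betw ?r (carrier (perms B)) (carrier (perms C \<times>\<times> perms ?D))"
  proof (rule bij_betw_byWitness[where f' = "\<lambda>(f, g). \<lambda>x\<in>B. if x \<in> C then f x else g x"])
    show "\<forall>f\<in>carrier (perms B). (\<lambda>(f, g). \<lambda>x\<in>B. if x \<in> C then f x else g x) (?r f) = f"
    proof
      fix f assume "f \<in> carrier (perms B)"
      then have "f \<in> extensional B" by (rule fibre_permsD)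
      then show "(\<lambda>(f, g). \<lambda>x\<in>B. if x \<in> C then f x else g x) (?r f) = f"
        by (intro extensionalityI[of _ B]) auto
    qed
    show "\<forall>p\<in>carrier (perms C \<times>\<times> perms ?D). ?r ((\<lambda>(f, g). \<lambda>x\<in>B. if x \<in> C then f x else g x) p) = p"
    proof
      fix p assume p: "p \<in> carrier (perms C \<times>\<times> perms ?D)"
      obtain f g where [simp]: "p = (f, g)" by (cases p)
      have "f \<in> extensional C" "g \<in> extensional ?D" using p fibre_permsD(1) by auto
      then show "?r ((\<lambda>(f, g). \<lambda>x\<in>B. if x \<in> C then f x else g x) p) = p"
        using C(2) by (auto simp: fun_eq_iff restrict_def extensional_def)
    qed
    show "?r ` carrier (perms B) \<subseteq> carrier (perms C \<times>\<times> perms ?D)" using rC rD by auto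
    show "(\<lambda>(f, g). \<lambda>x\<in>B. if x \<in> C then f x else g x) ` carrier (perms C \<times>\<times> perms ?D) \<subseteq> carrier (perms B)"
    proof (rule image_subsetI)
      fix p assume p: "p \<in> carrier (perms C \<times>\<times> perms ?D)"
      obtain f g where [simp]: "p = (f, g)" by (cases p)
      have fg: "f \<in> carrier (perms C)" "g \<in> carrier (perms ?D)" using p by auto
      note f = fibre_permsD[OF fg(1)] and g = fibre_permsD[OF fg(2)]
      let ?h = "\<lambda>x\<in>B. if x \<in> C then f x else g x"
      have hC: "?h x = f x" "?h x \<in> C" if "x \<in> C" for x using that C(2) f(4) by auto
      have hD: "?h x = g x" "?h x \<in> ?D" if "x \<in> ?D" for x using that g(4)[OF that] by auto
      have "?h \<in> carrier (perms B)"
      proof (rule fibre_permsI)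
        show "inj_on ?h B"
        proof (rule inj_onI)
          fix x y assume xy: "x \<in> B" "y \<in> B" "?h x = ?h y"
          consider "x \<in> C" "y \<in> C" | "x \<in> ?D" "y \<in> ?D" | "x \<in> C" "y \<in> ?D" | "x \<in> ?D" "y \<in> C"
            using xy(1,2) by blast
          then show "x = y"
          proof cases
            case 1 then show ?thesis using xy(3) hC inj_onD[OF f(3)] by metis
          next
            case 2 then show ?thesis using xy(3) hD inj_onD[OF g(3)] by metis
          next
            case 3 then show ?thesis using xy(3) hC(2) hD(2) by (metis DiffD2)
          next
            case 4 then show ?thesis using xy(3) hC(2) hD(2) by (metis DiffD2)
          qed
        qed
        fix x assume x: "x \<in> B"
        show "?h x \<in> B" using x hC(2)[of x] hD(2)[of x] C(2) by blast
        show "R (?h x) x" using x f(6) g(6) by auto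
        fix k assume k: "k \<in> carrier G"
        show "?h (\<phi> k x) = \<phi> k (?h x)"
        proof (cases "x \<in> C")
          case True
          then show ?thesis using hC(1) f(5)[OF k] blockD(3)[OF C(1) k] by metis
        next
          case False
          then have "x \<in> ?D" using x by simp
          then show ?thesis using hD(1) g(5)[OF k] blockD(3)[OF D(1) k] by metis
        qed
      qed (simp_all add: blockD(5)[OF B])
      then show "(\<lambda>(f, g). \<lambda>x\<in>B. if x \<in> C then f x else g x) p \<in> carrier (perms B)" by simp
    qed
  qed
qed

lemma tau_closed: "block B \<Longrightarrow> x \<in> B \<Longrightarrow> \<tau> x \<in> B"
  by (rule blockD(3)[OF _ h0])

lemma perm_tau: "block B \<Longrightarrow> f \<in> carrier (perms B) \<Longrightarrow> x \<in> B \<Longrightarrow> f (\<tau> x) = \<tau> (f x)"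
  by (rule fibre_permsD(5)[OF _ h0])

text \<open>Two of \<open>x\<close>, \<open>f x\<close>, \<open>f (f x)\<close> lie in the same orbit of
  \<open>\<tau>\<close>, because all three lie in one fibre.  As \<open>f\<close> is injective and commutes with
  \<open>\<tau>\<close>, each of the possibilities reduces to one of the two stated.\<close>

lemma perm_square_cases:
  assumes B: "block B" and f: "f \<in> carrier (perms B)" and x: "x \<in> B"
  shows "f (f x) = x \<or> f (f x) = \<tau> x"
proof -
  note fD = fibre_permsD[OF f]
  have xB: "f x \<in> B" "f (f x) \<in> B" using fD(4) x by simp_all
  have E: "x \<in> E" "f x \<in> E" "f (f x) \<in> E" using blockD(2)[OF B] x xB by simp_all
  have Rs: "R x (f x)" "R x (f (f x))"
    using perm_R[OF B f x] perm_R[OF B f xB(1)] R_trans E by blast+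
  have tt: "\<tau> (\<tau> x) = x" by (rule tau_tau[OF E(1)])
  have inj: "u = v" if "f u = f v" "u \<in> B" "v \<in> B" for u v
    using inj_onD[OF fD(3) that(1)] that by simp
  have *: "f (f x) = x" if "f x = \<tau> x"
    using perm_tau[OF B f x] that tt by simp
  consider "f x = x" | "f x = \<tau> x" | "f (f x) = x" | "f (f x) = \<tau> x"
    | "f (f x) = f x" | "f (f x) = \<tau> (f x)"
    using two_pairs[OF Rs E] by blast
  then show ?thesis
  proof cases
    case 5
    then have "f x = x" using inj x xB by blast
    then show ?thesis by simp
  next
    case 6
    then have "f (f x) = f (\<tau> x)" using perm_tau[OF B f x] by simp
    then have "f x = \<tau> x" using inj xB(1) tau_closed[OF B x] by blast
    then show ?thesis using * by blast
  next
    case 2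
    then show ?thesis using * by blast
  qed simp_all
qed

lemma act_one: "x \<in> E \<Longrightarrow> \<phi> \<one> x = x"
  using id_eq_one by (metis restrict_apply')

lemma act_pow_perm:
  assumes B: "block B" and f: "f \<in> carrier (perms B)" and y: "y \<in> B"
    and k: "k \<in> carrier G" "\<phi> k y = f y"
  shows "\<phi> (k [^] (n::nat)) y = (f ^^ n) y"
proof (induction n)
  case 0
  have "\<phi> \<one> y = y" by (rule act_one[OF blockD(2)[OF B y]])
  then show ?case by simp
next
  case (Suc n)
  have kn: "k [^] n \<in> carrier G" using k by simp
  have "\<phi> (k [^] Suc n) y = \<phi> (k [^] n) (f y)"
    using composition_rule[OF blockD(2)[OF B y] kn k(1)] k(2) by simp
  also have "\<dots> = f (\<phi> (k [^] n) y)" by (rule fibre_permsD(5)[OF f kn y, symmetric])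
  finally show ?case using Suc by simp
qed

text \<open>Let \<open>f\<close> act on the fibre of \<open>y\<close> as the four-cycle \<open>y, f y, \<tau> y, f
  (\<tau> y)\<close>.  The block generated by this fibre is the union of the orbits of \<open>y\<close> and of
  \<open>f y\<close> under \<open>G\<close>.\<close>

context
  fixes B f y
  assumes B: "block B" and f: "f \<in> carrier (perms B)" and y: "y \<in> B" and ffy: "f (f y) = \<tau> y"
begin

definition even_orbit where "even_orbit = {\<phi> h y | h. h \<in> carrier G}"
definition odd_orbit where "odd_orbit = {\<phi> h (f y) | h. h \<in> carrier G}"

lemma fy: "f y \<in> B" by (rule fibre_permsD(4)[OF f y])

lemma yE: "y \<in> E" "f y \<in> E" using blockD(2)[OF B] y fy by simp_all

lemma act_orbit:
  assumes "w \<in> E" "h \<in> carrier G" "x \<in> {\<phi> h w | h. h \<in> carrier G}"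
  shows "\<phi> h x \<in> {\<phi> h w | h. h \<in> carrier G}"
proof -
  obtain k where k: "k \<in> carrier G" "x = \<phi> k w" using assms(3) by blast
  then have "\<phi> h x = \<phi> (h \<otimes> k) w" using composition_rule[OF assms(1,2) k(1)] by simp
  then show ?thesis using grp.m_closed[OF assms(2) k(1)] by blast
qed

lemma orbits_closed:
  "h \<in> carrier G \<Longrightarrow> x \<in> even_orbit \<Longrightarrow> \<phi> h x \<in> even_orbit" "h \<in> carrier G \<Longrightarrow> x \<in> odd_orbit \<Longrightarrow> \<phi> h x \<in> odd_orbit"
  unfolding even_orbit_def odd_orbit_def by (fact act_orbit[OF yE(1)], fact act_orbit[OF yE(2)])

lemma base_in_orbits: "y \<in> even_orbit" "f y \<in> odd_orbit"
proof -
  have "y = \<phi> \<one> y" "f y = \<phi> \<one> (f y)" using act_one yE by simp_all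
  then show "y \<in> even_orbit" "f y \<in> odd_orbit" unfolding even_orbit_def odd_orbit_def using grp.one_closed by blast+
qed

lemma orbits_sub: "even_orbit \<subseteq> B" "odd_orbit \<subseteq> B"
  unfolding even_orbit_def odd_orbit_def using blockD(3)[OF B _ y] blockD(3)[OF B _ fy] by blast+

lemma swap_even: "x \<in> even_orbit \<Longrightarrow> f x \<in> odd_orbit"
  unfolding even_orbit_def odd_orbit_def using fibre_permsD(5)[OF f _ y] by blast

lemma swap_odd: "x \<in> odd_orbit \<Longrightarrow> f x \<in> even_orbit"
proof -
  assume "x \<in> odd_orbit"
  then obtain h where h: "h \<in> carrier G" "x = \<phi> h (f y)" by (auto simp: odd_orbit_def)
  have "f x = \<phi> h (\<tau> y)" using fibre_permsD(5)[OF f h(1) fy] h ffy by simp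
  then show "f x \<in> even_orbit" using orbits_closed(1)[OF h(1) orbits_closed(1)[OF h0 base_in_orbits(1)]] by simp
qed

lemma ff_ne: "f (f x) \<noteq> x" if "x \<in> even_orbit \<union> odd_orbit"
proof -
  have 1: "f (f y) \<noteq> y" using ffy tau_free yE(1) by simp
  have 2: "f (f (f y)) \<noteq> f y"
    using 1 inj_onD[OF fibre_permsD(3)[OF f], of "f (f y)" y] y fy fibre_permsD(4)[OF f] by blast
  have ne: "f (f (\<phi> h w)) \<noteq> \<phi> h w" if h: "h \<in> carrier G" and w: "w \<in> B" "f (f w) \<noteq> w" for h w
  proof -
    have fw: "f w \<in> B" "f (f w) \<in> B" using fibre_permsD(4)[OF f] w by simp_all
    have "f (f (\<phi> h w)) = \<phi> h (f (f w))"
      using fibre_permsD(5)[OF f h w(1)] fibre_permsD(5)[OF f h fw(1)] by simp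
    moreover have "f (f w) \<in> E" "w \<in> E" using fw w blockD(2)[OF B] by simp_all
    ultimately show ?thesis using inj_onD[OF inj_prop[OF h], of "f (f w)" w] w(2) by argo
  qed
  from that obtain h where "h \<in> carrier G" "x = \<phi> h y \<or> x = \<phi> h (f y)"
    unfolding even_orbit_def odd_orbit_def by blast
  then show ?thesis using ne[OF _ y 1] ne[OF _ fy 2] by blast
qed

lemma ff_tau: "x \<in> even_orbit \<union> odd_orbit \<Longrightarrow> f (f x) = \<tau> x"
  using perm_square_cases[OF B f] ff_ne orbits_sub by blast

text \<open>If \<open>k\<close> takes \<open>y\<close> to \<open>f y\<close>, then \<open>k\<^sup>6\<close> takes
  \<open>y\<close> to \<open>f\<^sup>6 y = \<tau>\<^sup>3 y = \<tau> y\<close>, which \<open>no_sixth_root\<close>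
  excludes.\<close>

lemma orbits_disjoint: "even_orbit \<inter> odd_orbit = {}"
proof (rule ccontr)
  assume "even_orbit \<inter> odd_orbit \<noteq> {}"
  then obtain h h' where h: "h \<in> carrier G" "h' \<in> carrier G" "\<phi> h y = \<phi> h' (f y)"
    by (auto simp: even_orbit_def odd_orbit_def)
  \<comment> \<open>A common point of the orbits yields an element \<open>k\<close> that takes \<open>y\<close> to
    \<open>f y\<close>.\<close>
  define k where "k = inv h' \<otimes> h"
  have k: "k \<in> carrier G" using h by (simp add: k_def)
  have "\<phi> k y = \<phi> (inv h') (\<phi> h y)"
    unfolding k_def using composition_rule[OF yE(1)] h by simp
  also have "\<dots> = f y" using orbit_sym_aux[OF h(2) yE(2)] h(3) by simp
  finally have "\<phi> (k [^] (6::nat)) y = (f ^^ 6) y" by (rule act_pow_perm[OF B f y k])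
  also have "(f ^^ 6) y = f (f (f (f (f (f y)))))" by (simp add: eval_nat_numeral)
  also have "\<dots> = \<tau> (\<tau> (\<tau> y))"
    using ff_tau base_in_orbits(1) orbits_closed(1)[OF h0] by simp
  also have "\<dots> = \<tau> y" using tau_tau[OF act_closed[OF h0 yE(1)]] by simp
  finally show False using no_sixth_root[OF k yE(1)] by simp
qed

definition four_cycles where "four_cycles = even_orbit \<union> odd_orbit"

lemma R_y_cases:
  assumes "u \<in> E" "R y u" shows "u \<in> {y, \<tau> y} \<or> u \<in> {f y, \<tau> (f y)}"
proof -
  have "f y \<notin> {y, \<tau> y}"
  proof
    assume "f y \<in> {y, \<tau> y}"
    then have "f (f y) = y" using perm_tau[OF B f y] tau_tau[OF yE(1)] by auto
    then show False using ff_ne base_in_orbits by blast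
  qed
  then show ?thesis
    using two_pairs[OF perm_R[OF B f y] assms(2) yE assms(1)] by blast
qed

lemma block_four_cycles: "block four_cycles"
  unfolding block_def
proof (intro conjI ballI impI)
  show "four_cycles \<subseteq> E" using orbits_sub blockD(1)[OF B] by (auto simp: four_cycles_def)
next
  fix h x assume "h \<in> carrier G" "x \<in> four_cycles"
  then show "\<phi> h x \<in> four_cycles" using orbits_closed by (auto simp: four_cycles_def)
next
  fix x u assume x: "x \<in> four_cycles" and u: "u \<in> E" "R x u"
  obtain h w where h: "h \<in> carrier G" "x = \<phi> h w" "w \<in> {y, f y}"
    using x by (auto simp: four_cycles_def even_orbit_def odd_orbit_def)
  have w: "w \<in> E" "R y w" using h(3) yE perm_R[OF B f y] R_refl by auto
  have ih: "inv h \<in> carrier G" using h by simp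
  have xE: "x \<in> E" using x orbits_sub blockD(1)[OF B] by (auto simp: four_cycles_def)
  have "R w (\<phi> (inv h) u)"
    using R_act[OF u(2) ih xE u(1)] orbit_sym_aux[OF h(1) w(1)] h(2) by simp
  then have "R y (\<phi> (inv h) u)"
    using R_trans[OF w(2) _ yE(1) w(1)] act_closed[OF ih u(1)] by blast
  then have "\<phi> (inv h) u \<in> four_cycles"
    using R_y_cases[OF act_closed[OF ih u(1)]] base_in_orbits orbits_closed[OF h0] by (auto simp: four_cycles_def)
  then have "\<phi> h (\<phi> (inv h) u) \<in> four_cycles" using orbits_closed[OF h(1)] by (auto simp: four_cycles_def)
  moreover have "\<phi> h (\<phi> (inv h) u) = u" using orbit_sym_aux[OF ih u(1)] h(1) by simp
  ultimately show "u \<in> four_cycles" by simp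
qed

lemma four_cycles_sub: "four_cycles \<subseteq> B" using orbits_sub by (auto simp: four_cycles_def)

definition rotation where "rotation = restrict f four_cycles"
text \<open>On the four-cycle of \<open>y\<close> this is the reflection that fixes \<open>y\<close> and \<open>\<tau>
  y\<close> and exchanges the other two points.  It is well defined on the whole block because the two orbits are
  disjoint, and it commutes with \<open>G\<close> because \<open>\<tau>\<close> is the square of \<open>f\<close>
  there.\<close>

definition reflection where "reflection = (\<lambda>x\<in>four_cycles. if x \<in> even_orbit then x else \<tau> x)"

lemma rotation_perms: "rotation \<in> carrier (perms four_cycles)"
  unfolding rotation_def by (rule restrict_perms[OF B block_four_cycles four_cycles_sub f])

lemma rotation_apply: "x \<in> four_cycles \<Longrightarrow> rotation x = f x" by (simp add: rotation_def)

lemma reflection_even: "x \<in> even_orbit \<Longrightarrow> reflection x = x" by (simp add: reflection_def four_cycles_def)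
lemma reflection_odd: "x \<in> odd_orbit \<Longrightarrow> reflection x = \<tau> x" using orbits_disjoint by (auto simp: reflection_def four_cycles_def)

lemma reflection_closed: "x \<in> even_orbit \<Longrightarrow> reflection x \<in> even_orbit" "x \<in> odd_orbit \<Longrightarrow> reflection x \<in> odd_orbit"
  by (simp_all add: reflection_even reflection_odd orbits_closed(2)[OF h0])

lemma reflection_refl: "x \<in> four_cycles \<Longrightarrow> reflection (reflection x) = x"
proof -
  assume x: "x \<in> four_cycles"
  then have "x \<in> E" using blockD(2)[OF block_four_cycles] by blast
  then show ?thesis using x reflection_even reflection_odd reflection_closed(2) tau_tau unfolding four_cycles_def by (metis UnE)
qed

lemma reflection_perms: "reflection \<in> carrier (perms four_cycles)"
proof (rule fibre_permsI)
  show "finite four_cycles" by (rule blockD(5)[OF block_four_cycles])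
  show "reflection \<in> extensional four_cycles" by (simp add: reflection_def)
  show "inj_on reflection four_cycles" using reflection_refl by (metis inj_onI)
  fix x assume x: "x \<in> four_cycles"
  show "reflection x \<in> four_cycles" using x reflection_closed by (auto simp: four_cycles_def)
  have xE: "x \<in> E" using x blockD(2)[OF block_four_cycles] by blast
  have "R (\<tau> x) x" if "x \<in> odd_orbit"
  proof -
    have xB: "x \<in> B" "f x \<in> B" using that orbits_sub fibre_permsD(4)[OF f] by auto
    have "R (f (f x)) x"
      using fibre_permsD(6)[OF f xB(2)] fibre_permsD(6)[OF f xB(1)]
        R_trans[of "f (f x)" "f x" x] blockD(2)[OF B] xB fibre_permsD(4)[OF f] by blast
    then show ?thesis using ff_tau that by simp
  qed
  then show "R (reflection x) x" using x reflection_even reflection_odd R_refl[OF xE] unfolding four_cycles_def by (metis UnE)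
  fix h assume h: "h \<in> carrier G"
  show "reflection (\<phi> h x) = \<phi> h (reflection x)"
  proof (cases "x \<in> even_orbit")
    case True
    then show ?thesis using reflection_even orbits_closed(1)[OF h] by simp
  next
    case False
    then have x2: "x \<in> odd_orbit" using x by (simp add: four_cycles_def)
    then have xB: "x \<in> B" "f x \<in> B" using orbits_sub fibre_permsD(4)[OF f] by auto
    have "reflection (\<phi> h x) = f (f (\<phi> h x))" using reflection_odd ff_tau orbits_closed(2)[OF h x2] by simp
    also have "\<dots> = \<phi> h (f (f x))"
      using fibre_permsD(5)[OF f h xB(1)] fibre_permsD(5)[OF f h xB(2)] by simp
    finally show ?thesis using reflection_odd ff_tau x2 by simp
  qed
qed

text \<open>A permutation commuting with \<open>G\<close> is determined by its values on orbit
  representatives.\<close>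

lemma perms_eqI:
  assumes "g \<in> carrier (perms four_cycles)" "g' \<in> carrier (perms four_cycles)" "g y = g' y" "g (f y) = g' (f y)"
  shows "g = g'"
proof (rule extensionalityI[of _ four_cycles])
  fix x assume "x \<in> four_cycles"
  then obtain h w where h: "h \<in> carrier G" "x = \<phi> h w" "w \<in> {y, f y}"
    by (auto simp: four_cycles_def even_orbit_def odd_orbit_def)
  have "w \<in> four_cycles" using h(3) base_in_orbits by (auto simp: four_cycles_def)
  then show "g x = g' x"
    using fibre_permsD(5)[OF assms(1) h(1)] fibre_permsD(5)[OF assms(2) h(1)] h assms(3,4) by auto
qed (simp_all add: fibre_permsD(1)[OF assms(1)] fibre_permsD(1)[OF assms(2)])

text \<open>After a suitable rotation a permutation fixes \<open>y\<close>, hence \<open>\<tau> y\<close>, so it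
  either fixes \<open>f y\<close> or sends it to \<open>\<tau> (f y)\<close>; in the second case it is the
  reflection.\<close>

lemma perms_four_cycles_iso_D8: "perms four_cycles \<cong> D8"
proof -
  interpret K: group "perms four_cycles" by (rule group_perms[OF block_four_cycles])
  have yC: "y \<in> four_cycles" "f y \<in> four_cycles" using base_in_orbits by (auto simp: four_cycles_def)
  have ffC: "f x \<in> four_cycles" if "x \<in> four_cycles" for x using that swap_even swap_odd by (auto simp: four_cycles_def)
  have tC: "\<tau> x \<in> four_cycles" if "x \<in> four_cycles" for x using that by (rule tau_closed[OF block_four_cycles])
  have ff: "f (f x) = \<tau> x" if "x \<in> four_cycles" for x using ff_tau that by (simp add: four_cycles_def)
  have mult: "(g \<otimes>\<^bsub>perms four_cycles\<^esub> g') x = g (g' x)" if "g \<in> carrier (perms four_cycles)" "g' \<in> carrier (perms four_cycles)" "x \<in> four_cycles" for g g' x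
    using that by (simp add: fibre_perms_mult compose_eq)
  have one: "\<one>\<^bsub>perms four_cycles\<^esub> x = x" if "x \<in> four_cycles" for x using that by (simp add: fibre_perms_one)
  have ext: "g = g'" if "g \<in> carrier (perms four_cycles)" "g' \<in> carrier (perms four_cycles)" "\<And>x. x \<in> four_cycles \<Longrightarrow> g x = g' x" for g g'
    using extensionalityI[OF fibre_permsD(1)[OF that(1)] fibre_permsD(1)[OF that(2)] that(3)] .
  note rs = rotation_perms reflection_perms
  have rC: "rotation x \<in> four_cycles" "reflection x \<in> four_cycles" if "x \<in> four_cycles" for x
    using fibre_permsD(4)[OF rotation_perms that] fibre_permsD(4)[OF reflection_perms that] .
  have rr: "(rotation \<otimes>\<^bsub>perms four_cycles\<^esub> rotation) x = \<tau> x" if "x \<in> four_cycles" for x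
    using that rs rC by (simp add: mult rotation_apply ff ffC)
  have r2: "rotation [^]\<^bsub>perms four_cycles\<^esub> (2::nat) = rotation \<otimes>\<^bsub>perms four_cycles\<^esub> rotation" using rs by (simp add: numeral_2_eq_2)
  have "rotation [^]\<^bsub>perms four_cycles\<^esub> (4::nat) = (rotation [^]\<^bsub>perms four_cycles\<^esub> (2::nat)) [^]\<^bsub>perms four_cycles\<^esub> (2::nat)"
    using K.nat_pow_pow[OF rotation_perms, of 2 2] by simp
  also have "\<dots> = (rotation \<otimes>\<^bsub>perms four_cycles\<^esub> rotation) \<otimes>\<^bsub>perms four_cycles\<^esub> (rotation \<otimes>\<^bsub>perms four_cycles\<^esub> rotation)"
    unfolding r2 using rs by (simp add: numeral_2_eq_2)
  also have "\<dots> = \<one>\<^bsub>perms four_cycles\<^esub>"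
  proof (rule ext)
    have rrP: "rotation \<otimes>\<^bsub>perms four_cycles\<^esub> rotation \<in> carrier (perms four_cycles)" using rotation_perms by (rule K.m_closed[OF rotation_perms])
    then show "rotation \<otimes>\<^bsub>perms four_cycles\<^esub> rotation \<otimes>\<^bsub>perms four_cycles\<^esub> (rotation \<otimes>\<^bsub>perms four_cycles\<^esub> rotation) \<in> carrier (perms four_cycles)" by (rule K.m_closed[OF rrP])
    fix x assume x: "x \<in> four_cycles"
    show "(rotation \<otimes>\<^bsub>perms four_cycles\<^esub> rotation \<otimes>\<^bsub>perms four_cycles\<^esub> (rotation \<otimes>\<^bsub>perms four_cycles\<^esub> rotation)) x = \<one>\<^bsub>perms four_cycles\<^esub> x"
      unfolding mult[OF rrP rrP x] rr[OF x] rr[OF tC[OF x]] one[OF x]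
      by (rule tau_tau[OF blockD(2)[OF block_four_cycles x]])
  qed (rule K.one_closed)
  finally have r4: "rotation [^]\<^bsub>perms four_cycles\<^esub> (4::nat) = \<one>\<^bsub>perms four_cycles\<^esub>" .
  have r2ne: "rotation [^]\<^bsub>perms four_cycles\<^esub> (2::nat) \<noteq> \<one>\<^bsub>perms four_cycles\<^esub>"
  proof
    assume "rotation [^]\<^bsub>perms four_cycles\<^esub> (2::nat) = \<one>\<^bsub>perms four_cycles\<^esub>"
    then have "\<tau> y = y" using rr[OF yC(1)] one[OF yC(1)] r2 by simp
    then show False using tau_free[OF yE(1)] by simp
  qed
  have "K.ord rotation = 4"
  proof -
    have "K.ord rotation dvd 4" "\<not> K.ord rotation dvd 2" using r4 r2ne K.pow_eq_id[OF rotation_perms] by auto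
    moreover have "K.ord rotation \<le> 4" using \<open>K.ord rotation dvd 4\<close> by (rule dvd_imp_le) simp
    moreover have "K.ord rotation \<noteq> 0" using \<open>K.ord rotation dvd 4\<close> by (metis dvd_0_left zero_neq_numeral)
    moreover have "K.ord rotation \<noteq> 3" using \<open>K.ord rotation dvd 4\<close> by auto
    moreover have "K.ord rotation \<noteq> 1" "K.ord rotation \<noteq> 2" using \<open>\<not> K.ord rotation dvd 2\<close> by auto
    ultimately show ?thesis by linarith
  qed
  have ss: "reflection \<otimes>\<^bsub>perms four_cycles\<^esub> reflection = \<one>\<^bsub>perms four_cycles\<^esub>"
  proof (rule ext)
    show "reflection \<otimes>\<^bsub>perms four_cycles\<^esub> reflection \<in> carrier (perms four_cycles)" using reflection_perms by (rule K.m_closed[OF reflection_perms])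
    fix x assume x: "x \<in> four_cycles"
    show "(reflection \<otimes>\<^bsub>perms four_cycles\<^esub> reflection) x = \<one>\<^bsub>perms four_cycles\<^esub> x"
      unfolding mult[OF reflection_perms reflection_perms x] one[OF x] by (rule reflection_refl[OF x])
  qed (rule K.one_closed)
  have rsr: "rotation \<otimes>\<^bsub>perms four_cycles\<^esub> (reflection \<otimes>\<^bsub>perms four_cycles\<^esub> rotation) = reflection"
  proof (rule ext)
    fix x assume x: "x \<in> four_cycles"
    have e: "(rotation \<otimes>\<^bsub>perms four_cycles\<^esub> (reflection \<otimes>\<^bsub>perms four_cycles\<^esub> rotation)) x = f (reflection (f x))"
      using rs x rC ffC by (simp add: mult rotation_apply)
    show "(rotation \<otimes>\<^bsub>perms four_cycles\<^esub> (reflection \<otimes>\<^bsub>perms four_cycles\<^esub> rotation)) x = reflection x"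
    proof (cases "x \<in> even_orbit")
      case True
      have "f (reflection (f x)) = \<tau> (f (f x))"
        using reflection_odd[OF swap_even[OF True]] perm_tau[OF B f, of "f x"] ffC[OF x] four_cycles_sub by auto
      also have "\<dots> = x" using ff[OF x] tau_tau blockD(2)[OF block_four_cycles x] by simp
      finally show ?thesis using e reflection_even[OF True] by simp
    next
      case False
      then have x2: "x \<in> odd_orbit" using x by (simp add: four_cycles_def)
      then show ?thesis using e reflection_even[OF swap_odd[OF x2]] reflection_odd[OF x2] ff[OF x] by simp
    qed
  qed (use rs in auto)
  have srs: "reflection \<otimes>\<^bsub>perms four_cycles\<^esub> rotation \<otimes>\<^bsub>perms four_cycles\<^esub> reflection = inv\<^bsub>perms four_cycles\<^esub> rotation"
  proof (rule K.inv_equality[symmetric])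
    have "rotation \<otimes>\<^bsub>perms four_cycles\<^esub> (reflection \<otimes>\<^bsub>perms four_cycles\<^esub> rotation \<otimes>\<^bsub>perms four_cycles\<^esub> reflection) = rotation \<otimes>\<^bsub>perms four_cycles\<^esub> (reflection \<otimes>\<^bsub>perms four_cycles\<^esub> rotation) \<otimes>\<^bsub>perms four_cycles\<^esub> reflection"
      using rs by (simp add: K.m_assoc)
    then have "rotation \<otimes>\<^bsub>perms four_cycles\<^esub> (reflection \<otimes>\<^bsub>perms four_cycles\<^esub> rotation \<otimes>\<^bsub>perms four_cycles\<^esub> reflection) = \<one>\<^bsub>perms four_cycles\<^esub>" using rsr ss by simp
    then show "reflection \<otimes>\<^bsub>perms four_cycles\<^esub> rotation \<otimes>\<^bsub>perms four_cycles\<^esub> reflection \<otimes>\<^bsub>perms four_cycles\<^esub> rotation = \<one>\<^bsub>perms four_cycles\<^esub>"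
      by (rule K.inv_comm) (use rs in simp_all)
  qed (use rs in auto)
  have ns: "rotation [^]\<^bsub>perms four_cycles\<^esub> k \<noteq> reflection" for k :: int
  proof
    assume k: "rotation [^]\<^bsub>perms four_cycles\<^esub> k = reflection"
    have "reflection \<otimes>\<^bsub>perms four_cycles\<^esub> rotation = rotation \<otimes>\<^bsub>perms four_cycles\<^esub> reflection"
      using K.int_pow_mult[OF rotation_perms, of k 1] K.int_pow_mult[OF rotation_perms, of 1 k] rotation_perms k by (simp add: add.commute)
    then have "rotation \<otimes>\<^bsub>perms four_cycles\<^esub> rotation \<otimes>\<^bsub>perms four_cycles\<^esub> reflection = reflection" using rsr rs by (simp add: K.m_assoc)
    then have "rotation \<otimes>\<^bsub>perms four_cycles\<^esub> rotation = \<one>\<^bsub>perms four_cycles\<^esub>" using rs by simp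
    then show False using r2ne r2 by simp
  qed
  have gen: "\<exists>k::int. g = rotation [^]\<^bsub>perms four_cycles\<^esub> k \<or> g = rotation [^]\<^bsub>perms four_cycles\<^esub> k \<otimes>\<^bsub>perms four_cycles\<^esub> reflection" if g: "g \<in> carrier (perms four_cycles)" for g
  proof -
    have fixing: "c = \<one>\<^bsub>perms four_cycles\<^esub> \<or> c = reflection" if c: "c \<in> carrier (perms four_cycles)" "c y = y" for c
    proof -
      have cfy: "c (f y) \<in> four_cycles" by (rule fibre_permsD(4)[OF c(1) yC(2)])
      then have cE: "c (f y) \<in> E" using blockD(2)[OF block_four_cycles] by blast
      have "R y (c (f y))"
        using R_trans[OF perm_R[OF B f y] perm_R[OF block_four_cycles c(1) yC(2)] yE cE] .
      then consider "c (f y) = y" | "c (f y) = \<tau> y" | "c (f y) = f y" | "c (f y) = \<tau> (f y)"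
        using R_y_cases[OF cE] by blast
      then show ?thesis
      proof cases
        case 1
        then have "f y = y" using inj_onD[OF fibre_permsD(3)[OF c(1)], of "f y" y] c(2) yC by simp
        then show ?thesis using ffy tau_free[OF yE(1)] by simp
      next
        case 2
        then have "c (f y) = c (\<tau> y)" using perm_tau[OF block_four_cycles c(1) yC(1)] c(2) by simp
        then have "f y = \<tau> y" using inj_onD[OF fibre_permsD(3)[OF c(1)]] yC tC by blast
        then have "f (f y) = y" using perm_tau[OF B f y] tau_tau[OF yE(1)] by simp
        then show ?thesis using ffy tau_free[OF yE(1)] by simp
      next
        case 3
        then have "c = \<one>\<^bsub>perms four_cycles\<^esub>" by (intro perms_eqI) (simp_all add: c one yC)
        then show ?thesis ..
      next
        case 4
        then have "c = reflection" by (intro perms_eqI) (simp_all add: c reflection_perms reflection_even reflection_odd base_in_orbits)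
        then show ?thesis ..
      qed
    qed
    have gyE: "g y \<in> E" using fibre_permsD(4)[OF g yC(1)] blockD(2)[OF block_four_cycles] by blast
    have pw: "(rotation [^]\<^bsub>perms four_cycles\<^esub> (0::int)) y = y" "(rotation [^]\<^bsub>perms four_cycles\<^esub> (1::int)) y = f y"
        "(rotation [^]\<^bsub>perms four_cycles\<^esub> (2::int)) y = \<tau> y" "(rotation [^]\<^bsub>perms four_cycles\<^esub> (3::int)) y = \<tau> (f y)"
    proof -
      have i: "rotation [^]\<^bsub>perms four_cycles\<^esub> (2::int) = rotation \<otimes>\<^bsub>perms four_cycles\<^esub> rotation" "rotation [^]\<^bsub>perms four_cycles\<^esub> (3::int) = rotation \<otimes>\<^bsub>perms four_cycles\<^esub> rotation \<otimes>\<^bsub>perms four_cycles\<^esub> rotation"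
        using K.int_pow_mult[OF rotation_perms, of 1 1] K.int_pow_mult[OF rotation_perms, of 2 1] rotation_perms by simp_all
      show "(rotation [^]\<^bsub>perms four_cycles\<^esub> (0::int)) y = y" by (simp add: one yC)
      show "(rotation [^]\<^bsub>perms four_cycles\<^esub> (1::int)) y = f y" using rotation_perms by (simp add: rotation_apply yC)
      show "(rotation [^]\<^bsub>perms four_cycles\<^esub> (2::int)) y = \<tau> y" by (simp add: i rr yC)
      show "(rotation [^]\<^bsub>perms four_cycles\<^esub> (3::int)) y = \<tau> (f y)"
        unfolding i using mult[OF _ rotation_perms yC(1), of "rotation \<otimes>\<^bsub>perms four_cycles\<^esub> rotation"] rotation_perms rr[OF yC(2)] by (simp add: rotation_apply yC)
    qed
    have "R y (g y)" by (rule perm_R[OF block_four_cycles g yC(1)])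
    then have "g y = y \<or> g y = f y \<or> g y = \<tau> y \<or> g y = \<tau> (f y)" using R_y_cases[OF gyE] by blast
    then obtain k :: int where k: "g y = (rotation [^]\<^bsub>perms four_cycles\<^esub> k) y" using pw by metis
    define c where "c = inv\<^bsub>perms four_cycles\<^esub> (rotation [^]\<^bsub>perms four_cycles\<^esub> k) \<otimes>\<^bsub>perms four_cycles\<^esub> g"
    have rk: "rotation [^]\<^bsub>perms four_cycles\<^esub> k \<in> carrier (perms four_cycles)" using rotation_perms by simp
    have c: "c \<in> carrier (perms four_cycles)" using rk g by (simp add: c_def)
    have "c y = (inv\<^bsub>perms four_cycles\<^esub> (rotation [^]\<^bsub>perms four_cycles\<^esub> k)) ((rotation [^]\<^bsub>perms four_cycles\<^esub> k) y)"
      using mult[OF K.inv_closed[OF rk] g yC(1)] k by (simp add: c_def)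
    also have "\<dots> = y"
      using mult[OF K.inv_closed[OF rk] rk yC(1)] rk one[OF yC(1)] by simp
    finally have "c = \<one>\<^bsub>perms four_cycles\<^esub> \<or> c = reflection" using fixing[OF c] by blast
    moreover have "g = rotation [^]\<^bsub>perms four_cycles\<^esub> k \<otimes>\<^bsub>perms four_cycles\<^esub> c" using rk g by (simp add: c_def)
    ultimately show ?thesis using rk by auto
  qed
  show ?thesis
    using dihedral_iso[OF K.is_group _ rs \<open>K.ord rotation = 4\<close> ss srs ns gen] by simp
qed

end

text \<open>If some permutation has a nontrivial square, the block generated by its four-cycle contributes a factor
  \<open>D\<^sub>8\<close> and is removed; what remains in the end has exponent two.\<close>

theorem perms_iso: "block B \<Longrightarrow> \<exists>n1 n2. perms B \<cong> group_power C2 n1 \<times>\<times> group_power D8 n2"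
proof (induction "card B" arbitrary: B rule: less_induct)
  case less
  note B = less.prems
  interpret K: group "perms B" by (rule group_perms[OF B])
  show ?case
  proof (cases "\<forall>f\<in>carrier (perms B). \<forall>y\<in>B. f (f y) = y")
    case True
    have "f \<otimes>\<^bsub>perms B\<^esub> f = \<one>\<^bsub>perms B\<^esub>" if f: "f \<in> carrier (perms B)" for f
      unfolding fibre_perms_mult[OF f f] fibre_perms_one
      by (rule extensionalityI[of _ B]) (use True f in \<open>simp_all add: compose_eq\<close>)
    then obtain n where "perms B \<cong> group_power C2 n"
      using exponent_two_iso_C2_power[OF K.is_group finite_fibre_perms[OF blockD(5)[OF B]]] by blast
    then show ?thesis using DirProd_group_power_0_iso by blast
  next
    case False
    then obtain f y where f: "f \<in> carrier (perms B)" and y: "y \<in> B" and "f (f y) \<noteq> y" by blast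
    then have ffy: "f (f y) = \<tau> y" using perm_square_cases[OF B] by blast
    let ?four_cycles = "four_cycles f y"
    note bC = block_four_cycles[OF B f y ffy] and sub = four_cycles_sub[OF B f y ffy]
    have bD: "block (B - ?four_cycles)" by (rule block_Diff[OF B bC])
    have "y \<in> ?four_cycles" using base_in_orbits[OF B f y ffy] by (simp add: four_cycles_def[OF B f y ffy])
    then have "card (B - ?four_cycles) < card B"
      using y blockD(5)[OF B] by (intro psubset_card_mono) auto
    from less.hyps[OF this bD] obtain n1 n2 where
      IH: "perms (B - ?four_cycles) \<cong> group_power C2 n1 \<times>\<times> group_power D8 n2" by blast
    interpret KC: group "perms ?four_cycles" by (rule group_perms[OF bC])
    have gC2: "group (group_power C2 n)" and gD8: "group (group_power D8 n)" for n
      by (simp_all add: group_dihedral)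
    interpret gC2: group "group_power C2 n1" by (rule gC2)
    interpret gD8: group "group_power D8 n2" by (rule gD8)
    interpret d8: group D8 by (simp add: group_dihedral)
    interpret prod: group "group_power C2 n1 \<times>\<times> group_power D8 n2" by (rule DirProd_group[OF gC2 gD8])
    have "perms B \<cong> perms ?four_cycles \<times>\<times> perms (B - ?four_cycles)" by (rule perms_split[OF B bC sub])
    also have "perms ?four_cycles \<times>\<times> perms (B - ?four_cycles) \<cong> D8 \<times>\<times> (group_power C2 n1 \<times>\<times> group_power D8 n2)"
      by (rule KC.DirProd_iso_trans[OF perms_four_cycles_iso_D8[OF B f y ffy] IH])
    also have "\<dots> \<cong> (group_power C2 n1 \<times>\<times> group_power D8 n2) \<times>\<times> D8"
      by (rule DirProd_commute_iso)
    also have "\<dots> \<cong> group_power C2 n1 \<times>\<times> (group_power D8 n2 \<times>\<times> D8)"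
      by (rule DirProd_assoc_iso)
    also have "\<dots> \<cong> group_power C2 n1 \<times>\<times> (D8 \<times>\<times> group_power D8 n2)"
      by (rule gC2.DirProd_iso_trans[OF iso_refl DirProd_commute_iso])
    also have "\<dots> \<cong> group_power C2 n1 \<times>\<times> group_power D8 (Suc n2)"
      by (rule gC2.DirProd_iso_trans[OF iso_refl group_power_Suc_iso])
    finally show ?thesis by blast
  qed
qed

end

section \<open>The action of \<open>Out(G) \<times> S\<^sub>3\<close> on classes of triples\<close>

context group begin

lemma GT1_eq_fibre_perms: "GT1 G = fibre_perms (H_group G) (H_act G) (class_equiv G) (triple_classes G)"
  by (simp add: GT1_def fibre_perms_def)

lemma conjugate_conj_by: "h \<in> carrier G \<Longrightarrow> conjugate G (conj_by G x h) x"
  by (auto simp: conjugate_def)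

lemma class_equiv_theta_delta:
  assumes "c \<in> triple_classes G" "d \<in> triple_classes G" "class_equiv G c d"
  shows "class_equiv G (theta G ` c) (theta G ` d)" "class_equiv G (delta G ` c) (delta G ` d)"
proof -
  obtain x y z where t: "(x, y, z) \<in> triples G" "c = triple_class G (x, y, z)"
    using assms(1) by (rule triple_classesE3)
  obtain x' y' z' where t': "(x', y', z') \<in> triples G" "d = triple_class G (x', y', z')"
    using assms(2) by (rule triple_classesE3)
  have car: "x \<in> carrier G" "y \<in> carrier G" "z \<in> carrier G" "x' \<in> carrier G" "y' \<in> carrier G" "z' \<in> carrier G"
    using triples_carrier t(1) t'(1) by auto
  have e: "conjugate G x x'" "conjugate G y y'" "conjugate G z z'"
    using assms(3) by (simp_all add: t t' class_equiv_iff)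
  have cc: "conjugate G (conj_by G u h) (conj_by G u' h')"
    if "conjugate G u u'" "u \<in> carrier G" "u' \<in> carrier G" "h \<in> carrier G" "h' \<in> carrier G" for u u' h h'
    using conjugate_trans[OF conjugate_conj_by[OF that(4)]
        conjugate_trans[OF that(1) conjugate_sym[OF conjugate_conj_by[OF that(5)]]]]
      that by simp
  have th: "(y, x, conj_by G z x) \<in> triples G" "(y', x', conj_by G z' x') \<in> triples G"
    using theta_triples[OF t(1)] theta_triples[OF t'(1)] by (simp_all add: theta_def)
  show "class_equiv G (theta G ` c) (theta G ` d)"
    using class_equiv_iff[OF th] e cc[OF e(3)] car
    by (simp add: t t' theta_triple_class) (simp add: theta_def)
  have de: "(z, y, conj_by G x y) \<in> triples G" "(z', y', conj_by G x' y') \<in> triples G"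
    using delta_triples[OF t(1)] delta_triples[OF t'(1)] by (simp_all add: delta_def)
  show "class_equiv G (delta G ` c) (delta G ` d)"
    using class_equiv_iff[OF de] e cc[OF e(1)] car
    by (simp add: t t' delta_triple_class) (simp add: delta_def)
qed

lemma class_equiv_Out_act:
  assumes "A \<in> carrier (Out G)" "c \<in> triple_classes G" "d \<in> triple_classes G" "class_equiv G c d"
  shows "class_equiv G (Out_act A c) (Out_act A d)"
proof -
  obtain \<alpha> where a: "\<alpha> \<in> A" "\<alpha> \<in> auto G" using Out_coset(1,2)[OF assms(1)] by blast
  obtain x y z where t: "(x, y, z) \<in> triples G" "c = triple_class G (x, y, z)"
    using assms(2) by (rule triple_classesE3)
  obtain x' y' z' where t': "(x', y', z') \<in> triples G" "d = triple_class G (x', y', z')"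
    using assms(3) by (rule triple_classesE3)
  have car: "x' \<in> carrier G" "y' \<in> carrier G" "z' \<in> carrier G" using triples_carrier t'(1) by auto
  have cj: "conjugate G (\<alpha> u) (\<alpha> u')" if "conjugate G u u'" "u' \<in> carrier G" for u u'
    using that auto_conj_by[OF a(2)] autoD(3)[OF a(2)] by (auto simp: conjugate_def)
  have at: "(\<alpha> x, \<alpha> y, \<alpha> z) \<in> triples G" "(\<alpha> x', \<alpha> y', \<alpha> z') \<in> triples G"
    using auto_triples[OF a(2) t(1)] auto_triples[OF a(2) t'(1)] by (simp_all add: map_triple_def)
  have "conjugate G x x'" "conjugate G y y'" "conjugate G z z'"
    using assms(4) by (simp_all add: t t' class_equiv_iff)
  then have "class_equiv G (triple_class G (\<alpha> x, \<alpha> y, \<alpha> z)) (triple_class G (\<alpha> x', \<alpha> y', \<alpha> z'))"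
    using class_equiv_iff[OF at] cj car by simp
  then show ?thesis
    using Out_act_class[OF assms(1) a(1) t(1)] Out_act_class[OF assms(1) a(1) t'(1)]
    by (simp add: t t' map_triple_def)
qed

lemma class_equiv_H_act:
  assumes "h \<in> carrier (H_group G)" "c \<in> triple_classes G" "d \<in> triple_classes G" "class_equiv G c d"
  shows "class_equiv G (H_act G h c) (H_act G h d)"
proof -
  have "class_equiv G (S3_act G p c) (S3_act G p d)" for p
    using assms(2-4) by (simp add: S3_act_def class_equiv_theta_delta S3_relations)
  then have "class_equiv G (Out_act (fst h) (S3_act G (snd h) c)) (Out_act (fst h) (S3_act G (snd h) d))"
    using assms by (intro class_equiv_Out_act S3_act_closed) (auto simp: H_group_def)
  then show ?thesis using assms by (simp add: H_act_def)
qed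

lemma auto_eq_of_triple:
  assumes "\<alpha> \<in> auto G" "\<beta> \<in> auto G" "t \<in> triples G" "map_triple \<alpha> t = map_triple \<beta> t" "w \<in> carrier G"
  shows "\<alpha> w = \<beta> w"
proof -
  obtain x y z where t: "t = (x, y, z)" by (cases t)
  interpret a: group_hom G G \<alpha>
    using autoD(1)[OF assms(1)] by (simp add: group_hom_def group_hom_axioms_def is_group)
  interpret b: group_hom G G \<beta>
    using autoD(1)[OF assms(2)] by (simp add: group_hom_def group_hom_axioms_def is_group)
  have "subgroup {w \<in> carrier G. \<alpha> w = \<beta> w} G"
    by (rule subgroupI) auto
  moreover have "{x, y, z} \<subseteq> {w \<in> carrier G. \<alpha> w = \<beta> w}"
    using assms(3,4) triples_carrier[of x y z] by (simp add: t map_triple_def)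
  ultimately have "generate G {x, y, z} \<subseteq> {w \<in> carrier G. \<alpha> w = \<beta> w}"
    using generate_subgroup_incl by blast
  then show ?thesis using assms(3,5) by (auto simp: t triples_def)
qed

lemma triple_class_eqD:
  assumes "triple_class G t = triple_class G u" "t \<in> triples G"
  shows "\<exists>h\<in>carrier G. t = map_triple (\<lambda>g. conj_by G g h) u"
  using triple_class_self[OF assms(2)] unfolding assms(1) by (auto simp: triple_class_def)

definition outer_coset where "outer_coset \<alpha> = Inn G #>\<^bsub>AutoGroup G\<^esub> \<alpha>"

lemma outer_coset:
  assumes "\<alpha> \<in> auto G"
  shows "outer_coset \<alpha> \<in> carrier (Out G)" "\<alpha> \<in> outer_coset \<alpha>"
proof -
  interpret A: group "AutoGroup G" by (rule AutoGroup)
  show "outer_coset \<alpha> \<in> carrier (Out G)"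
    using assms by (auto simp: outer_coset_def Out_def FactGroup_def RCOSETS_def AutoGroup_simps)
  show "\<alpha> \<in> outer_coset \<alpha>"
    unfolding outer_coset_def
    using A.rcos_self[OF _ normal_imp_subgroup[OF Inn_normal]] assms by (simp add: AutoGroup_simps)
qed

lemma group_Out: "group (Out G)"
  unfolding Out_def by (rule normal.factorgroup_is_group[OF Inn_normal])

lemma outer_coset_H_group: "\<alpha> \<in> auto G \<Longrightarrow> (outer_coset \<alpha>, id) \<in> carrier (H_group G)"
  using outer_coset(1)[of \<alpha>] monoid.one_closed[OF group.is_monoid[OF sym_group_is_group[of 3]]]
  by (simp add: H_group_def sym_group_one)

lemma H_act_outer_coset:
  assumes "\<alpha> \<in> auto G" "t \<in> triples G"
  shows "H_act G (outer_coset \<alpha>, id) (triple_class G t) = triple_class G (map_triple \<alpha> t)"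
proof -
  have "triple_class G t \<in> triple_classes G" using assms(2) by (simp add: triple_classes_def)
  then show ?thesis
    using Out_act_class[OF outer_coset[OF assms(1)] assms(2)]
    by (simp add: H_act_def S3_act_simps)
qed

text \<open>The exponent of \<open>S\<^sub>3\<close> divides six, so only the outer automorphism survives, and its
  sixth power is the square of its third.\<close>

lemma H_act_sixth_power:
  assumes "h \<in> carrier (H_group G)" "t \<in> triples G"
  shows "\<exists>\<beta>\<in>auto G. H_act G (h [^]\<^bsub>H_group G\<^esub> (6::nat)) (triple_class G t) =
    triple_class G (map_triple \<beta> (map_triple \<beta> t))"
proof -
  interpret O: group "Out G" by (rule group_Out)
  interpret S: group "sym_group 3" by (rule sym_group_is_group)
  obtain A p where h: "h = (A, p)" "A \<in> carrier (Out G)" "p \<in> carrier (sym_group 3)"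
    using assms(1) by (auto simp: H_group_def)
  have pow: "(A, p) [^]\<^bsub>H_group G\<^esub> n = (A [^]\<^bsub>Out G\<^esub> n, p [^]\<^bsub>sym_group 3\<^esub> n)" for n :: nat
    by (induction n) (simp_all add: H_group_def nat_pow_def)
  have "Coset.order (sym_group 3) = 6"
    by (simp add: Coset.order_def sym_group_card_carrier fact_numeral)
  then have p6: "p [^]\<^bsub>sym_group 3\<^esub> (6::nat) = id"
    using S.pow_order_eq_1[OF h(3)] by (simp add: sym_group_one)
  define B where "B = A [^]\<^bsub>Out G\<^esub> (3::nat)"
  have B: "B \<in> carrier (Out G)" using h(2) by (simp add: B_def)
  have "A [^]\<^bsub>Out G\<^esub> (6::nat) = B \<otimes>\<^bsub>Out G\<^esub> B"
    using O.nat_pow_mult[OF h(2), of 3 3] by (simp add: B_def)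
  then have h6: "h [^]\<^bsub>H_group G\<^esub> (6::nat) = (B \<otimes>\<^bsub>Out G\<^esub> B, id)" by (simp add: h(1) pow p6)
  obtain \<beta> where b: "\<beta> \<in> B" "\<beta> \<in> auto G" using Out_coset(1,2)[OF B] by blast
  have c: "triple_class G t \<in> triple_classes G" using assms(2) by (simp add: triple_classes_def)
  have "H_act G (h [^]\<^bsub>H_group G\<^esub> (6::nat)) (triple_class G t) = Out_act B (Out_act B (triple_class G t))"
    using c by (simp add: h6 H_act_def S3_act_simps Out_act_mult[OF B B])
  then show ?thesis
    using b by (simp add: Out_act_class[OF B b(1)] assms(2) auto_triples bexI[of _ \<beta>])
qed

end

section \<open>The group \<open>GT\<^sub>1\<close> of \<open>PSL(2, q)\<close>\<close>

text \<open>The third member of a triple is the inverse of the product of the other two, so it is enough to move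
  those.\<close>

lemma psl_conj_triple_eqI:
  fixes A B A' B' :: "'k::field ^ 2 ^ 2"
  assumes t: "(psl A, psl B, z) \<in> triples PSL" and t': "(psl A', psl B', z') \<in> triples PSL"
    and det: "det A = 1" "det B = 1" "det A' = 1" "det B' = 1"
    and trace: "trace A = trace A'" "trace B = trace B'" "trace (A ** B) = trace (A' ** B')"
  shows "\<exists>g. det g \<noteq> 0 \<and> map_triple (psl_conj g) (psl A, psl B, z) = (psl A', psl B', z')"
proof -
  interpret G: group "PSL :: ('k ^ 2 ^ 2) set monoid" by (rule group_PSL)
  have "\<exists>g. det g \<noteq> 0 \<and> g ** A = A' ** g \<and> g ** B = B' ** g"
    by (rule simultaneously_similar[OF det trace triple_irreducible(1)[OF t det(1,2)] _
          triple_irreducible(1)[OF t' det(3,4)]])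
      (rule triple_irreducible(2)[OF t det(1,2)])
  then obtain g where g: "det g \<noteq> 0" "g ** A = A' ** g" "g ** B = B' ** g" by blast
  have AB: "psl_conj g (psl A) = psl A'" "psl_conj g (psl B) = psl B'"
    using psl_conj_eqI[OF det(1) g(1,2)] psl_conj_eqI[OF det(2) g(1,3)] .
  have au: "psl_conj g \<in> auto PSL" by (rule psl_conj_auto[OF g(1)])
  have c: "psl A \<otimes>\<^bsub>PSL\<^esub> psl B \<otimes>\<^bsub>PSL\<^esub> w = \<one>\<^bsub>PSL\<^esub> \<Longrightarrow> w \<in> carrier PSL \<Longrightarrow> w = inv\<^bsub>PSL\<^esub> (psl A \<otimes>\<^bsub>PSL\<^esub> psl B)"
    if "det A = 1" "det B = 1" for A B :: "'k ^ 2 ^ 2" and w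
    by (rule G.triple_inv(1)[OF _ psl_closed[OF that(1)] psl_closed[OF that(2)]])
  have "(psl A', psl B', psl_conj g z) \<in> triples PSL"
    using G.auto_triples[OF au t] by (simp add: map_triple_def AB)
  then have "psl_conj g z = inv\<^bsub>PSL\<^esub> (psl A' \<otimes>\<^bsub>PSL\<^esub> psl B')"
    using c[OF det(3,4), of "psl_conj g z"] by (simp only: triples_def mem_Collect_eq prod.case)
  also have "\<dots> = z'"
    using c[OF det(3,4), of z'] t' by (simp only: triples_def mem_Collect_eq prod.case)
  finally have "map_triple (psl_conj g) (psl A, psl B, z) = (psl A', psl B', z')"
    by (simp only: map_triple_def prod.case AB)
  then show ?thesis using g(1) by blast
qed

lemma triple_class_psl_conj_square:
  fixes g :: "'k::field ^ 2 ^ 2"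
  assumes "t \<in> triples PSL" "det g = s ^ 2" "det g \<noteq> 0"
  shows "triple_class PSL (map_triple (psl_conj g) t) = triple_class PSL t"
proof -
  interpret G: group "PSL :: ('k ^ 2 ^ 2) set monoid" by (rule group_PSL)
  have "s \<noteq> 0" using assms(2,3) by auto
  then obtain h where h: "h \<in> carrier PSL" "\<And>W. W \<in> carrier PSL \<Longrightarrow> psl_conj g W = conj_by PSL W h"
    using psl_conj_square_inner[OF assms(2)] by blast
  have "map_triple (psl_conj g) t = map_triple (\<lambda>W. conj_by PSL W h) t"
    using assms(1) h(2) by (cases t) (auto simp: map_triple_def triples_def)
  then show ?thesis using G.triple_class_conj[OF assms(1) h(1)] by simp
qed

lemma map_triple_psl_conj:
  assumes "det g \<noteq> 0" "det h \<noteq> 0" "t \<in> triples PSL"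
  shows "map_triple (psl_conj g) (map_triple (psl_conj h) t) = map_triple (psl_conj (g ** h)) t"
  using assms by (cases t) (auto simp: map_triple_def triples_def psl_conj_mult)

text \<open>The trace is defined on \<open>PSL\<close> only up to sign.\<close>

lemma conjugate_psl_trace:
  fixes A A' :: "'k::field ^ 2 ^ 2"
  assumes "conjugate PSL (psl A) (psl A')" "det A = 1" "det A' = 1"
  shows "trace A = trace A' \<or> trace A = - trace A'"
proof -
  obtain h where h: "h \<in> carrier PSL" "psl A = conj_by PSL (psl A') h"
    using assms(1) by (auto simp: conjugate_def)
  obtain H where H: "det H = 1" "h = psl H" by (rule psl_cases[OF h(1)])
  let ?H = "matrix_inv H"
  have d: "det ?H \<noteq> 0" using H(1) by (simp add: det_matrix_inv)
  have "psl A = psl_conj ?H (psl A')"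
    using h(2) conj_by_psl[OF H(1) psl_closed[OF assms(3)]] by (simp add: H(2))
  then have "A = ?H ** A' ** matrix_inv ?H \<or> A = - (?H ** A' ** matrix_inv ?H)"
    by (simp add: psl_conj_psl[OF assms(3)] psl_eq_iff)
  moreover have "trace (?H ** A' ** matrix_inv ?H) = trace A'"
    using trace_mul_sym[of "?H ** A'" "matrix_inv ?H"] matrix_inv_mult(2)[OF d]
    by (simp add: matrix_mul_assoc)
  ultimately show ?thesis by (auto simp: trace_uminus)
qed

lemma conjugate_psl_lift:
  fixes A :: "'k::field ^ 2 ^ 2"
  assumes "conjugate PSL (psl A) w" "det A = 1" "w \<in> carrier PSL"
  shows "\<exists>A'. det A' = 1 \<and> w = psl A' \<and> trace A' = trace A"
proof -
  obtain M where M: "det M = 1" "w = psl M" by (rule psl_cases[OF assms(3)])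
  then have "trace A = trace M \<or> trace A = - trace M" using conjugate_psl_trace assms by blast
  moreover have "psl M = psl (- M)" by (auto simp: psl_eq)
  ultimately show ?thesis using M by (metis det_uminus22 trace_uminus)
qed

text \<open>The representatives of the first two members can be negated independently, which makes their traces agree.
  The third member is the inverse of the product, whose trace is then fixed up to sign.\<close>

lemma class_equiv_lifts:
  fixes A B :: "'k::field ^ 2 ^ 2"
  assumes t: "(psl A, psl B, z) \<in> triples PSL" and det: "det A = 1" "det B = 1"
    and d: "d \<in> triple_classes PSL" "class_equiv PSL (triple_class PSL (psl A, psl B, z)) d"
  shows "\<exists>A' B' z'. det A' = 1 \<and> det B' = 1 \<and> (psl A', psl B', z') \<in> triples PSL \<and>
    d = triple_class PSL (psl A', psl B', z') \<and> trace A' = trace A \<and> trace B' = trace B \<and>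
    (trace (A' ** B') = trace (A ** B) \<or> trace (A' ** B') = - trace (A ** B))"
proof -
  interpret G: group "PSL :: ('k ^ 2 ^ 2) set monoid" by (rule group_PSL)
  obtain x' y' z' where t': "(x', y', z') \<in> triples PSL" "d = triple_class PSL (x', y', z')"
    using d(1) by (rule G.triple_classesE3)
  have c: "conjugate PSL (psl A) x'" "conjugate PSL (psl B) y'" "conjugate PSL z z'"
    using d(2) G.class_equiv_iff[OF t t'(1)] by (simp_all add: t'(2))
  have car: "x' \<in> carrier PSL" "y' \<in> carrier PSL" "z' \<in> carrier PSL" "z \<in> carrier PSL"
    using G.triples_carrier[OF t'(1)] G.triples_carrier[OF t] by auto
  obtain A' where A': "det A' = 1" "x' = psl A'" "trace A' = trace A"
    using conjugate_psl_lift[OF c(1) det(1) car(1)] by blast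
  obtain B' where B': "det B' = 1" "y' = psl B'" "trace B' = trace B"
    using conjugate_psl_lift[OF c(2) det(2) car(2)] by blast
  have prod: "inv\<^bsub>PSL\<^esub> w = psl (C ** D)" if "(psl C, psl D, w) \<in> triples PSL" "det C = 1" "det D = 1"
    for C D :: "'k ^ 2 ^ 2" and w
  proof -
    have e: "psl C \<otimes>\<^bsub>PSL\<^esub> psl D \<otimes>\<^bsub>PSL\<^esub> w = \<one>\<^bsub>PSL\<^esub>" and w: "w \<in> carrier PSL"
      using that(1) by (auto simp: triples_def)
    have "w = inv\<^bsub>PSL\<^esub> (psl C \<otimes>\<^bsub>PSL\<^esub> psl D)"
      by (rule G.triple_inv(1)[OF e psl_closed[OF that(2)] psl_closed[OF that(3)] w])
    then show ?thesis using that(2,3) by (simp add: psl_mult det_mul)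
  qed
  have "conjugate PSL (inv\<^bsub>PSL\<^esub> z) (inv\<^bsub>PSL\<^esub> z')"
  proof -
    obtain h where h: "h \<in> carrier PSL" "z = conj_by PSL z' h" using c(3) by (auto simp: conjugate_def)
    have "inv\<^bsub>PSL\<^esub> (conj_by PSL z' h) = conj_by PSL (inv\<^bsub>PSL\<^esub> z') h"
      using h(1) car(3) by (simp add: conj_by_def G.inv_mult_group G.m_assoc)
    then show ?thesis using h by (auto simp: conjugate_def)
  qed
  then have "conjugate PSL (psl (A ** B)) (psl (A' ** B'))"
    using prod[OF t det] prod[of A' B' z'] t'(1) A' B' by simp
  then have "trace (A ** B) = trace (A' ** B') \<or> trace (A ** B) = - trace (A' ** B')"
    by (rule conjugate_psl_trace) (simp_all add: det_mul det A' B')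
  then have "trace (A' ** B') = trace (A ** B) \<or> trace (A' ** B') = - trace (A ** B)" by auto
  then show ?thesis using A' B' t' by blast
qed

lemma triple_classes_psl_cases:
  fixes c :: "(('k::field ^ 2 ^ 2) set \<times> ('k ^ 2 ^ 2) set \<times> ('k ^ 2 ^ 2) set) set"
  assumes "c \<in> triple_classes PSL"
  obtains A B z where "det A = 1" "det B = 1" "(psl A, psl B, z) \<in> triples PSL"
    "c = triple_class PSL (psl A, psl B, z)"
proof -
  interpret G: group "PSL :: ('k ^ 2 ^ 2) set monoid" by (rule group_PSL)
  obtain x y z where t: "(x, y, z) \<in> triples PSL" "c = triple_class PSL (x, y, z)"
    using assms by (rule G.triple_classesE3)
  have "x \<in> carrier PSL" "y \<in> carrier PSL" using G.triples_carrier[OF t(1)] by auto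
  then obtain A B where "det A = 1" "x = psl A" "det B = 1" "y = psl B" by (meson psl_cases)
  then show ?thesis using that t by blast
qed

text \<open>Without signs the three traces of equivalent classes agree, and the matrix conjugating one triple into the
  other has a square as its determinant.  So equivalent classes are equal.\<close>

theorem GT1_PSL_char_2_trivial:
  assumes "(2 :: 'k::{field,finite}) = 0"
  shows "trivial_group (GT1 (PSL :: ('k ^ 2 ^ 2) set monoid))"
proof -
  let ?G = "PSL :: ('k ^ 2 ^ 2) set monoid"
  interpret G: group ?G by (rule group_PSL)
  interpret GT: group "GT1 ?G" by (rule G.group_GT1)
  have minus: "- u = u" for u :: 'k
    using assms by (metis add_eq_0_iff mult_2 mult_zero_left)
  have eq: "c = d" if c: "c \<in> triple_classes ?G" and d: "d \<in> triple_classes ?G" "class_equiv ?G c d" for c d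
  proof -
    obtain A B :: "'k ^ 2 ^ 2" and z where AB: "det A = 1" "det B = 1" "(psl A, psl B, z) \<in> triples PSL"
      "c = triple_class PSL (psl A, psl B, z)" by (rule triple_classes_psl_cases[OF c])
    obtain A' B' :: "'k ^ 2 ^ 2" and z' where AB': "det A' = 1" "det B' = 1" "(psl A', psl B', z') \<in> triples PSL"
      "d = triple_class PSL (psl A', psl B', z')" "trace A' = trace A" "trace B' = trace B"
      "trace (A' ** B') = trace (A ** B)"
      using class_equiv_lifts[OF AB(3,1,2) d(1)] d(2) AB(4) minus by metis
    obtain g where g: "det g \<noteq> 0" "map_triple (psl_conj g) (psl A, psl B, z) = (psl A', psl B', z')"
      using psl_conj_triple_eqI[OF AB(3) AB'(3) AB(1,2) AB'(1,2)] AB'(5-7) by metis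
    obtain s where "det g = s ^ 2" using square_char_2[OF assms] by blast
    from triple_class_psl_conj_square[OF AB(3) this g(1)] show ?thesis
      by (simp add: g(2) AB(4) AB'(4))
  qed
  have "\<phi> = \<one>\<^bsub>GT1 ?G\<^esub>" if \<phi>: "\<phi> \<in> carrier (GT1 ?G)" for \<phi>
  proof -
    note P = fibre_permsD[OF \<phi>[unfolded G.GT1_eq_fibre_perms]]
    show ?thesis
      unfolding G.GT1_eq_fibre_perms fibre_perms_one
      by (rule extensionalityI[OF P(1)]) (use eq P(4,6) in \<open>simp_all\<close>)
  qed
  then have "carrier (GT1 ?G) = {\<one>\<^bsub>GT1 ?G\<^esub>}" using GT.one_closed by blast
  then show ?thesis by (simp add: trivial_group_def GT.is_group)
qed

text \<open>Automorphisms that agree on a generating triple are equal.  If the two classes were the same, the square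
  of \<open>\<beta>\<close> would therefore be conjugation by an element of \<open>SL\<close> times
  \<open>\<delta>\<close>.  For \<open>\<beta>\<close> the identity, this says that \<open>\<delta>\<close> fixes no
  class.\<close>

lemma no_square_root_of_nonsquare_conj:
  fixes \<delta> :: "'k::{field,finite} ^ 2 ^ 2"
  assumes two: "(2 :: 'k) \<noteq> 0" and \<delta>: "\<And>s. det \<delta> \<noteq> s ^ 2" and t: "t \<in> triples PSL" and \<beta>: "\<beta> \<in> auto PSL"
  shows "triple_class PSL (map_triple \<beta> (map_triple \<beta> t)) \<noteq> triple_class PSL (map_triple (psl_conj \<delta>) t)"
proof
  interpret G: group "PSL :: ('k ^ 2 ^ 2) set monoid" by (rule group_PSL)
  interpret A: group "AutoGroup (PSL :: ('k ^ 2 ^ 2) set monoid)" by (rule G.AutoGroup)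
  have d0: "det \<delta> \<noteq> 0" using \<delta>[of 0] by simp
  have bb: "compose (carrier PSL) \<beta> \<beta> \<in> auto PSL"
    using A.m_closed[of \<beta> \<beta>] \<beta> by (simp add: G.AutoGroup_simps)
  have bt: "map_triple \<beta> (map_triple \<beta> t) = map_triple (compose (carrier PSL) \<beta> \<beta>) t"
    using t by (cases t) (simp add: map_triple_def triples_def compose_eq)
  assume "triple_class PSL (map_triple \<beta> (map_triple \<beta> t)) = triple_class PSL (map_triple (psl_conj \<delta>) t)"
  then obtain h where h: "h \<in> carrier PSL"
      "map_triple \<beta> (map_triple \<beta> t) = map_triple (\<lambda>g. conj_by PSL g h) (map_triple (psl_conj \<delta>) t)"
    using G.triple_class_eqD[OF _ G.auto_triples[OF \<beta> G.auto_triples[OF \<beta> t]]] by blast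
  obtain H where H: "det H = 1" "h = psl H" by (rule psl_cases[OF h(1)])
  let ?g = "matrix_inv H ** \<delta>"
  have dH: "det (matrix_inv H) = 1" using H(1) by (simp add: det_matrix_inv)
  have dg: "det ?g = det \<delta>" by (simp add: det_mul dH)
  have "map_triple (\<lambda>g. conj_by PSL g h) (map_triple (psl_conj \<delta>) t) = map_triple (psl_conj ?g) t"
  proof -
    obtain x y z where xyz: "t = (x, y, z)" by (cases t)
    have "conj_by PSL (psl_conj \<delta> W) h = psl_conj ?g W" if W: "W \<in> carrier PSL" for W
      using psl_conj_mult[of "matrix_inv H" \<delta> W] conj_by_psl[OF H(1) psl_conj_closed[OF d0 W]] dH d0 W
      by (simp add: H(2))
    then show ?thesis using G.triples_carrier[of x y z] t by (simp add: xyz map_triple_def)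
  qed
  then have "map_triple (compose (carrier PSL) \<beta> \<beta>) t = map_triple (psl_conj ?g) t" using h(2) bt by simp
  then have "\<beta> (\<beta> W) = psl_conj ?g W" if "W \<in> carrier PSL" for W
    using G.auto_eq_of_triple[OF bb psl_conj_auto t _ that, of ?g] that d0 dg by (simp add: compose_eq)
  then have "\<exists>s. det ?g = s ^ 2"
    using auto_squared_psl_conj_imp_square[OF two \<beta>, of ?g] d0 dg by simp
  then show False using \<delta> dg by simp
qed

text \<open>The involution \<open>\<tau>\<close> is induced by a diagonal matrix with a non-square determinant.
  Equivalent classes with the same traces differ by a matrix in \<open>GL\<close>, and so, according to its
  determinant, either agree or are exchanged by \<open>\<tau>\<close>; as the trace of the product takes at most two
  values on a fibre, there are at most two orbits of \<open>\<tau>\<close> in it.\<close>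

theorem GT1_PSL_odd:
  assumes two: "(2 :: 'k::{field,finite}) \<noteq> 0"
  shows "\<exists>n1 n2. GT1 (PSL :: ('k ^ 2 ^ 2) set monoid) \<cong> group_power C2 n1 \<times>\<times> group_power D8 n2"
proof -
  let ?G = "PSL :: ('k ^ 2 ^ 2) set monoid"
  interpret G: group ?G by (rule group_PSL)
  \<comment> \<open>Any non-square will do: the products of two of them are squares.\<close>
  obtain e :: 'k where e: "\<And>s. e \<noteq> s ^ 2" using nonsquare_exists[OF two] by blast
  define \<delta> where "\<delta> = mat22 e 0 0 1"
  have \<delta>: "det \<delta> = e" by (simp add: \<delta>_def mat22_simps)
  have e0: "e \<noteq> 0" using e[of 0] by simp
  have \<delta>0: "det \<delta> \<noteq> 0" using \<delta> e0 by simp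
  define h0 where "h0 = (G.outer_coset (psl_conj \<delta>), id :: nat \<Rightarrow> nat)"
  have au: "psl_conj \<delta> \<in> auto PSL" by (rule psl_conj_auto[OF \<delta>0])
  have tau: "H_act ?G h0 (triple_class PSL t) = triple_class PSL (map_triple (psl_conj \<delta>) t)"
    if "t \<in> triples PSL" for t
    using G.H_act_outer_coset[OF au that] by (simp add: h0_def)
  have dt: "map_triple (psl_conj \<delta>) t \<in> triples PSL" if "t \<in> triples PSL" for t
    by (rule G.auto_triples[OF au that])
  have tautau: "H_act ?G h0 (H_act ?G h0 c) = c" if c: "c \<in> triple_classes PSL" for c
  proof -
    obtain t where t: "t \<in> triples PSL" "c = triple_class PSL t" using c by (auto simp: triple_classes_def)
    have "det (\<delta> ** \<delta>) = e ^ 2" by (simp add: det_mul \<delta> power2_eq_square)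
    then show ?thesis
      using triple_class_psl_conj_square[OF t(1), of "\<delta> ** \<delta>" e] e0
      by (simp add: t tau dt map_triple_psl_conj \<delta>0)
  qed
  have pair: "d \<in> {c, H_act ?G h0 c}"
    if t: "(psl A, psl B, z) \<in> triples PSL" "(psl A', psl B', z') \<in> triples PSL"
      and cd: "c = triple_class PSL (psl A, psl B, z)" "d = triple_class PSL (psl A', psl B', z')"
      and det: "det A = 1" "det B = 1" "det A' = 1" "det B' = 1"
      and tr: "trace A = trace A'" "trace B = trace B'" "trace (A ** B) = trace (A' ** B')"
    for A B A' B' :: "'k ^ 2 ^ 2" and z z' c d
  proof -
    obtain g where g: "det g \<noteq> 0" "map_triple (psl_conj g) (psl A, psl B, z) = (psl A', psl B', z')"
      using psl_conj_triple_eqI[OF t det tr] by blast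
    show ?thesis
    proof (cases "\<exists>s. det g = s ^ 2")
      case True
      then show ?thesis using triple_class_psl_conj_square[OF t(1) _ g(1)] g(2) cd by auto
    next
      case False
      then obtain s where s: "e * det g = s ^ 2" using nonsquare_mult_nonsquare[of e "det g"] e by blast
      have "triple_class PSL (map_triple (psl_conj (\<delta> ** g)) (psl A, psl B, z)) = c"
        unfolding cd by (rule triple_class_psl_conj_square[OF t(1), of _ s])
          (simp add: det_mul \<delta> s, simp add: det_mul \<delta> e0 g(1))
      then have "H_act ?G h0 d = c"
        using tau[OF t(2)] map_triple_psl_conj[OF \<delta>0 g(1) t(1)] g(2) cd(2) by simp
      moreover have "d \<in> triple_classes PSL" using t(2) cd(2) by (simp add: triple_classes_def)
      ultimately show ?thesis using tautau[of d] by auto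
    qed
  qed
  have no_root: "triple_class PSL (map_triple \<beta> (map_triple \<beta> t)) \<noteq> H_act ?G h0 (triple_class PSL t)"
    if "t \<in> triples PSL" "\<beta> \<in> auto PSL" for t \<beta>
    unfolding tau[OF that(1)]
    by (rule no_square_root_of_nonsquare_conj[OF two _ that]) (simp add: \<delta> e)
  interpret act: group_action "H_group ?G" "triple_classes ?G" "H_act ?G" by (rule G.H_action)
  interpret F: paired_fibres "H_group ?G" "triple_classes ?G" "H_act ?G" "class_equiv ?G" h0
  proof unfold_locales
    show "finite (triple_classes ?G)" by simp
    show "h0 \<in> carrier (H_group ?G)"
      unfolding h0_def by (rule G.outer_coset_H_group[OF au])
    fix c assume c: "c \<in> triple_classes ?G"
    then obtain t where t: "t \<in> triples PSL" "c = triple_class PSL t" by (auto simp: triple_classes_def)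
    show "class_equiv ?G c c" by (rule G.class_equiv_refl[OF c])
    show "H_act ?G h0 (H_act ?G h0 c) = c" by (rule tautau[OF c])
    show "H_act ?G h0 c \<noteq> c"
    proof -
      let ?id = "\<lambda>W\<in>carrier ?G. W"
      have "?id \<in> auto ?G"
        using monoid.one_closed[OF group.is_monoid[OF G.AutoGroup]] by (simp only: G.AutoGroup_simps)
      moreover have "map_triple ?id t = t"
        using t(1) by (cases t) (simp add: map_triple_def triples_def)
      ultimately show ?thesis using no_root[OF t(1), of ?id] t(2) by simp
    qed
    fix h assume h: "h \<in> carrier (H_group ?G)"
    show "H_act ?G (h [^]\<^bsub>H_group ?G\<^esub> (6::nat)) c \<noteq> H_act ?G h0 c"
      using G.H_act_sixth_power[OF h t(1)] no_root[OF t(1)] t(2) by metis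
  next
    fix c d assume "class_equiv ?G c d" "c \<in> triple_classes ?G" "d \<in> triple_classes ?G"
    then show "class_equiv ?G d c" by (rule G.class_equiv_sym)
    fix h assume "h \<in> carrier (H_group ?G)"
    then show "class_equiv ?G (H_act ?G h c) (H_act ?G h d)"
      using G.class_equiv_H_act \<open>class_equiv ?G c d\<close> \<open>c \<in> _\<close> \<open>d \<in> _\<close> by blast
  next
    fix c d b assume "class_equiv ?G c d" "class_equiv ?G d b" "c \<in> triple_classes ?G"
      "d \<in> triple_classes ?G" "b \<in> triple_classes ?G"
    then show "class_equiv ?G c b" by (rule G.class_equiv_trans)
  next
    fix c d b assume eq: "class_equiv ?G c d" "class_equiv ?G c b" and c: "c \<in> triple_classes ?G"
      and db: "d \<in> triple_classes ?G" "b \<in> triple_classes ?G"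
    obtain A B :: "'k ^ 2 ^ 2" and z where AB: "det A = 1" "det B = 1" "(psl A, psl B, z) \<in> triples PSL"
      "c = triple_class PSL (psl A, psl B, z)" by (rule triple_classes_psl_cases[OF c])
    obtain A1 B1 :: "'k ^ 2 ^ 2" and z1 where 1: "det A1 = 1" "det B1 = 1" "(psl A1, psl B1, z1) \<in> triples PSL"
      "d = triple_class PSL (psl A1, psl B1, z1)" "trace A1 = trace A" "trace B1 = trace B"
      "trace (A1 ** B1) = trace (A ** B) \<or> trace (A1 ** B1) = - trace (A ** B)"
      using class_equiv_lifts[OF AB(3,1,2) db(1)] eq(1) AB(4) by blast
    obtain A2 B2 :: "'k ^ 2 ^ 2" and z2 where 2: "det A2 = 1" "det B2 = 1" "(psl A2, psl B2, z2) \<in> triples PSL"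
      "b = triple_class PSL (psl A2, psl B2, z2)" "trace A2 = trace A" "trace B2 = trace B"
      "trace (A2 ** B2) = trace (A ** B) \<or> trace (A2 ** B2) = - trace (A ** B)"
      using class_equiv_lifts[OF AB(3,1,2) db(2)] eq(2) AB(4) by blast
    consider "trace (A1 ** B1) = trace (A ** B)" | "trace (A2 ** B2) = trace (A ** B)"
      | "trace (A2 ** B2) = trace (A1 ** B1)" using 1(7) 2(7) by auto
    then show "d \<in> {c, H_act ?G h0 c} \<or> b \<in> {c, H_act ?G h0 c} \<or> b \<in> {d, H_act ?G h0 d}"
    proof cases
      case a: 1
      have "d \<in> {c, H_act ?G h0 c}"
        by (rule pair[OF AB(3) 1(3) AB(4) 1(4)]) (use a AB 1 in simp_all)
      then show ?thesis by blast
    next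
      case a: 2
      have "b \<in> {c, H_act ?G h0 c}"
        by (rule pair[OF AB(3) 2(3) AB(4) 2(4)]) (use a AB 2 in simp_all)
      then show ?thesis by blast
    next
      case a: 3
      have "b \<in> {d, H_act ?G h0 d}"
        by (rule pair[OF 1(3) 2(3) 1(4) 2(4)]) (use a 1 2 in simp_all)
      then show ?thesis by blast
    qed
  qed
  show ?thesis unfolding G.GT1_eq_fibre_perms by (rule F.perms_iso[OF F.block_E])
qed

theorem theorem1p1:
  shows "(\<forall>s::nat. s \<ge> 1 \<and> CARD('k::{field,finite}) = 2 ^ s \<longrightarrow>
            trivial_group (GT1 (PSL :: ('k ^ 2 ^ 2) set monoid)))
       \<and> (\<forall>p s::nat. Factorial_Ring.prime p \<and> odd p \<and> s \<ge> 1 \<and> CARD('k) = p ^ s \<longrightarrow>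
            (\<exists>n1 n2::nat. GT1 (PSL :: ('k ^ 2 ^ 2) set monoid)
               \<cong> group_power C2 n1 \<times>\<times> group_power D8 n2))"
proof (intro conjI allI impI)
  have char: "Factorial_Ring.prime CHAR('k)"
    by (rule prime_CHAR_semidom) (rule finite_imp_CHAR_pos, simp)
  {
    fix s :: nat assume s: "s \<ge> 1 \<and> CARD('k) = 2 ^ s"
    have "CHAR('k) dvd 2 ^ s" using CHAR_dvd_CARD[where 'a = 'k] s by simp
    then have "CHAR('k) = 2"
      using char prime_dvd_power primes_dvd_imp_eq two_is_prime_nat by blast
    then have "(2 :: 'k) = 0" using of_nat_CHAR[where 'a = 'k] by simp
    then show "trivial_group (GT1 (PSL :: ('k ^ 2 ^ 2) set monoid))" by (rule GT1_PSL_char_2_trivial)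
  next
    fix p s :: nat assume p: "Factorial_Ring.prime p \<and> odd p \<and> s \<ge> 1 \<and> CARD('k) = p ^ s"
    have "(2 :: 'k) \<noteq> 0"
    proof
      assume "(2 :: 'k) = 0"
      then have "of_nat 2 = (0 :: 'k)" by simp
      then have "CHAR('k) dvd 2" by (simp only: of_nat_eq_0_iff_char_dvd)
      then have "CHAR('k) = 2" using char primes_dvd_imp_eq two_is_prime_nat by blast
      then have "2 dvd p ^ s" using CHAR_dvd_CARD[where 'a = 'k] p by simp
      then show False using p by simp
    qed
    then show "\<exists>n1 n2::nat. GT1 (PSL :: ('k ^ 2 ^ 2) set monoid) \<cong> group_power C2 n1 \<times>\<times> group_power D8 n2"
      by (rule GT1_PSL_odd)
  }
qed

end
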